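(* Let $N\ge 2$ and fix a finite generating set of $\mathrm{SL}(N,\mathbb{Z})$. The probability that a random word of length $L$ in the generating set has characteristic polynomial with Galois group (over $\mathbb{Q}$) the full symmetric group $S_N$ tends to $1$ as $L\to\infty$.
   Context: A random word of length $L$ in a generating set $\{g_1,\dots,g_k\}$ is the product $g_{i_1}g_{i_2}\cdots g_{i_L}$ with indices chosen independently and uniformly from $\{1,\dots,k\}$. The Galois group of a polynomial of degree $N$ is that of its splitting field over $\mathbb{Q}$, viewed as a permutation group of the roots. *)

theory Defs
  imports
    "HOL-Algebra.Bij"
    "HOL-Algebra.Generated_Groups"
    "HOL-Algebra.Generated_Fields"
    "HOL-Algebra.Algebraic_Closure_Type"
    "HOL-Probability.Probability_Mass_Function"
    "Jordan_Normal_Form.Char_Poly"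
begin

definition SL :: "nat \<Rightarrow> 'a :: comm_ring_1 mat monoid" where
  "SL N = \<lparr>carrier = {A \<in> carrier_mat N N. Determinant.det A = 1},
           monoid.mult = (*), one = 1\<^sub>m N\<rparr>"

lemma group_SL: "group (SL N :: 'a :: comm_ring_1 mat monoid)"
proof (rule groupI)
  fix A :: "'a mat" assume A: "A \<in> carrier (SL N)"
  then have Ac: "A \<in> carrier_mat N N" and dA: "Determinant.det A = 1"
    by (auto simp: SL_def)
  note adj = adj_mat[OF Ac]
  have "Determinant.det (adj_mat A) * Determinant.det A = Determinant.det (1\<^sub>m N :: 'a mat)"
    using adj dA Ac det_mult[OF adj(1) Ac] by simp
  then have "adj_mat A \<in> carrier (SL N)" "adj_mat A * A = 1\<^sub>m N"
    using adj dA by (auto simp: SL_def)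
  then show "\<exists>B\<in>carrier (SL N). B \<otimes>\<^bsub>SL N\<^esub> A = \<one>\<^bsub>SL N\<^esub>"
    by (auto simp: SL_def)
qed (auto simp: SL_def det_mult)

text \<open>The product \<open>g\<^sub>1 g\<^sub>2 \<dots> g\<^sub>L\<close> of the letters of a word; the size \<open>N\<close> is needed for
  the empty word.\<close>

definition word_product :: "nat \<Rightarrow> 'a :: comm_ring_1 mat list \<Rightarrow> 'a mat" where
  "word_product N ws = foldr (*) ws (1\<^sub>m N)"

text \<open>The distribution of the letters of a random word of length \<open>L\<close> in \<open>S\<close>: they are
  independent and uniform on \<open>S\<close>.\<close>

definition random_letters :: "'a set \<Rightarrow> nat \<Rightarrow> 'a list pmf" where
  "random_letters S L = replicate_pmf L (pmf_of_set S)"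

definition complex_roots_of :: "rat poly \<Rightarrow> complex set" where
  "complex_roots_of p = {z. poly (map_poly of_rat p) z = 0}"

definition splitting_field :: "rat poly \<Rightarrow> complex ring" where
  "splitting_field p =
     ring_of_type_algebra
       \<lparr>carrier := generate_field ring_of_type_algebra (\<rat> \<union> complex_roots_of p)\<rparr>"

definition galois_group :: "rat poly \<Rightarrow> (complex \<Rightarrow> complex) set" where
  "galois_group p =
     {\<sigma> \<in> ring_iso (splitting_field p) (splitting_field p).
        \<sigma> \<in> extensional (carrier (splitting_field p)) \<and> (\<forall>q\<in>\<rat>. \<sigma> q = q)}"

text \<open>The Galois group as a set of permutations of the roots, inside \<^const>\<open>Bij\<close>.\<close>

definition galois_perms :: "rat poly \<Rightarrow> (complex \<Rightarrow> complex) set" where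
  "galois_perms p = (\<lambda>\<sigma>. restrict \<sigma> (complex_roots_of p)) ` galois_group p"

text \<open>For a polynomial of degree \<open>N\<close>, the Galois group can only be the symmetric group
  \<open>S\<^sub>N\<close> acting on the roots if there are \<open>N\<close> distinct roots. This has to be required
  separately: a polynomial with a repeated root may still have every permutation of its
  (fewer than \<open>N\<close>) distinct roots in its Galois group.\<close>

definition has_full_symmetric_galois_group :: "rat poly \<Rightarrow> bool" where
  "has_full_symmetric_galois_group p \<longleftrightarrow>
     card (complex_roots_of p) = Polynomial.degree p \<and>
     galois_perms p = carrier (BijGroup (complex_roots_of p))"

lemma Rats_roots_in_splitting_field: "\<rat> \<union> complex_roots_of p \<subseteq> carrier (splitting_field p)"
  by (auto simp: splitting_field_def intro: generate_field.incl)

lemma field_splitting_field: "Ring.field (splitting_field p)"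
  unfolding splitting_field_def
  by (rule field.generate_field_is_field[OF field_from_type_algebra])
     (auto simp: ring_of_type_algebra_def)

end

theory Submission
  imports Defs
begin

text \<open>The factorisation of a monic integer polynomial modulo a prime \<open>p\<close> shows a permutation of its roots
  in the Galois group: the one by which the Frobenius map \<open>x \<mapsto> x\<^sup>p\<close> permutes the roots in the
  residue field (\<open>frobenius_automorphism\<close>, \<open>frobenius_on_residues\<close>). Two factorisation patterns are
  enough. An irreducible quadratic factor times distinct linear factors gives a transposition. A linear factor times an
  irreducible factor of degree \<open>N - 1\<close>, possibly modulo another prime, gives a cycle through all roots but one.
  Together they generate the symmetric group, unless the remaining root is fixed by the whole Galois group; it would then be
  an integer that divides the constant term \<open>\<plusminus>1\<close>, and the first pattern is made to exclude
  \<open>1\<close> and \<open>-1\<close> as roots (\<open>full_symmetric_galois_group\<close>). For \<open>N = 2\<close> the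
  transposition is enough. Each pattern occurs, for every large prime \<open>p\<close>, in a proportion of at least some
  \<open>\<kappa> > 0\<close>, depending only on \<open>N\<close>, of the monic polynomials of degree \<open>N\<close> modulo
  \<open>p\<close> with constant term \<open>(-1)\<^sup>N\<close> (\<open>factorisation_proportions\<close>). It remains to
  see that the characteristic polynomial of a random word is close to random modulo many primes at once, independently.

  Let \<open>m\<close> be the product of \<open>r\<close> large primes. A random word modulo \<open>m\<close> is a random
  walk on a finite group. It may be periodic and then does not become uniform, but there is a normal subgroup
  \<open>M\<close> with commutative quotient such that an event which is rare on every coset of \<open>M\<close> is rare for
  long words (\<open>word_subgroup\<close>, \<open>word_mixing\<close>). In a commutative quotient the class of an elementary
  matrix has order dividing \<open>12\<close> and \<open>m\<close>, so \<open>M\<close> contains all elementary matrices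
  (\<open>elementary_in_normal\<close>).

  Row operations therefore move within a coset of \<open>M\<close>. Adding multiples of the other rows to row
  \<open>0\<close> changes the characteristic polynomial affinely in the coefficients, and the affine map is bijective modulo
  \<open>p\<close> when the first basis vector is cyclic (\<open>char_poly_equidistributed\<close>). The Chinese remainder
  theorem allows these coefficients to be chosen independently modulo the \<open>r\<close> primes. Matrices whose first basis
  vector is not cyclic modulo \<open>p\<close> have proportion at most \<open>C / p\<close> with \<open>C\<close> depending
  only on \<open>N\<close>: elimination leads from any matrix to one with a cyclic first basis vector by a bounded number of
  row operations, and along each line of row operations the exceptions are the zeros of a polynomial of bounded degree
  (\<open>card_not_cyclic\<close>). So a pattern is missing modulo all \<open>r\<close> primes with probability at most
  \<open>(1 - \<kappa>)\<^sup>r\<close> plus the sum of the \<open>C / p\<close> (\<open>card_all_primes_fail\<close>), and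
  both are small when first \<open>r\<close> and then the primes are taken large.\<close>

section \<open>Algebraic integers and their residues modulo a prime\<close>

text \<open>The matrix has a monic characteristic polynomial with integer coefficients, and \<open>x\<close> is an
  eigenvalue. Sums and products of algebraic integers are reduced to this.\<close>

lemma algebraic_int_if_integer_eigenvector:
  fixes v :: "'i \<Rightarrow> complex" and M :: "'i \<Rightarrow> 'i \<Rightarrow> int"
  assumes fin: "finite I" and i0: "i0 \<in> I" "v i0 \<noteq> 0"
    and ev: "\<And>i. i \<in> I \<Longrightarrow> x * v i = (\<Sum>k\<in>I. of_int (M i k) * v k)"
  shows "algebraic_int x"
proof -
  obtain b where b: "bij_betw b {0..<card I} I"
    using ex_bij_betw_nat_finite[OF fin] by blast
  define n where "n = card I"
  define A where "A = mat n n (\<lambda>(i,k). M (b i) (b k))"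
  define B :: "complex mat" where "B = map_mat of_int A"
  define w where "w = vec n (\<lambda>i. v (b i))"
  have A: "A \<in> carrier_mat n n" by (simp add: A_def)
  have bI: "b i \<in> I" if "i < n" for i
    using b that unfolding bij_betw_def n_def by auto
  have hA: "B \<in> carrier_mat n n" using A by (simp add: B_def)
  have "B *\<^sub>v w = x \<cdot>\<^sub>v w"
  proof (rule eq_vecI)
    fix i assume "i < dim_vec (x \<cdot>\<^sub>v w)"
    then have i: "i < n" by (simp add: w_def)
    have "(B *\<^sub>v w) $ i = (\<Sum>k\<in>{0..<n}. of_int (M (b i) (b k)) * v (b k))"
      using i by (simp add: scalar_prod_def A_def w_def B_def)
    also have "\<dots> = (\<Sum>k\<in>I. of_int (M (b i) k) * v k)"
      using sum.reindex_bij_betw[OF b, of "\<lambda>k. of_int (M (b i) k) * v k"] by (simp add: n_def)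
    also have "\<dots> = x * v (b i)" using ev[OF bI[OF i]] by simp
    finally show "(B *\<^sub>v w) $ i = (x \<cdot>\<^sub>v w) $ i" using i by (simp add: w_def)
  qed (simp add: A_def w_def B_def)
  moreover have "w \<noteq> 0\<^sub>v n"
  proof
    assume w0: "w = 0\<^sub>v n"
    obtain j where j: "j < n" "b j = i0" using b i0 unfolding bij_betw_def n_def by force
    have "w $ j = 0" using w0 j by simp
    then show False using j i0 by (simp add: w_def)
  qed
  ultimately have "eigenvector (B) w x"
    unfolding eigenvector_def by (simp add: w_def A_def B_def)
  then have "eigenvalue (B) x" unfolding eigenvalue_def by blast
  then have "poly (char_poly (B)) x = 0"
    using eigenvalue_root_char_poly[OF hA] by simp
  moreover have "char_poly B = of_int_poly (char_poly A)"
    unfolding B_def by (rule of_int_hom.char_poly_hom[OF A])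
  ultimately have r: "poly (of_int_poly (char_poly A)) x = 0"
    using \<open>char_poly B = of_int_poly (char_poly A)\<close> by simp
  show ?thesis unfolding algebraic_int_altdef_ipoly
    using r degree_monic_char_poly[OF A] by (intro exI[of _ "char_poly A"]) simp
qed

text \<open>A companion matrix: multiplication by \<open>z\<close> on the powers below the degree of a monic equation. For two
  algebraic integers \<open>z\<close> and \<open>w\<close>, both \<open>z + w\<close> and \<open>z w\<close> then act by integer matrices on the products \<open>z\<^sup>i w\<^sup>j\<close>.\<close>

lemma algebraic_int_power_recurrence:
  assumes "algebraic_int (z :: complex)"
  obtains m and a :: "nat \<Rightarrow> nat \<Rightarrow> int" where "m > 0"
    "\<And>i. i < m \<Longrightarrow> z * z ^ i = (\<Sum>k<m. of_int (a i k) * z ^ k)"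
proof -
  obtain f :: "int poly" where f: "poly (of_int_poly f) z = 0" "lead_coeff f = 1"
    using assms unfolding algebraic_int_altdef_ipoly by blast
  define m where "m = Polynomial.degree f"
  have m0: "m > 0"
  proof (rule ccontr)
    assume "\<not> m > 0"
    then have "Polynomial.degree f = 0" by (simp add: m_def)
    then obtain c where c: "f = [:c:]" by (rule degree_eq_zeroE)
    with f show False by simp
  qed
  have "(\<Sum>k\<le>m. of_int (coeff f k) * z ^ k) = 0"
    using f(1) by (simp add: poly_altdef m_def)
  then have zm: "z ^ m = (\<Sum>k<m. of_int (- coeff f k) * z ^ k)"
    using f(2) by (simp add: lessThan_Suc_atMost[symmetric] m_def[symmetric] sum_negf
        eq_neg_iff_add_eq_0 add.commute)
  define a where "a i k = (if Suc i < m then (if k = Suc i then 1 else 0) else - coeff f k)" for i k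
  have "z * z ^ i = (\<Sum>k<m. of_int (a i k) * z ^ k)" if "i < m" for i
  proof (cases "Suc i < m")
    case True
    have "(\<Sum>k<m. of_int (a i k) * z ^ k) = (\<Sum>k<m. if k = Suc i then z ^ k else 0)"
      using True by (intro sum.cong) (auto simp: a_def)
    then show ?thesis using True by simp
  next
    case False
    then have "Suc i = m" using that by simp
    then show ?thesis using zm False by (auto simp: a_def)
  qed
  with m0 show ?thesis using that by blast
qed

lemma
  assumes "algebraic_int (z :: complex)" "algebraic_int w"
  shows algebraic_int_plus [intro]: "algebraic_int (z + w)"
    and algebraic_int_times [intro]: "algebraic_int (z * w)"
proof -
  obtain m a where m: "m > 0" and a: "\<And>i. i < m \<Longrightarrow> z * z ^ i = (\<Sum>k<m. of_int (a i k :: int) * z ^ k)"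
    using algebraic_int_power_recurrence[OF assms(1)] by metis
  obtain n b where n: "n > 0" and b: "\<And>i. i < n \<Longrightarrow> w * w ^ i = (\<Sum>k<n. of_int (b i k :: int) * w ^ k)"
    using algebraic_int_power_recurrence[OF assms(2)] by metis
  define I where "I = {..<m} \<times> {..<n}"
  define v where "v = (\<lambda>(i,j). z ^ i * w ^ j)"
  have I: "finite I" "(0,0) \<in> I" "v (0,0) \<noteq> 0" using m n by (auto simp: I_def v_def)
  show "algebraic_int (z + w)"
  proof (rule algebraic_int_if_integer_eigenvector[where v = v, OF I])
    fix ij assume "ij \<in> I"
    then obtain i j where ij: "ij = (i,j)" "i < m" "j < n" by (auto simp: I_def)
    have "(z + w) * v ij = (z * z ^ i) * w ^ j + z ^ i * (w * w ^ j)"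
      by (simp add: ij v_def algebra_simps)
    also have "\<dots> = (\<Sum>k<m. of_int (a i k) * z ^ k * w ^ j) + (\<Sum>l<n. z ^ i * (of_int (b j l) * w ^ l))"
      by (subst a[OF ij(2)], subst b[OF ij(3)]) (simp add: sum_distrib_left sum_distrib_right)
    also have "(\<Sum>k<m. of_int (a i k) * z ^ k * w ^ j) =
        (\<Sum>k<m. \<Sum>l<n. if l = j then of_int (a i k) * (z ^ k * w ^ l) else 0)"
      using ij by (simp add: mult_ac)
    also have "(\<Sum>l<n. z ^ i * (of_int (b j l) * w ^ l)) =
        (\<Sum>l<n. \<Sum>k<m. if k = i then of_int (b j l) * (z ^ k * w ^ l) else 0)"
      using ij by (simp add: mult_ac)
    also have "\<dots> = (\<Sum>k<m. \<Sum>l<n. if k = i then of_int (b j l) * (z ^ k * w ^ l) else 0)"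
      by (rule sum.swap)
    also have "(\<Sum>k<m. \<Sum>l<n. if l = j then of_int (a i k) * (z ^ k * w ^ l) else 0) + \<dots> =
       (\<Sum>kl\<in>I. of_int ((\<lambda>(i,j) (k,l). (if l = j then a i k else 0) + (if k = i then b j l else 0)) ij kl) * v kl)"
      unfolding I_def sum.distrib[symmetric] sum.cartesian_product
      by (intro sum.cong) (auto simp: ij v_def algebra_simps)
    finally show "(z + w) * v ij = (\<Sum>kl\<in>I. of_int ((\<lambda>(i,j) (k,l). (if l = j then a i k else 0) + (if k = i then b j l else 0)) ij kl) * v kl)" .
  qed
  show "algebraic_int (z * w)"
  proof (rule algebraic_int_if_integer_eigenvector[where v = v, OF I])
    fix ij assume "ij \<in> I"
    then obtain i j where ij: "ij = (i,j)" "i < m" "j < n" by (auto simp: I_def)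
    have "(z * w) * v ij = (z * z ^ i) * (w * w ^ j)"
      by (simp add: ij v_def algebra_simps)
    also have "\<dots> = (\<Sum>k<m. \<Sum>l<n. of_int (a i k) * z ^ k * (of_int (b j l) * w ^ l))"
      by (subst a[OF ij(2)], subst b[OF ij(3)]) (simp add: sum_product)
    also have "\<dots> = (\<Sum>kl\<in>I. of_int ((\<lambda>(i,j) (k,l). a i k * b j l) ij kl) * v kl)"
      unfolding I_def sum.cartesian_product
      by (intro sum.cong) (auto simp: ij v_def algebra_simps)
    finally show "(z * w) * v ij = (\<Sum>kl\<in>I. of_int ((\<lambda>(i,j) (k,l). a i k * b j l) ij kl) * v kl)" .
  qed
qed

lemma algebraic_int_of_int [simp, intro]: "algebraic_int (of_int k :: complex)"
  by (intro int_imp_algebraic_int) auto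

lemma algebraic_int_of_nat [simp, intro]: "algebraic_int (of_nat k :: complex)"
  by (intro int_imp_algebraic_int) auto

lemma algebraic_int_one [simp, intro]: "algebraic_int (1 :: complex)"
  by (intro int_imp_algebraic_int) auto

lemma algebraic_int_diff [intro]:
  "algebraic_int (z :: complex) \<Longrightarrow> algebraic_int w \<Longrightarrow> algebraic_int (z - w)"
  using algebraic_int_plus[of z "- w"] by auto

lemma algebraic_int_power [intro]: "algebraic_int (z :: complex) \<Longrightarrow> algebraic_int (z ^ n)"
  by (induction n) auto

lemma algebraic_int_sum [intro]:
  "(\<And>i. i \<in> I \<Longrightarrow> algebraic_int (f i :: complex)) \<Longrightarrow> algebraic_int (sum f I)"
  by (induction I rule: infinite_finite_induct) auto

lemma algebraic_int_prod [intro]: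
  "(\<And>i. i \<in> I \<Longrightarrow> algebraic_int (f i :: complex)) \<Longrightarrow> algebraic_int (prod f I)"
  by (induction I rule: infinite_finite_induct) auto

lemma algebraic_int_root_of_unity:
  assumes "m > 0" "(z :: complex) ^ m = 1"
  shows "algebraic_int z"
  unfolding algebraic_int_altdef_ipoly
proof (intro exI[of _ "Polynomial.monom 1 m - 1"] conjI)
  show "poly (of_int_poly (Polynomial.monom 1 m - 1)) z = 0"
    using assms by (simp add: hom_distribs poly_monom)
  have "coeff (Polynomial.monom 1 m - 1 :: int poly) m = 1" using assms by simp
  moreover have "Polynomial.degree (Polynomial.monom 1 m - 1 :: int poly) = m"
    using assms by (intro antisym degree_le le_degree) auto
  ultimately show "lead_coeff (Polynomial.monom 1 m - 1 :: int poly) = 1" by simp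
qed

definition int_coeffs :: "complex poly \<Rightarrow> bool" where
  "int_coeffs F \<longleftrightarrow> (\<forall>k. algebraic_int (coeff F k))"

lemma int_coeffs_of_int_poly [simp, intro]: "int_coeffs (of_int_poly f)"
  by (auto simp: int_coeffs_def)

lemma int_coeffs_mult [intro]: "int_coeffs F \<Longrightarrow> int_coeffs G \<Longrightarrow> int_coeffs (F * G)"
  by (auto simp: int_coeffs_def coeff_mult)

lemma int_coeffs_pCons [simp]: "int_coeffs (pCons a F) \<longleftrightarrow> algebraic_int a \<and> int_coeffs F"
  unfolding int_coeffs_def by (metis coeff_pCons_0 coeff_pCons_Suc not0_implies_Suc)

lemma int_coeffs_0 [simp]: "int_coeffs 0" by (simp add: int_coeffs_def)
lemma int_coeffs_1 [simp]: "int_coeffs 1" by (simp add: one_pCons)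

lemma int_coeffs_prod [intro]:
  "(\<And>i. i \<in> I \<Longrightarrow> int_coeffs (f i)) \<Longrightarrow> int_coeffs (prod f I)"
  by (induction I rule: infinite_finite_induct) auto

lemma algebraic_int_poly [intro]: "int_coeffs F \<Longrightarrow> algebraic_int z \<Longrightarrow> algebraic_int (poly F z)"
  by (auto simp: poly_altdef int_coeffs_def)

text \<open>The algebraic integers modulo a prime ideal above \<open>p\<close> form an algebraic closure of the field with
  \<open>p\<close> elements. All computations in finite fields take place there, through congruences of complex numbers.\<close>

locale residue_prime =
  fixes p :: nat and P :: "complex set"
  assumes prime_p: "prime p"
    and P_int: "x \<in> P \<Longrightarrow> algebraic_int x"
    and p_in: "of_nat p \<in> P"
    and one_notin: "1 \<notin> P"
    and P_add: "x \<in> P \<Longrightarrow> y \<in> P \<Longrightarrow> x + y \<in> P"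
    and P_mult: "x \<in> P \<Longrightarrow> algebraic_int a \<Longrightarrow> a * x \<in> P"
    and P_prime: "algebraic_int a \<Longrightarrow> algebraic_int b \<Longrightarrow> a * b \<in> P \<Longrightarrow> a \<in> P \<or> b \<in> P"

text \<open>An ideal that is maximal among those that contain \<open>p\<close> and not \<open>1\<close> is prime. The multiples of \<open>p\<close> are such an ideal, since
  \<open>1/p\<close> is not an algebraic integer, and Zorn's lemma gives a maximal one.\<close>

lemma ex_residue_prime:
  assumes p: "prime p"
  shows "\<exists>P. residue_prime p P"
proof -
  define Ids where "Ids = {J. (\<forall>x\<in>J. algebraic_int x) \<and> of_nat p \<in> J \<and> (1::complex) \<notin> J \<and>
     (\<forall>x\<in>J. \<forall>y\<in>J. x + y \<in> J) \<and> (\<forall>x\<in>J. \<forall>a. algebraic_int a \<longrightarrow> a * x \<in> J)}"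
  define J0 where "J0 = {of_nat p * a | a :: complex. algebraic_int a}"
  have p0: "of_nat p \<noteq> (0::complex)" using p prime_gt_0_nat by fastforce
  have J0: "J0 \<in> Ids"
  proof -
    have "1 \<notin> J0"
    proof
      assume "1 \<in> J0"
      then obtain a where a: "algebraic_int a" "1 = of_nat p * (a::complex)" by (auto simp: J0_def)
      then have ae: "a = of_rat (1 / of_nat p)" using p0 by (simp add: field_simps of_rat_divide)
      then have "a \<in> \<int>" using rational_algebraic_int_is_int[OF a(1)] by simp
      then obtain k where k: "a = of_int k" by (auto elim: Ints_cases)
      then have "of_int (1::int) = (of_int (int p * k) :: complex)" using a(2) by simp
      then have "1 = int p * k" by (simp only: of_int_eq_iff)
      then have "int p dvd 1" by (metis dvd_triv_left)
      then show False using p by (simp add: prime_nat_iff)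
    qed
    moreover have "x + y \<in> J0" if xy: "x \<in> J0" "y \<in> J0" for x y
    proof -
      obtain a b where "x = of_nat p * a" "y = of_nat p * b" "algebraic_int a" "algebraic_int b"
        using xy by (auto simp: J0_def)
      then show ?thesis unfolding J0_def
        by (intro CollectI exI[of _ "a + b"]) (auto simp: algebra_simps)
    qed
    moreover have "a * x \<in> J0" if x: "x \<in> J0" "algebraic_int a" for x a
    proof -
      obtain b where "x = of_nat p * b" "algebraic_int b"
        using x by (auto simp: J0_def)
      then show ?thesis unfolding J0_def using x
        by (intro CollectI exI[of _ "a * b"]) (auto simp: algebra_simps)
    qed
    moreover have "of_nat p \<in> J0" unfolding J0_def by (intro CollectI exI[of _ 1]) auto
    ultimately show ?thesis by (auto simp: Ids_def J0_def)
  qed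
  have "\<exists>M\<in>Ids. \<forall>Y\<in>Ids. M \<subseteq> Y \<longrightarrow> Y = M"
  proof (rule subset_Zorn_nonempty)
    fix C assume "C \<noteq> {}" and C: "subset.chain Ids C"
    show "\<Union>C \<in> Ids"
    proof -
      have CI: "\<And>J. J \<in> C \<Longrightarrow> J \<in> Ids" using C unfolding subset.chain_def by auto
      have lin: "\<And>J J'. J \<in> C \<Longrightarrow> J' \<in> C \<Longrightarrow> J \<subseteq> J' \<or> J' \<subseteq> J"
        using C unfolding subset.chain_def by auto
      have "x + y \<in> \<Union>C" if xy: "x \<in> \<Union>C" "y \<in> \<Union>C" for x y
      proof -
        obtain J J' where J: "J \<in> C" "J' \<in> C" "x \<in> J" "y \<in> J'" using xy by auto
        obtain K where K: "K \<in> C" "x \<in> K" "y \<in> K" using lin[OF J(1,2)] J by auto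
        then have "x + y \<in> K" using CI[OF K(1)] by (auto simp: Ids_def)
        then show ?thesis using K by auto
      qed
      then show ?thesis using \<open>C \<noteq> {}\<close> CI unfolding Ids_def by blast
    qed
  qed (use J0 in auto)
  then obtain M where M: "M \<in> Ids" and max: "\<And>Y. Y \<in> Ids \<Longrightarrow> M \<subseteq> Y \<Longrightarrow> Y = M" by blast
  have Mp: "of_nat p \<in> M" and M1: "1 \<notin> M" and MA: "\<And>x. x \<in> M \<Longrightarrow> algebraic_int x"
    and Madd: "\<And>x y. x \<in> M \<Longrightarrow> y \<in> M \<Longrightarrow> x + y \<in> M"
    and Mmult: "\<And>x a. x \<in> M \<Longrightarrow> algebraic_int a \<Longrightarrow> a * x \<in> M"
    using M by (auto simp: Ids_def)
  have M0: "0 \<in> M" using Mmult[OF Mp, of 0] by simp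
  \<comment> \<open>By maximality, adjoining an element outside \<open>M\<close> produces the unit ideal.\<close>
  have unit: "\<exists>m\<in>M. \<exists>c. algebraic_int c \<and> 1 = m + c * a" if a: "algebraic_int a" "a \<notin> M" for a
  proof (rule ccontr)
    assume no: "\<not> ?thesis"
    define Y where "Y = {m + c * a | m c. m \<in> M \<and> algebraic_int c}"
    have MY: "M \<subseteq> Y" unfolding Y_def
    proof
      fix m assume "m \<in> M"
      then show "m \<in> {m + c * a | m c. m \<in> M \<and> algebraic_int c}"
        by (intro CollectI exI[of _ m] exI[of _ 0]) auto
    qed
    have "x + y \<in> Y" if xy: "x \<in> Y" "y \<in> Y" for x y
    proof -
      obtain m c m' c' where "x = m + c * a" "y = m' + c' * a" "m \<in> M" "m' \<in> M"
        "algebraic_int c" "algebraic_int c'" using xy by (auto simp: Y_def)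
      then show ?thesis unfolding Y_def using Madd
        by (intro CollectI exI[of _ "m + m'"] exI[of _ "c + c'"]) (auto simp: algebra_simps)
    qed
    moreover have "b * x \<in> Y" if x: "x \<in> Y" "algebraic_int b" for x b
    proof -
      obtain m c where "x = m + c * a" "m \<in> M" "algebraic_int c" using x by (auto simp: Y_def)
      then show ?thesis unfolding Y_def using Mmult[of m b] x
        by (intro CollectI exI[of _ "b * m"] exI[of _ "b * c"]) (auto simp: algebra_simps)
    qed
    moreover have "\<forall>x\<in>Y. algebraic_int x" using MA a by (auto simp: Y_def)
    moreover have "1 \<notin> Y" using no by (auto simp: Y_def)
    ultimately have "Y \<in> Ids" using Mp MY by (auto simp: Ids_def)
    then have "Y = M" using max MY by blast
    moreover have "a \<in> Y" unfolding Y_def using M0 by (intro CollectI exI[of _ 0] exI[of _ 1]) auto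
    ultimately show False using a by simp
  qed
  have "residue_prime p M"
  proof
    fix a b :: complex assume ab: "algebraic_int a" "algebraic_int b" "a * b \<in> M"
    show "a \<in> M \<or> b \<in> M"
    proof (rule ccontr)
      assume "\<not> (a \<in> M \<or> b \<in> M)"
      then obtain m c m' c' where "m \<in> M" "m' \<in> M" and c: "algebraic_int c" "algebraic_int c'"
        and e: "1 = m + c * a" "1 = m' + c' * b"
        using unit[of a] unit[of b] ab by blast
      have "1 = (m + c * a) * (m' + c' * b)" using e by (metis mult.right_neutral)
      also have "\<dots> = (m' + c' * b) * m + (c * a) * m' + (c * c') * (a * b)"
        by (simp add: algebra_simps)
      also have "\<dots> \<in> M"
        using \<open>m \<in> M\<close> \<open>m' \<in> M\<close> c ab MA
        by (intro Madd Mmult[of m] Mmult[of m'] Mmult[of "a * b"]) auto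
      finally show False using M1 by simp
    qed
  qed (use p Mp M1 MA Madd Mmult in auto)
  then show ?thesis by blast
qed

context residue_prime
begin

lemma p_gt_1: "p > 1" using prime_p by (rule prime_gt_1_nat)

lemma P_0 [simp]: "0 \<in> P" using P_mult[OF p_in, of 0] by simp

lemma P_minus: "x \<in> P \<Longrightarrow> - x \<in> P" using P_mult[of x "-1"] by auto
lemma P_minus_iff [simp]: "- x \<in> P \<longleftrightarrow> x \<in> P" using P_minus[of x] P_minus[of "-x"] by auto

lemma P_diff: "x \<in> P \<Longrightarrow> y \<in> P \<Longrightarrow> x - y \<in> P" using P_add[of x "-y"] P_minus[of y] by simp

lemma P_mult': "x \<in> P \<Longrightarrow> algebraic_int a \<Longrightarrow> x * a \<in> P"
  using P_mult[of x a] by (simp add: mult.commute)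

lemma of_int_in_P_iff: "of_int k \<in> P \<longleftrightarrow> int p dvd k"
proof
  assume "int p dvd k"
  then obtain l where "k = int p * l" by blast
  then show "of_int k \<in> P" using P_mult'[OF p_in, of "of_int l"] by simp
next
  assume k: "of_int k \<in> P"
  show "int p dvd k"
  proof (rule ccontr)
    assume "\<not> int p dvd k"
    then have "coprime (int p) k" using prime_p by (simp add: prime_imp_coprime)
    then obtain u v where uv: "u * int p + v * k = 1" using bezout_int[of "int p" k] by auto
    have "of_int u * of_nat p + of_int v * of_int k \<in> P"
      using k p_in by (intro P_add P_mult) auto
    moreover have "of_int u * of_nat p + of_int v * of_int k = (of_int (u * int p + v * k) :: complex)"
      by simp
    ultimately show False using uv one_notin by simp
  qed
qed

lemma P_prod:
  assumes "finite I" "\<And>i. i \<in> I \<Longrightarrow> algebraic_int (f i)" "prod f I \<in> P"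
  shows "\<exists>i\<in>I. f i \<in> P"
  using assms
proof (induction I rule: finite_induct)
  case empty
  then show ?case using one_notin by simp
next
  case (insert i I)
  then show ?case using P_prime[of "f i" "prod f I"] by (auto intro: algebraic_int_prod)
qed

definition residue_eq :: "complex \<Rightarrow> complex \<Rightarrow> bool" (infix \<open>\<equiv>\<^sub>P\<close> 50) where
  "a \<equiv>\<^sub>P b \<longleftrightarrow> a - b \<in> P"

lemma residue_eq_refl [simp]: "a \<equiv>\<^sub>P a" by (simp add: residue_eq_def)
lemma residue_eq_sym: "a \<equiv>\<^sub>P b \<Longrightarrow> b \<equiv>\<^sub>P a" using P_minus[of "a - b"] by (simp add: residue_eq_def)
lemma residue_eq_trans [trans]: "a \<equiv>\<^sub>P b \<Longrightarrow> b \<equiv>\<^sub>P c \<Longrightarrow> a \<equiv>\<^sub>P c"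
  using P_add[of "a - b" "b - c"] by (simp add: residue_eq_def)
lemma residue_eq_add: "a \<equiv>\<^sub>P b \<Longrightarrow> c \<equiv>\<^sub>P d \<Longrightarrow> a + c \<equiv>\<^sub>P b + d"
  using P_add[of "a - b" "c - d"] by (simp add: residue_eq_def algebra_simps)
lemma residue_eq_diff: "a \<equiv>\<^sub>P b \<Longrightarrow> c \<equiv>\<^sub>P d \<Longrightarrow> a - c \<equiv>\<^sub>P b - d"
  using P_diff[of "a - b" "c - d"] by (simp add: residue_eq_def algebra_simps)
lemma residue_eq_mult:
  assumes "a \<equiv>\<^sub>P b" "c \<equiv>\<^sub>P d" "algebraic_int b" "algebraic_int c"
  shows "a * c \<equiv>\<^sub>P b * d"
proof -
  have "a * c - b * d = (a - b) * c + b * (c - d)" by (simp add: algebra_simps)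
  then show ?thesis using assms P_mult P_mult' P_add unfolding residue_eq_def by metis
qed
lemma residue_eq_power:
  assumes "a \<equiv>\<^sub>P b" "algebraic_int a" "algebraic_int b"
  shows "a ^ n \<equiv>\<^sub>P b ^ n"
  using assms by (induction n) (auto intro!: residue_eq_mult)
lemma residue_eq_sum: "(\<And>i. i \<in> I \<Longrightarrow> f i \<equiv>\<^sub>P g i) \<Longrightarrow> sum f I \<equiv>\<^sub>P sum g I"
  by (induction I rule: infinite_finite_induct) (auto intro: residue_eq_add)
lemma residue_eq_0_iff: "a \<equiv>\<^sub>P 0 \<longleftrightarrow> a \<in> P" by (simp add: residue_eq_def)

lemma residue_eq_of_int_iff: "of_int k \<equiv>\<^sub>P of_int l \<longleftrightarrow> int p dvd k - l"
  unfolding residue_eq_def using of_int_in_P_iff[of "k - l"] by simp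

lemma residue_eq_poly:
  assumes "a \<equiv>\<^sub>P b" "algebraic_int a" "algebraic_int b" "int_coeffs F"
  shows "poly F a \<equiv>\<^sub>P poly F b"
  unfolding poly_altdef using assms
  by (intro residue_eq_sum residue_eq_mult residue_eq_power) (auto simp: int_coeffs_def)

lemma residue_eq_poly_coeffs:
  assumes "\<And>k. coeff F k \<equiv>\<^sub>P coeff G k" "algebraic_int a" "int_coeffs G" 
  shows "poly F a \<equiv>\<^sub>P poly G a"
proof -
  define n where "n = max (Polynomial.degree F) (Polynomial.degree G)"
  have F: "poly F a = (\<Sum>k\<le>n. coeff F k * a ^ k)"
    unfolding poly_altdef by (rule sum.mono_neutral_left) (auto simp: n_def coeff_eq_0)
  have G: "poly G a = (\<Sum>k\<le>n. coeff G k * a ^ k)"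
    unfolding poly_altdef by (rule sum.mono_neutral_left) (auto simp: n_def coeff_eq_0)
  show ?thesis unfolding F G using assms by (intro residue_eq_sum residue_eq_mult) (auto simp: int_coeffs_def)
qed

text \<open>By synthetic division, a polynomial over the residue field
  has at most as many roots as its degree.\<close>

lemma card_roots_mod_le:
  assumes "finite Z" "int_coeffs F" "Polynomial.degree F \<le> D" "\<exists>k. coeff F k \<notin> P"
    and "\<And>z. z \<in> Z \<Longrightarrow> algebraic_int z" "\<And>z. z \<in> Z \<Longrightarrow> poly F z \<in> P"
    and "\<And>z w. z \<in> Z \<Longrightarrow> w \<in> Z \<Longrightarrow> z \<equiv>\<^sub>P w \<Longrightarrow> z = w"
  shows "card Z \<le> D"
  using assms
proof (induction Z arbitrary: F D rule: finite_induct)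
  case empty
  then show ?case by simp
next
  case (insert x Z)
  define Q where "Q = synthetic_div F x"
  have FQ: "F + smult x Q = pCons (poly F x) Q"
    unfolding Q_def by (rule synthetic_div_correct)
  have x: "algebraic_int x" using insert by simp
  have cF: "coeff F k = coeff (pCons (poly F x) Q) k - x * coeff Q k" for k
    using arg_cong[OF FQ, of "\<lambda>q. coeff q k"] by (simp add: algebra_simps)
  have degQ: "Polynomial.degree Q = Polynomial.degree F - 1"
    unfolding Q_def by (rule degree_synthetic_div)
  have Qint: "int_coeffs Q"
  proof -
    \<comment> \<open>The coefficients of \<open>Q\<close> are obtained from the vanishing ones above the degree, downwards.\<close>
    have "algebraic_int (coeff Q (n - i))" if "n > Polynomial.degree Q" for n i
    proof (induction i)
      case 0
      then show ?case using that by (simp add: coeff_eq_0)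
    next
      case (Suc i)
      have "coeff Q (n - Suc i) = coeff F (n - i) + x * coeff Q (n - i)" if "i < n"
        using cF[of "n - i"] that by (simp add: Suc_diff_Suc[symmetric] del: Suc_diff_Suc)
      moreover have "algebraic_int (coeff F (n - i) + x * coeff Q (n - i))"
        using insert.prems(1) Suc x by (auto simp: int_coeffs_def)
      moreover have "n - Suc i = n - i" if "\<not> i < n" using that by simp
      ultimately show ?case using Suc by metis
    qed
    then show ?thesis unfolding int_coeffs_def
      by (metis diff_diff_cancel lessI less_Suc_eq_le nat_le_linear order_less_le_trans)
  qed
  have Fx: "poly F x \<in> P" using insert by simp
  have Qnot: "\<exists>k. coeff Q k \<notin> P"
  proof (rule ccontr)
    assume "\<not> ?thesis"
    then have Q: "\<And>k. coeff Q k \<in> P" by simp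
    have "coeff F k \<in> P" for k
      unfolding cF[of k] using Q Fx x
      by (intro P_diff P_mult) (auto simp: coeff_pCons split: nat.splits)
    then show False using insert.prems by blast
  qed
  have D: "D > 0"
  proof (rule ccontr)
    assume "\<not> D > 0"
    then have "Polynomial.degree F = 0" using insert.prems by simp
    then obtain c where "F = [:c:]" by (rule degree_eq_zeroE)
    then have "Q = 0" by (simp add: Q_def)
    then show False using Qnot by simp
  qed
  have "card Z \<le> D - 1"
  proof (rule insert.IH[OF Qint])
    show "Polynomial.degree Q \<le> D - 1" using degQ insert.prems by linarith
    fix z assume z: "z \<in> Z"
    have "poly F z + x * poly Q z = poly F x + z * poly Q z"
      using arg_cong[OF FQ, of "\<lambda>q. poly q z"] by simp
    then have "(z - x) * poly Q z = poly F z - poly F x" by (simp add: algebra_simps)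
    also have "\<dots> \<in> P" using z Fx insert.prems by (intro P_diff) auto
    finally have "z - x \<in> P \<or> poly Q z \<in> P"
      by (rule P_prime[rotated 2])
        (use z x Qint insert.prems(4) in \<open>blast intro: algebraic_int_diff algebraic_int_poly\<close>)+
    moreover have "z - x \<notin> P" using insert.hyps z insert.prems(6)[of z x] by (auto simp: residue_eq_def)
    ultimately show "poly Q z \<in> P" by blast
  qed (use insert.prems Qnot in auto)
  then show ?case using D insert.hyps by simp
qed

text \<open>The prime \<open>p\<close> divides the inner binomial coefficients.\<close>

lemma frobenius_add:
  assumes "algebraic_int a" "algebraic_int b"
  shows "(a + b) ^ p \<equiv>\<^sub>P a ^ p + b ^ p"
proof -
  have "(a + b) ^ p = (\<Sum>k\<le>p. of_nat (p choose k) * a ^ k * b ^ (p - k))"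
    by (rule binomial_ring)
  also have "\<dots> \<equiv>\<^sub>P (\<Sum>k\<le>p. if k = 0 then b ^ p else if k = p then a ^ p else 0)"
  proof (rule residue_eq_sum)
    fix k assume "k \<in> {..p}"
    then have k: "k \<le> p" by simp
    show "of_nat (p choose k) * a ^ k * b ^ (p - k) \<equiv>\<^sub>P
        (if k = 0 then b ^ p else if k = p then a ^ p else 0)"
    proof (cases "k = 0 \<or> k = p")
      case True
      then show ?thesis using p_gt_1 by auto
    next
      case False
      then have "p dvd (p choose k)" using k prime_p by (intro dvd_choose_prime) auto
      then have "of_nat (p choose k) \<in> P" using of_int_in_P_iff[of "int (p choose k)"] by simp
      then show ?thesis using False assms
        by (auto simp: residue_eq_0_iff mult.assoc intro!: P_mult')
    qed
  qed
  also have "(\<Sum>k\<le>p. if k = 0 then b ^ p else if k = p then a ^ p else 0) = a ^ p + b ^ p"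
  proof -
    have "{..p} = {0} \<union> ({p} \<union> {0<..<p})" using p_gt_1 by auto
    then show ?thesis using p_gt_1 by (subst \<open>{..p} = _\<close>) (subst sum.union_disjoint; auto)
  qed
  finally show ?thesis .
qed

lemma frobenius_sum:
  assumes "\<And>i. i \<in> I \<Longrightarrow> algebraic_int (f i)"
  shows "(sum f I) ^ p \<equiv>\<^sub>P (\<Sum>i\<in>I. f i ^ p)"
  using assms
proof (induction I rule: infinite_finite_induct)
  case (insert x F)
  have "(sum f (insert x F)) ^ p = (f x + sum f F) ^ p" using insert by simp
  also have "\<dots> \<equiv>\<^sub>P f x ^ p + sum f F ^ p" using insert by (intro frobenius_add) auto
  also have "\<dots> \<equiv>\<^sub>P f x ^ p + (\<Sum>i\<in>F. f i ^ p)" using insert by (intro residue_eq_add) auto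
  finally show ?case using insert by simp
qed (use p_gt_1 in \<open>auto simp: power_0_left\<close>)

lemma fermat_of_int: "of_int k ^ p \<equiv>\<^sub>P of_int k"
proof -
  have nat: "of_nat k ^ p \<equiv>\<^sub>P (of_nat k :: complex)" for k
  proof (induction k)
    case (Suc k)
    have "of_nat (Suc k) ^ p = (of_nat k + 1 :: complex) ^ p" by (simp add: add.commute)
    also have "\<dots> \<equiv>\<^sub>P of_nat k ^ p + 1 ^ p" by (intro frobenius_add) auto
    also have "\<dots> \<equiv>\<^sub>P of_nat k + 1" using Suc by (intro residue_eq_add) auto
    finally show ?case by (simp add: add.commute)
  qed (use p_gt_1 in \<open>simp add: zero_power\<close>)
  define r where "r = nat (k mod int p)"
  have r: "of_int k \<equiv>\<^sub>P of_nat r"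
    using residue_eq_of_int_iff[of k "int r"] p_gt_1 by (simp add: r_def mod_eq_dvd_iff[symmetric])
  have "of_int k ^ p \<equiv>\<^sub>P of_nat r ^ p" using r by (intro residue_eq_power) auto
  also have "\<dots> \<equiv>\<^sub>P of_nat r" by (rule nat)
  also have "\<dots> \<equiv>\<^sub>P of_int k" using r by (rule residue_eq_sym)
  finally show ?thesis .
qed

lemma frobenius_int_poly:
  assumes "algebraic_int a"
  shows "poly (of_int_poly f) (a ^ p) \<equiv>\<^sub>P poly (of_int_poly f) a ^ p"
proof -
  have "poly (of_int_poly f) a ^ p \<equiv>\<^sub>P
      (\<Sum>i\<le>Polynomial.degree f. (of_int (coeff f i) * a ^ i) ^ p)"
    unfolding poly_altdef using assms by (simp, intro frobenius_sum) auto
  also have "\<dots> \<equiv>\<^sub>P (\<Sum>i\<le>Polynomial.degree f. of_int (coeff f i) * (a ^ p) ^ i)"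
  proof (rule residue_eq_sum)
    fix i
    have "(of_int (coeff f i) * a ^ i) ^ p = of_int (coeff f i) ^ p * (a ^ p) ^ i"
      by (simp add: power_mult_distrib mult.commute flip: power_mult)
    also have "\<dots> \<equiv>\<^sub>P of_int (coeff f i) * (a ^ p) ^ i"
      using assms by (intro residue_eq_mult fermat_of_int) auto
    finally show "(of_int (coeff f i) * a ^ i) ^ p \<equiv>\<^sub>P of_int (coeff f i) * (a ^ p) ^ i" .
  qed
  also have "\<dots> = poly (of_int_poly f) (a ^ p)" by (simp add: poly_altdef)
  finally show ?thesis by (rule residue_eq_sym)
qed

text \<open>The elements fixed by Frobenius are the residues of integers: \<open>X\<^sup>p - X\<close> has no more
  than \<open>p\<close> roots.\<close>

lemma frobenius_fixed_imp_int:
  assumes z: "algebraic_int z" "z ^ p \<equiv>\<^sub>P z"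
  shows "\<exists>k. 0 \<le> k \<and> k < int p \<and> z \<equiv>\<^sub>P of_int k"
proof (rule ccontr)
  assume no: "\<not> ?thesis"
  define F :: "complex poly" where "F = Polynomial.monom 1 p - Polynomial.monom 1 1"
  define Z where "Z = insert z (of_int ` {0..<int p})"
  have inj: "inj_on (of_int :: int \<Rightarrow> complex) {0..<int p}" by (auto simp: inj_on_def)
  have "z \<notin> of_int ` {0..<int p}" using no residue_eq_refl by fastforce
  then have card: "card Z = Suc p" using inj by (simp add: Z_def card_image)
  have cF: "coeff F k = (if k = p then 1 else 0) - (if k = 1 then 1 else 0)" for k
    by (simp add: F_def)
  have "card Z \<le> p"
  proof (rule card_roots_mod_le)
    show "int_coeffs F" unfolding int_coeffs_def cF by auto
    show "Polynomial.degree F \<le> p"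
      unfolding F_def using p_gt_1 by (intro degree_diff_le) (auto simp: degree_monom_eq)
    show "\<exists>k. coeff F k \<notin> P" using one_notin p_gt_1 by (intro exI[of _ p]) (simp add: cF)
    fix x assume "x \<in> Z"
    then show "poly F x \<in> P"
      using z fermat_of_int by (auto simp: Z_def F_def poly_monom residue_eq_def)
  next
    fix x y assume xy: "x \<in> Z" "y \<in> Z" "x \<equiv>\<^sub>P y"
    have 1: "\<not> z \<equiv>\<^sub>P of_int k" if "k \<in> {0..<int p}" for k using no that by auto
    have 2: "k = l" if "k \<in> {0..<int p}" "l \<in> {0..<int p}" "of_int k \<equiv>\<^sub>P of_int l" for k l
      using that by (auto simp: residue_eq_of_int_iff dest!: mod_eq_dvd_iff[THEN iffD2])
    show "x = y" using xy 1 2 unfolding Z_def by (auto dest: residue_eq_sym)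
  qed (use z in \<open>auto simp: Z_def\<close>)
  then show False using card by simp
qed

end

section \<open>Automorphisms of a splitting field\<close>

definition subfield_of_complex :: "complex set \<Rightarrow> bool" where
  "subfield_of_complex S \<longleftrightarrow> 1 \<in> S \<and> (\<forall>x\<in>S. \<forall>y\<in>S. x - y \<in> S \<and> x * y \<in> S) \<and> (\<forall>x\<in>S. inverse x \<in> S)"

context
  fixes S assumes S: "subfield_of_complex S"
begin

lemma subfield_1: "1 \<in> S"
  and subfield_diff: "x \<in> S \<Longrightarrow> y \<in> S \<Longrightarrow> x - y \<in> S"
  and subfield_mult: "x \<in> S \<Longrightarrow> y \<in> S \<Longrightarrow> x * y \<in> S"
  and subfield_inverse: "x \<in> S \<Longrightarrow> inverse x \<in> S"
  using S by (auto simp: subfield_of_complex_def)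

lemma subfield_0: "0 \<in> S" using subfield_diff[OF subfield_1 subfield_1] by simp
lemma subfield_uminus: "x \<in> S \<Longrightarrow> - x \<in> S" using subfield_diff[OF subfield_0, of x] by simp
lemma subfield_add: "x \<in> S \<Longrightarrow> y \<in> S \<Longrightarrow> x + y \<in> S"
  using subfield_diff[of x "- y"] subfield_uminus[of y] by simp
lemma subfield_divide: "x \<in> S \<Longrightarrow> y \<in> S \<Longrightarrow> x / y \<in> S"
  unfolding divide_inverse by (intro subfield_mult subfield_inverse)
lemma subfield_sum: "(\<And>i. i \<in> I \<Longrightarrow> f i \<in> S) \<Longrightarrow> sum f I \<in> S"
  by (induction I rule: infinite_finite_induct) (auto intro: subfield_0 subfield_add)
lemma subfield_power: "x \<in> S \<Longrightarrow> x ^ n \<in> S"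
  by (induction n) (auto intro: subfield_1 subfield_mult)
lemma subfield_of_nat: "of_nat n \<in> S"
  by (induction n) (auto intro: subfield_0 subfield_1 subfield_add)
lemma subfield_of_int: "of_int n \<in> S"
  by (cases n rule: int_cases2) (auto intro: subfield_of_nat subfield_uminus)
lemma subfield_of_rat: "of_rat q \<in> S"
proof (cases q)
  case (Fract a b)
  then show ?thesis
    by (auto simp: of_rat_rat intro: subfield_divide subfield_of_int)
qed
lemma subfield_Rats: "\<rat> \<subseteq> S" by (auto elim!: Rats_cases intro: subfield_of_rat)
lemma subfield_poly: "(\<And>k. coeff F k \<in> S) \<Longrightarrow> x \<in> S \<Longrightarrow> poly F x \<in> S"
  unfolding poly_altdef by (intro subfield_sum subfield_mult subfield_power)

lemma coeffs_in_subfield_mult: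
  "(\<And>k. coeff F k \<in> S) \<Longrightarrow> (\<And>k. coeff G k \<in> S) \<Longrightarrow> coeff (F * G) k \<in> S"
  unfolding coeff_mult by (intro subfield_sum subfield_mult)

lemma coeffs_in_subfield_mod:
  assumes D: "\<And>k. coeff D k \<in> S" "D \<noteq> 0"
  shows "(\<And>k. coeff F k \<in> S) \<Longrightarrow> coeff (F mod D) k \<in> S"
proof (induction "Polynomial.degree F" arbitrary: F k rule: less_induct)
  case less
  show ?case
  proof (cases "F = 0 \<or> Polynomial.degree F < Polynomial.degree D \<or> Polynomial.degree F = 0")
    case True
    show ?thesis
    proof (cases "Polynomial.degree F < Polynomial.degree D \<or> F = 0")
      case True
      then show ?thesis using less.prems by (auto simp: mod_poly_less subfield_0)
    next
      case False
      then have "Polynomial.degree D = 0" using True by auto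
      then have "is_unit D" using D(2) by (simp add: is_unit_iff_degree)
      then have "F mod D = 0" by (simp add: unit_imp_mod_eq_0)
      then show ?thesis by (simp add: subfield_0)
    qed
  next
    case False
    define M where "M = Polynomial.monom (lead_coeff F / lead_coeff D) (Polynomial.degree F - Polynomial.degree D)"
    define G where "G = F - M * D"
    have MS: "coeff M k \<in> S" for k
      unfolding M_def using less.prems D by (auto intro: subfield_divide simp: subfield_0)
    have GS: "coeff G k \<in> S" for k
      unfolding G_def using coeffs_in_subfield_mult[OF MS D(1)] less.prems
      by (auto intro: subfield_diff)
    have M0: "M \<noteq> 0" using False D(2) by (simp add: M_def monom_eq_0_iff)
    have "lead_coeff F / lead_coeff D \<noteq> 0" using False D(2) by simp
    then have "Polynomial.degree M = Polynomial.degree F - Polynomial.degree D"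
      unfolding M_def by (rule degree_monom_eq)
    then have dM: "Polynomial.degree (M * D) = Polynomial.degree F"
      using M0 D(2) False by (subst degree_mult_eq) auto
    have lM: "lead_coeff (M * D) = lead_coeff F"
    proof -
      have "lead_coeff M = lead_coeff F / lead_coeff D" unfolding M_def by (rule lead_coeff_monom)
      then show ?thesis using D(2) by (simp add: lead_coeff_mult)
    qed
    have "coeff G (Polynomial.degree F) = 0"
      using lM by (simp add: G_def dM)
    moreover have "Polynomial.degree G \<le> Polynomial.degree F"
      unfolding G_def by (rule degree_diff_le) (simp_all add: dM)
    ultimately have "Polynomial.degree G < Polynomial.degree F"
      using False by (metis coeff_0 eq_zero_or_degree_less leading_coeff_0_iff degree_0 le_neq_implies_less neq0_conv)
    then have "coeff (G mod D) k \<in> S" using less.hyps GS by blast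
    moreover have "G mod D = F mod D" unfolding G_def
      by (metis diff_zero mod_mod_trivial mod_mult_self2_is_0 poly_mod_diff_left)
    ultimately show ?thesis by simp
  qed
qed

end

text \<open>The minimal polynomial of \<open>\<beta>\<close> over the subfield \<open>S\<close> divides every polynomial over
  \<open>S\<close> that vanishes at \<open>\<beta>\<close>; when \<open>\<beta>\<close> is the only common root of two of them, it is a power of
  \<open>X - \<beta>\<close>, and its second coefficient already shows that \<open>\<beta>\<close> lies in \<open>S\<close>.\<close>

lemma only_common_root_in_subfield:
  assumes S: "subfield_of_complex S"
    and F: "\<And>k. coeff F k \<in> S" "F \<noteq> 0" "poly F \<beta> = 0"
    and G: "\<And>k. coeff G k \<in> S" "poly G \<beta> = 0"
    and only: "\<And>z. poly F z = 0 \<Longrightarrow> poly G z = 0 \<Longrightarrow> z = \<beta>"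
  shows "\<beta> \<in> S"
proof -
  define Q where "Q D \<longleftrightarrow> (\<forall>k. coeff D k \<in> S) \<and> D \<noteq> 0 \<and> poly D \<beta> = 0" for D
  have "Q F" using F by (simp add: Q_def)
  then obtain D where D: "Q D" and min: "\<And>E. Q E \<Longrightarrow> Polynomial.degree D \<le> Polynomial.degree E"
    using ex_has_least_nat[of Q F Polynomial.degree] by blast
  have dvd: "D dvd H" if H: "\<And>k. coeff H k \<in> S" "poly H \<beta> = 0" for H
  proof (rule ccontr)
    assume n: "\<not> D dvd H"
    have "Q (H mod D)"
      unfolding Q_def
    proof (intro conjI allI)
      show "coeff (H mod D) k \<in> S" for k
        using coeffs_in_subfield_mod[OF S] D H by (auto simp: Q_def)
      show "H mod D \<noteq> 0" using n by (simp add: dvd_eq_mod_eq_0)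
      have "poly (H div D * D + H mod D) \<beta> = 0" using H(2) by simp
      then show "poly (H mod D) \<beta> = 0" using D unfolding poly_add poly_mult Q_def by simp
    qed
    then have "Polynomial.degree D \<le> Polynomial.degree (H mod D)" by (rule min)
    moreover have "H mod D \<noteq> 0" using n by (simp add: dvd_eq_mod_eq_0)
    ultimately show False using degree_mod_less[of D H] D by (auto simp: Q_def)
  qed
  have roots: "z = \<beta>" if "poly D z = 0" for z
    using only[of z] dvd[of F] dvd[of G] F G that by (metis dvd_trans poly_eq_0_iff_dvd)
  obtain as where as: "smult (lead_coeff D) (\<Prod>a\<leftarrow>as. [:- a, 1:]) = D"
    and len: "length as = Polynomial.degree D"
    using fundamental_theorem_algebra_factorized[of D] by blast
  have "set as \<subseteq> {\<beta>}"
  proof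
    fix a assume a: "a \<in> set as"
    then have "poly (\<Prod>a\<leftarrow>as. [:- a, 1:]) a = 0"
      by (induction as) auto
    then have "poly D a = 0" by (subst as[symmetric]) simp
    then show "a \<in> {\<beta>}" using roots by simp
  qed
  then have "as = replicate (Polynomial.degree D) \<beta>" using len
    by (metis replicate_length_same singletonD subsetD)
  then have De: "D = smult (lead_coeff D) ([:- \<beta>, 1:] ^ Polynomial.degree D)"
    using as by (metis map_replicate prod_list_replicate)
  have d0: "Polynomial.degree D \<noteq> 0"
  proof
    assume "Polynomial.degree D = 0"
    then obtain c where "D = [:c:]" by (rule degree_eq_zeroE)
    then show False using D by (simp add: Q_def)
  qed
  then obtain n where n: "Polynomial.degree D = Suc n" using not0_implies_Suc by blast
  have "coeff D n = lead_coeff D * (of_nat (Suc n) * (- \<beta>))"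
    by (subst De, subst coeff_smult, subst n, subst coeff_linear_poly_power) auto
  then have "\<beta> = - (coeff D n / (lead_coeff D * of_nat (Suc n)))"
    using D by (simp add: Q_def field_simps del: of_nat_Suc)
  also have "\<dots> \<in> S"
    using D unfolding Q_def
    by (intro subfield_uminus[OF S] subfield_divide[OF S] subfield_mult[OF S] subfield_of_nat[OF S]) auto
  finally show ?thesis .
qed

text \<open>The number \<open>c\<close> avoids the finitely many values for which another root of the equation of \<open>\<beta>\<close> is also a root of
  the equation of \<open>\<alpha>\<close>, transported by \<open>z \<mapsto> \<alpha> + c \<beta> - c z\<close>. So \<open>\<beta>\<close> is the only common root of two polynomials with
  coefficients in every subfield that contains \<open>\<alpha> + c \<beta>\<close>.\<close>

lemma primitive_element_two:
  assumes "algebraic_int (\<alpha>::complex)" "algebraic_int \<beta>"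
  shows "\<exists>c::nat. \<forall>S. subfield_of_complex S \<longrightarrow> \<alpha> + of_nat c * \<beta> \<in> S \<longrightarrow> \<alpha> \<in> S \<and> \<beta> \<in> S"
proof -
  obtain f g :: "int poly" where f: "poly (of_int_poly f) \<alpha> = 0" "lead_coeff f = 1"
    and g: "poly (of_int_poly g) \<beta> = 0" "lead_coeff g = 1"
    using assms unfolding algebraic_int_altdef_ipoly by blast
  have f0: "of_int_poly f \<noteq> (0::complex poly)" and g0: "of_int_poly g \<noteq> (0::complex poly)" using f g by auto
  define Rf where "Rf = {z::complex. poly (of_int_poly f) z = 0}"
  define Rg where "Rg = {z::complex. poly (of_int_poly g) z = 0}"
  have fin: "finite Rf" "finite Rg" using f0 g0 poly_roots_finite by (auto simp: Rf_def Rg_def)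
  define Bad where "Bad = (\<lambda>(x,y). (\<alpha> - x) / (y - \<beta>)) ` (Rf \<times> Rg)"
  have "finite Bad" using fin by (simp add: Bad_def)
  then have "finite {c. (of_nat c :: complex) \<in> Bad}"
    by (rule finite_vimageI[where h = of_nat, unfolded vimage_def]) (simp add: inj_on_def)
  then obtain c :: nat where c: "of_nat c \<notin> Bad"
    using ex_new_if_finite[OF infinite_UNIV_nat] by fastforce
  have "\<beta> \<in> S \<and> \<alpha> \<in> S" if S: "subfield_of_complex S" and \<gamma>: "\<alpha> + of_nat c * \<beta> \<in> S" for S
  proof -
    define H where "H = pcompose (of_int_poly f) [:\<alpha> + of_nat c * \<beta>, - of_nat c:]"
    have pH: "poly H z = poly (of_int_poly f) (\<alpha> + of_nat c * \<beta> - of_nat c * z)" for z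
      by (simp add: H_def poly_pcompose algebra_simps)
    have \<beta>: "\<beta> \<in> S"
    proof (rule only_common_root_in_subfield[OF S _ g0 g(1), of H])
      show "coeff (of_int_poly g) k \<in> S" for k using subfield_of_int[OF S] by simp
      have "coeff (pcompose (of_int_poly q) [:\<alpha> + of_nat c * \<beta>, - of_nat c:]) k \<in> S" for q :: "int poly" and k
      proof (induction q arbitrary: k)
        case 0
        then show ?case using subfield_0[OF S] by simp
      next
        case (pCons a q)
        have l: "coeff [:\<alpha> + of_nat c * \<beta>, - of_nat c:] k \<in> S" for k
          using \<gamma> subfield_uminus[OF S subfield_of_nat[OF S]] subfield_0[OF S]
          by (auto simp: coeff_pCons split: nat.splits)
        have a: "coeff [:of_int a:] k \<in> S" for k
          using subfield_of_int[OF S] subfield_0[OF S] by (auto simp: coeff_pCons split: nat.splits)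
        have e: "of_int_poly (pCons a q) = pCons (of_int a :: complex) (of_int_poly q)" by (rule of_int_hom.map_poly_pCons_hom)
        show ?case unfolding e pcompose_pCons coeff_add
          by (intro subfield_add[OF S] a coeffs_in_subfield_mult[OF S] l pCons.IH)
      qed
      then show "coeff H k \<in> S" for k by (simp add: H_def)
      show "poly H \<beta> = 0" using f by (simp add: pH)
      fix z assume z: "poly (of_int_poly g) z = 0" "poly H z = 0"
      show "z = \<beta>"
      proof (rule ccontr)
        assume ne: "z \<noteq> \<beta>"
        define x where "x = \<alpha> + of_nat c * \<beta> - of_nat c * z"
        have "x \<in> Rf" using z pH by (simp add: Rf_def x_def)
        moreover have "z \<in> Rg" using z by (simp add: Rg_def)
        moreover have "of_nat c = (\<alpha> - x) / (z - \<beta>)" using ne by (simp add: x_def field_simps)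
        ultimately have "of_nat c \<in> Bad" unfolding Bad_def by (intro image_eqI[of _ _ "(x,z)"]) auto
        then show False using c by simp
      qed
    qed
    have "(\<alpha> + of_nat c * \<beta>) - of_nat c * \<beta> \<in> S"
      using \<gamma> \<beta> by (intro subfield_diff[OF S] subfield_mult[OF S] subfield_of_nat[OF S])
    then show ?thesis using \<beta> by simp
  qed
  then show ?thesis by blast
qed

lemma primitive_element:
  assumes "finite A" "\<And>a. a \<in> A \<Longrightarrow> algebraic_int (a::complex)"
  shows "\<exists>\<gamma>. algebraic_int \<gamma> \<and> (\<forall>S. subfield_of_complex S \<longrightarrow> (\<gamma> \<in> S \<longleftrightarrow> A \<subseteq> S))"
  using assms
proof (induction A rule: finite_induct)
  case empty
  then show ?case using subfield_0 by (intro exI[of _ 0]) auto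
next
  case (insert a A)
  then obtain \<gamma> where \<gamma>: "algebraic_int \<gamma>" "\<And>S. subfield_of_complex S \<Longrightarrow> \<gamma> \<in> S \<longleftrightarrow> A \<subseteq> S" by auto
  obtain c :: nat where c: "\<And>S. subfield_of_complex S \<Longrightarrow> a + of_nat c * \<gamma> \<in> S \<Longrightarrow> a \<in> S \<and> \<gamma> \<in> S"
    using primitive_element_two[of a \<gamma>] \<gamma>(1) insert.prems by auto
  have "a + of_nat c * \<gamma> \<in> S" if "subfield_of_complex S" "a \<in> S" "\<gamma> \<in> S" for S
    using that by (intro subfield_add subfield_mult subfield_of_nat)
  moreover have "algebraic_int (a + of_nat c * \<gamma>)"
    using \<gamma> insert.prems by (intro algebraic_int_plus algebraic_int_times) auto
  ultimately show ?case using c \<gamma> insert.prems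
    by (intro exI[of _ "a + of_nat c * \<gamma>"]) auto
qed

interpretation of_rat_poly_hom: map_poly_comm_ring_hom "of_rat :: rat \<Rightarrow> complex" ..

definition rat_eval :: "rat poly \<Rightarrow> complex \<Rightarrow> complex" where
  "rat_eval h z = poly (map_poly of_rat h) z"

lemma rat_eval_simps [simp]:
  "rat_eval (g + h) z = rat_eval g z + rat_eval h z"
  "rat_eval (g - h) z = rat_eval g z - rat_eval h z"
  "rat_eval (g * h) z = rat_eval g z * rat_eval h z"
  "rat_eval [:c:] z = of_rat c"
  "rat_eval 0 z = 0"
  "rat_eval 1 z = 1"
  by (simp_all add: rat_eval_def of_rat_poly_hom.hom_add of_rat_poly_hom.hom_minus of_rat_poly_hom.hom_mult
      of_rat_hom.map_poly_pCons_hom)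

lemma rat_eval_pcompose: "rat_eval (pcompose g h) z = rat_eval g (rat_eval h z)"
  by (simp add: rat_eval_def hom_distribs poly_pcompose)

lemma rat_eval_of_int_poly: "rat_eval (of_int_poly f) z = poly (of_int_poly f) z"
proof -
  have "map_poly of_rat (of_int_poly f) = (of_int_poly f :: complex poly)"
    by (rule poly_eqI) simp
  then show ?thesis by (simp add: rat_eval_def)
qed

lemma rat_eval_in_subfield: "subfield_of_complex S \<Longrightarrow> z \<in> S \<Longrightarrow> rat_eval h z \<in> S"
  unfolding rat_eval_def by (rule subfield_poly) (auto intro: subfield_of_rat)

text \<open>By Bezout's identity, a polynomial that is not divisible by the minimal polynomial \<open>g\<close> of \<open>\<gamma>\<close> vanishes at no root
  of \<open>g\<close>. Applied to the derivative of \<open>g\<close>, this shows that the roots are simple.\<close>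

lemma minimal_polynomial:
  assumes "algebraic_int (\<gamma>::complex)"
  obtains g where "g \<noteq> 0" "rat_eval g \<gamma> = 0"
    "\<And>h z. rat_eval g z = 0 \<Longrightarrow> rat_eval h z = 0 \<longleftrightarrow> g dvd h"
    "\<And>h. rat_eval h \<gamma> \<noteq> 0 \<Longrightarrow> \<exists>u. rat_eval u \<gamma> * rat_eval h \<gamma> = 1"
    "card {z. rat_eval g z = 0} = Polynomial.degree g"
proof -
  obtain f :: "int poly" where f: "poly (of_int_poly f) \<gamma> = 0" "lead_coeff f = 1"
    using assms unfolding algebraic_int_altdef_ipoly by blast
  define Q where "Q h \<longleftrightarrow> h \<noteq> 0 \<and> rat_eval h \<gamma> = 0" for h
  have "Q (of_int_poly f)" using f by (auto simp: Q_def rat_eval_of_int_poly)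
  then obtain g where g: "Q g" and min: "\<And>h. Q h \<Longrightarrow> Polynomial.degree g \<le> Polynomial.degree h"
    using ex_has_least_nat[of Q _ Polynomial.degree] by blast
  have bez: "g dvd h \<or> (\<exists>u v. u * g + v * h = 1)" for h
  proof -
    define d where "d = gcd g h"
    obtain a b where ab: "a * g + b * h = d"
      using bezout_coefficients_fst_snd[of g h] d_def by metis
    obtain e where e: "g = d * e" unfolding d_def by (metis dvdE gcd_dvd1)
    have d0: "d \<noteq> 0" "e \<noteq> 0" using e g by (auto simp: Q_def)
    have "rat_eval d \<gamma> = 0 \<or> rat_eval e \<gamma> = 0" using g e by (auto simp: Q_def)
    then show ?thesis
    proof
      assume "rat_eval d \<gamma> = 0"
      then have "Polynomial.degree g \<le> Polynomial.degree d" using d0 by (intro min) (simp add: Q_def)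
      then have "Polynomial.degree e = 0" using d0 e by (simp add: degree_mult_eq)
      then have "is_unit e" using d0 by (simp add: is_unit_iff_degree)
      then have "g dvd d" using e by (metis dvd_refl mult_unit_dvd_iff)
      then show ?thesis unfolding d_def by (metis dvd_trans gcd_dvd2)
    next
      assume "rat_eval e \<gamma> = 0"
      then have "Polynomial.degree g \<le> Polynomial.degree e" using d0 by (intro min) (simp add: Q_def)
      then have "Polynomial.degree d = 0" using d0 e by (simp add: degree_mult_eq)
      then have "is_unit d" using d0 by (simp add: is_unit_iff_degree)
      then obtain w where "1 = d * w" by (elim dvdE)
      then have "(w * a) * g + (w * b) * h = 1" using ab by (metis distrib_left mult.assoc mult.commute)
      then show ?thesis by blast
    qed
  qed
  have root: "rat_eval h z = 0 \<longleftrightarrow> g dvd h" if z: "rat_eval g z = 0" for h z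
  proof
    assume h: "rat_eval h z = 0"
    show "g dvd h"
    proof (rule ccontr)
      assume "\<not> g dvd h"
      then obtain u v where "u * g + v * h = 1" using bez by blast
      then have "rat_eval (u * g + v * h) z = 1" by simp
      then show False using z h by simp
    qed
  qed (use z in \<open>auto elim!: dvdE\<close>)
  have inv: "\<exists>u. rat_eval u \<gamma> * rat_eval h \<gamma> = 1" if "rat_eval h \<gamma> \<noteq> 0" for h
  proof -
    have "\<not> g dvd h" using root[of \<gamma> h] g that by (auto simp: Q_def)
    then obtain u v where "u * g + v * h = 1" using bez by blast
    then have "rat_eval (u * g + v * h) \<gamma> = 1" by simp
    then show ?thesis using g by (auto simp: Q_def)
  qed
  have dg: "Polynomial.degree g \<noteq> 0"
  proof
    assume "Polynomial.degree g = 0"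
    then obtain c where "g = [:c:]" by (rule degree_eq_zeroE)
    then show False using g by (simp add: Q_def)
  qed
  have sq: "rsquarefree (map_poly of_rat g :: complex poly)"
    unfolding rsquarefree_roots
  proof (intro allI notI)
    fix z :: complex
    assume "poly (map_poly of_rat g) z = 0 \<and> poly (pderiv (map_poly of_rat g)) z = 0"
    then have "rat_eval g z = 0" "rat_eval (pderiv g) z = 0"
      by (auto simp: rat_eval_def hom_distribs)
    then have "g dvd pderiv g" using root by blast
    moreover have "pderiv g \<noteq> 0" using dg by (simp add: pderiv_eq_0_iff)
    ultimately have "Polynomial.degree g \<le> Polynomial.degree (pderiv g)" by (rule dvd_imp_degree_le)
    then show False using dg by (simp add: degree_pderiv)
  qed
  define G where "G = (map_poly of_rat g :: complex poly)"
  have fin: "finite {z. poly G z = 0}"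
    using g by (intro poly_roots_finite) (simp add: G_def Q_def)
  have "Polynomial.degree g = Polynomial.degree G" by (simp add: G_def)
  also have "\<dots> = Polynomial.degree (\<Prod>z | poly G z = 0. [:- z, 1:])"
  proof -
    have "G \<noteq> 0" using g by (simp add: G_def Q_def)
    then show ?thesis
      using complex_poly_decompose_rsquarefree[OF sq]
      by (metis G_def degree_smult_eq leading_coeff_0_iff)
  qed
  also have "\<dots> = card {z. poly G z = 0}"
    by (subst degree_prod_eq_sum_degree) (use fin in auto)
  finally have card: "card {z. rat_eval g z = 0} = Polynomial.degree g"
    by (simp add: rat_eval_def G_def)
  show ?thesis using that[of g] g root inv card by (auto simp: Q_def)
qed

locale monic_int_poly =
  fixes f :: "int poly"
  assumes monic: "lead_coeff f = 1"
begin

abbreviation "F \<equiv> (map_poly rat_of_int f)"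
definition "R = complex_roots_of F"
definition "K = carrier (splitting_field F)"

lemma R_eq: "R = {z. poly (of_int_poly f) z = 0}"
  using rat_eval_of_int_poly[of f] by (simp add: R_def complex_roots_of_def rat_eval_def)

lemma algebraic_int_R [intro]: "x \<in> R \<Longrightarrow> algebraic_int x"
  using monic unfolding R_eq algebraic_int_altdef_ipoly by auto

lemma finite_R [simp]: "finite R"
  unfolding R_eq by (rule poly_roots_finite) (use monic in auto)

lemma splitting_field_simps:
  "x \<otimes>\<^bsub>splitting_field F\<^esub> y = x * y" "x \<oplus>\<^bsub>splitting_field F\<^esub> y = x + y"
  "\<one>\<^bsub>splitting_field F\<^esub> = 1" "\<zero>\<^bsub>splitting_field F\<^esub> = 0"
  by (simp_all add: splitting_field_def ring_of_type_algebra_def)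

lemma ring_of_type_simps:
  fixes x y :: complex
  shows "x \<otimes>\<^bsub>ring_of_type_algebra\<^esub> y = x * y" "x \<oplus>\<^bsub>ring_of_type_algebra\<^esub> y = x + y"
    "\<one>\<^bsub>ring_of_type_algebra\<^esub> = (1::complex)" "\<zero>\<^bsub>ring_of_type_algebra\<^esub> = (0::complex)"
    "\<ominus>\<^bsub>ring_of_type_algebra\<^esub> x = - x"
    "x \<noteq> 0 \<Longrightarrow> inv\<^bsub>ring_of_type_algebra\<^esub> x = inverse x"
proof -
  interpret C: Ring.field "ring_of_type_algebra :: complex ring" by (rule field_from_type_algebra)
  show s: "x \<otimes>\<^bsub>ring_of_type_algebra\<^esub> y = x * y" "x \<oplus>\<^bsub>ring_of_type_algebra\<^esub> y = x + y"
    "\<one>\<^bsub>ring_of_type_algebra\<^esub> = (1::complex)" "\<zero>\<^bsub>ring_of_type_algebra\<^esub> = (0::complex)" for x y :: complex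
    by (simp_all add: ring_of_type_algebra_def)
  have c: "z \<in> carrier ring_of_type_algebra" for z :: complex by (simp add: ring_of_type_algebra_def)
  show "\<ominus>\<^bsub>ring_of_type_algebra\<^esub> x = - x"
    using C.minus_equality[of "- x" x] c s by simp
  show "inv\<^bsub>ring_of_type_algebra\<^esub> x = inverse x" if "x \<noteq> 0"
    using C.inv_unique'[of x "inverse x"] c s that by simp
qed

lemma K_alt: "K = generate_field ring_of_type_algebra (\<rat> \<union> R)"
  by (simp add: K_def splitting_field_def R_def)

lemma subfield_K: "subfield_of_complex K"
proof -
  have 1: "1 \<in> K" unfolding K_alt using generate_field.one[of "ring_of_type_algebra :: complex ring"]
    by (simp add: ring_of_type_simps)
  have neg: "- x \<in> K" if "x \<in> K" for x
    using generate_field.a_inv[of x ring_of_type_algebra] that unfolding K_alt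
    by (simp add: ring_of_type_simps)
  have add: "x + y \<in> K" if "x \<in> K" "y \<in> K" for x y
    using generate_field.eng_add[of x ring_of_type_algebra _ y] that unfolding K_alt
    by (simp add: ring_of_type_simps)
  have mult: "x * y \<in> K" if "x \<in> K" "y \<in> K" for x y
    using generate_field.eng_mult[of x ring_of_type_algebra _ y] that unfolding K_alt
    by (simp add: ring_of_type_simps)
  have inv: "inverse x \<in> K" if "x \<in> K" for x
    using generate_field.m_inv[of x ring_of_type_algebra] that unfolding K_alt
    by (cases "x = 0") (simp_all add: ring_of_type_simps)
  show ?thesis unfolding subfield_of_complex_def
    using 1 mult inv add[OF _ neg] by auto
qed

lemma R_subset_K: "R \<subseteq> K" unfolding K_alt by (auto intro: generate_field.incl)

lemma K_minimal:
  assumes S: "subfield_of_complex S" and RS: "R \<subseteq> S"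
  shows "K \<subseteq> S"
proof
  fix x assume "x \<in> K"
  then have "x \<in> generate_field ring_of_type_algebra (\<rat> \<union> R)" by (simp add: K_alt)
  then show "x \<in> S"
  proof (induction rule: generate_field.induct)
    case (incl h)
    then show ?case using subfield_Rats[OF S] RS by auto
  next
    case (m_inv h)
    then show ?case using subfield_inverse[OF S] by (simp add: ring_of_type_simps)
  qed (use S in \<open>auto simp: ring_of_type_simps intro: subfield_1 subfield_uminus subfield_add subfield_mult\<close>)
qed

lemma galois_group_iff:
  "\<sigma> \<in> galois_group F \<longleftrightarrow> \<sigma> \<in> extensional K \<and> bij_betw \<sigma> K K \<and> \<sigma> 1 = 1 \<and>
     (\<forall>x\<in>K. \<forall>y\<in>K. \<sigma> (x + y) = \<sigma> x + \<sigma> y \<and> \<sigma> (x * y) = \<sigma> x * \<sigma> y) \<and> (\<forall>q\<in>\<rat>. \<sigma> q = q)"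
  unfolding galois_group_def ring_iso_def Ring.ring_hom_def K_def[symmetric]
  by (auto simp: splitting_field_simps dest: bij_betw_imp_funcset)

text \<open>The image of \<open>K\<close> and the set of elements of \<open>K\<close> with image in \<open>K\<close> are subfields that contain the roots, so both
  contain \<open>K\<close>.\<close>

lemma restrict_in_galois_group:
  assumes "\<phi> 1 = 1" "\<And>x y. x \<in> K \<Longrightarrow> y \<in> K \<Longrightarrow> \<phi> (x + y) = \<phi> x + \<phi> y"
    "\<And>x y. x \<in> K \<Longrightarrow> y \<in> K \<Longrightarrow> \<phi> (x * y) = \<phi> x * \<phi> y" "\<And>q. q \<in> \<rat> \<Longrightarrow> \<phi> q = q" "\<phi> ` R \<subseteq> R"
  shows "restrict \<phi> K \<in> galois_group F"
proof -
  note K = subfield_K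
  have diff: "\<phi> (x - y) = \<phi> x - \<phi> y" if "x \<in> K" "y \<in> K" for x y
    using assms(2)[of "x - y" y] that subfield_diff[OF K] by (simp add: algebra_simps)
  have nz: "\<phi> x \<noteq> 0" if "x \<in> K" "x \<noteq> 0" for x
    using assms(3)[of x "inverse x"] that subfield_inverse[OF K] assms(1) by auto
  have zero: "\<phi> 0 = 0" using diff[of 0 0] subfield_0[OF K] by simp
  have inv: "\<phi> (inverse x) = inverse (\<phi> x)" if "x \<in> K" for x
  proof (cases "x = 0")
    case False
    have "\<phi> x * \<phi> (inverse x) = 1"
      using assms(3)[of x "inverse x"] that subfield_inverse[OF K] assms(1) False by auto
    then show ?thesis by (metis inverse_unique)
  qed (simp add: zero)
  have inj: "inj_on \<phi> K"
    by (rule inj_onI) (metis diff nz subfield_diff[OF K] eq_iff_diff_eq_0)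
  have "subfield_of_complex {x \<in> K. \<phi> x \<in> K}"
    unfolding subfield_of_complex_def using assms(1,3) diff inv
    by (auto intro: subfield_1[OF K] subfield_diff[OF K] subfield_mult[OF K] subfield_inverse[OF K])
  then have "K \<subseteq> {x \<in> K. \<phi> x \<in> K}"
    using assms(5) R_subset_K by (intro K_minimal) auto
  moreover have "K \<subseteq> \<phi> ` K"
  proof (rule K_minimal)
    show "subfield_of_complex (\<phi> ` K)"
      unfolding subfield_of_complex_def
    proof (intro conjI ballI)
      show "1 \<in> \<phi> ` K" using assms(1) subfield_1[OF K] by force
      fix x assume x: "x \<in> \<phi> ` K"
      then show "inverse x \<in> \<phi> ` K" using inv subfield_inverse[OF K] by (metis (no_types, lifting) imageE image_eqI)
      fix y assume y: "y \<in> \<phi> ` K"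
      obtain a b where ab: "x = \<phi> a" "y = \<phi> b" "a \<in> K" "b \<in> K" using x y by auto
      show "x - y \<in> \<phi> ` K" using ab diff[of a b] subfield_diff[OF K, of a b] by (metis image_eqI)
      show "x * y \<in> \<phi> ` K" using ab assms(3)[of a b] subfield_mult[OF K, of a b] by (metis image_eqI)
    qed
    have "\<phi> ` R = R"
      using assms(5) finite_R inj R_subset_K by (meson endo_inj_surj inj_on_subset)
    then show "R \<subseteq> \<phi> ` K" using R_subset_K by blast
  qed
  ultimately have "bij_betw \<phi> K K" using inj unfolding bij_betw_def by auto
  then have "bij_betw (restrict \<phi> K) K K" by (simp cong: bij_betw_cong)
  then show ?thesis unfolding galois_group_iff
    using assms subfield_1[OF K] subfield_add[OF K] subfield_mult[OF K] subfield_Rats[OF K] by auto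
qed

lemma galois_rat_eval:
  assumes "\<sigma> \<in> galois_group F" "z \<in> K"
  shows "\<sigma> (rat_eval h z) = rat_eval h (\<sigma> z)"
proof (induction h)
  case 0
  then show ?case using assms by (simp add: galois_group_iff)
next
  case (pCons a h)
  have e: "rat_eval (pCons a h) x = of_rat a + x * rat_eval h x" for x
    by (simp add: rat_eval_def of_rat_hom.map_poly_pCons_hom)
  have "of_rat a \<in> K" "rat_eval h z \<in> K" "z * rat_eval h z \<in> K"
    using subfield_K assms subfield_of_rat rat_eval_in_subfield subfield_mult by metis+
  then show ?case unfolding e using assms pCons unfolding galois_group_iff by simp
qed

lemma galois_permutes_roots:
  assumes "\<sigma> \<in> galois_group F"
  shows "bij_betw \<sigma> R R"
proof -
  have "\<sigma> x \<in> R" if "x \<in> R" for x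
    using galois_rat_eval[OF assms, of x F] that R_subset_K assms
    by (auto simp: R_eq rat_eval_of_int_poly galois_group_iff)
  then have "\<sigma> ` R \<subseteq> R" by auto
  moreover have "inj_on \<sigma> R"
    using assms R_subset_K unfolding galois_group_iff bij_betw_def by (blast intro: inj_on_subset)
  ultimately show ?thesis by (simp add: bij_betw_def endo_inj_surj)
qed

text \<open>With a primitive element \<open>\<gamma>\<close>, the automorphisms are
  the substitutions of the other roots of its minimal polynomial \<open>g\<close> for \<open>\<gamma>\<close>. If all of them fix
  \<open>h(\<gamma>)\<close>, where \<open>h\<close> has degree less than \<open>g\<close>, then \<open>h - h(\<gamma>)\<close> has too many roots.\<close>

lemma galois_fixed_imp_rational:
  assumes z: "z \<in> K" and fixed: "\<And>\<sigma>. \<sigma> \<in> galois_group F \<Longrightarrow> \<sigma> z = z"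
  shows "z \<in> \<rat>"
proof -
  obtain \<gamma> where \<gamma>: "algebraic_int \<gamma>" "\<And>S. subfield_of_complex S \<Longrightarrow> \<gamma> \<in> S \<longleftrightarrow> R \<subseteq> S"
    using primitive_element[OF finite_R] algebraic_int_R by metis
  obtain g where g: "g \<noteq> 0" "rat_eval g \<gamma> = 0"
    and root: "\<And>h z. rat_eval g z = 0 \<Longrightarrow> rat_eval h z = 0 \<longleftrightarrow> g dvd h"
    and inv: "\<And>h. rat_eval h \<gamma> \<noteq> 0 \<Longrightarrow> \<exists>u. rat_eval u \<gamma> * rat_eval h \<gamma> = 1"
    and card: "card {z. rat_eval g z = 0} = Polynomial.degree g"
    by (rule minimal_polynomial[OF \<gamma>(1)]) (rule that; blast)
  define Q where "Q = range (\<lambda>h. rat_eval h \<gamma>)"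
  have "subfield_of_complex Q"
    unfolding subfield_of_complex_def
  proof (intro conjI ballI)
    show "1 \<in> Q" unfolding Q_def by (intro image_eqI[of _ _ 1]) auto
    fix x assume "x \<in> Q"
    then obtain a where a: "x = rat_eval a \<gamma>" by (auto simp: Q_def)
    show "inverse x \<in> Q"
    proof (cases "x = 0")
      case True
      then show ?thesis unfolding Q_def by (intro image_eqI[of _ _ 0]) auto
    next
      case False
      then obtain u where "rat_eval u \<gamma> * x = 1" using inv a by auto
      then have "inverse x = rat_eval u \<gamma>" by (metis inverse_unique mult.commute)
      then show ?thesis by (auto simp: Q_def)
    qed
    fix y assume "y \<in> Q"
    then obtain b where b: "y = rat_eval b \<gamma>" by (auto simp: Q_def)
    show "x - y \<in> Q" unfolding Q_def a b by (intro image_eqI[of _ _ "a - b"]) auto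
    show "x * y \<in> Q" unfolding Q_def a b by (intro image_eqI[of _ _ "a * b"]) auto
  qed
  moreover have "\<gamma> \<in> Q" unfolding Q_def
    by (intro image_eqI[of _ _ "[:0,1:]"]) (auto simp: rat_eval_def of_rat_hom.map_poly_pCons_hom)
  ultimately have KQ: "K \<subseteq> Q" using \<gamma>(2) K_minimal by blast
  have \<gamma>K: "\<gamma> \<in> K" using \<gamma>(2)[OF subfield_K] R_subset_K by blast
  have dg: "Polynomial.degree g \<noteq> 0"
  proof
    assume "Polynomial.degree g = 0"
    then obtain c where "g = [:c:]" by (rule degree_eq_zeroE)
    then show False using g by simp
  qed
  obtain h0 where h0: "z = rat_eval h0 \<gamma>" using z KQ by (auto simp: Q_def)
  define h where "h = h0 mod g"
  have "h0 = h0 div g * g + h" by (simp add: h_def)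
  then have "rat_eval h0 \<gamma> = rat_eval (h0 div g * g + h) \<gamma>" by simp
  then have h: "z = rat_eval h \<gamma>" using h0 g by simp
  have dh: "Polynomial.degree h < Polynomial.degree g"
    using degree_mod_less[OF g(1), of h0] dg by (auto simp: h_def)
  have conj: "rat_eval h w = z" if w: "rat_eval g w = 0" for w
  proof -
    define \<phi> where "\<phi> x = rat_eval (SOME h. rat_eval h \<gamma> = x) w" for x
    have \<phi>: "\<phi> (rat_eval a \<gamma>) = rat_eval a w" for a
    proof -
      define b where "b = (SOME b. rat_eval b \<gamma> = rat_eval a \<gamma>)"
      have "rat_eval b \<gamma> = rat_eval a \<gamma>" unfolding b_def by (rule someI[of _ a]) simp
      then have "rat_eval (b - a) \<gamma> = 0" by simp
      then have "rat_eval (b - a) w = 0" using root g(2) w by blast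
      then show ?thesis by (simp add: \<phi>_def b_def)
    qed
    have in_Q: "\<exists>a. x = rat_eval a \<gamma>" if "x \<in> K" for x using KQ that by (auto simp: Q_def)
    have "restrict \<phi> K \<in> galois_group F"
    proof (rule restrict_in_galois_group)
      show "\<phi> 1 = 1" using \<phi>[of 1] by simp
      show "\<phi> (x + y) = \<phi> x + \<phi> y" if "x \<in> K" "y \<in> K" for x y
        using in_Q[OF that(1)] in_Q[OF that(2)] \<phi> by (metis rat_eval_simps(1))
      show "\<phi> (x * y) = \<phi> x * \<phi> y" if "x \<in> K" "y \<in> K" for x y
        using in_Q[OF that(1)] in_Q[OF that(2)] \<phi> by (metis rat_eval_simps(3))
      show "\<phi> q = q" if "q \<in> \<rat>" for q
        using that \<phi> by (metis Rats_cases rat_eval_simps(4))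
      show "\<phi> ` R \<subseteq> R"
      proof
        fix y assume "y \<in> \<phi> ` R"
        then obtain x where x: "x \<in> R" "y = \<phi> x" by auto
        obtain a where a: "x = rat_eval a \<gamma>" using in_Q x R_subset_K by blast
        have "rat_eval (pcompose F a) \<gamma> = 0"
          using x a by (simp add: rat_eval_pcompose rat_eval_of_int_poly R_eq)
        then have "rat_eval (pcompose F a) w = 0" using root g(2) w by blast
        then show "y \<in> R" using x a \<phi>[of a] by (simp add: rat_eval_pcompose rat_eval_of_int_poly R_eq)
      qed
    qed
    from fixed[OF this] have "\<phi> z = z" using z by simp
    then show ?thesis using \<phi>[of h] h by simp
  qed
  define H where "H = map_poly of_rat h - [:z:]"
  have "H = 0"
  proof (rule ccontr)
    assume "H \<noteq> 0"
    then have "card {x. poly H x = 0} \<le> Polynomial.degree H" by (rule card_poly_roots_bound)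
    moreover have "{x. rat_eval g x = 0} \<subseteq> {x. poly H x = 0}"
      using conj by (auto simp: H_def rat_eval_def)
    then have "card {x. rat_eval g x = 0} \<le> card {x. poly H x = 0}"
      using \<open>H \<noteq> 0\<close> by (intro card_mono poly_roots_finite)
    moreover have "Polynomial.degree H \<le> Polynomial.degree h"
      unfolding H_def by (rule degree_diff_le) auto
    ultimately show False using card dh by linarith
  qed
  then have "coeff (map_poly of_rat h) 0 = z" by (simp add: H_def)
  then show ?thesis by auto
qed

end

section \<open>The Frobenius automorphism at a large prime\<close>

context monic_int_poly
begin

lemma galois_comp:
  assumes "\<sigma> \<in> galois_group F" "\<tau> \<in> galois_group F"
  shows "restrict (\<sigma> \<circ> \<tau>) K \<in> galois_group F"
proof (rule restrict_in_galois_group)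
  have \<tau>K: "\<tau> x \<in> K" if "x \<in> K" for x
    using assms that unfolding galois_group_iff by (auto simp: bij_betw_def)
  show "(\<sigma> \<circ> \<tau>) (x + y) = (\<sigma> \<circ> \<tau>) x + (\<sigma> \<circ> \<tau>) y" if "x \<in> K" "y \<in> K" for x y
    using assms that \<tau>K unfolding galois_group_iff by simp
  show "(\<sigma> \<circ> \<tau>) (x * y) = (\<sigma> \<circ> \<tau>) x * (\<sigma> \<circ> \<tau>) y" if "x \<in> K" "y \<in> K" for x y
    using assms that \<tau>K unfolding galois_group_iff by simp
  show "(\<sigma> \<circ> \<tau>) ` R \<subseteq> R"
    using galois_permutes_roots[OF assms(1)] galois_permutes_roots[OF assms(2)]
    by (auto simp: bij_betw_def)
qed (use assms in \<open>auto simp: galois_group_iff\<close>)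

lemma galois_id: "restrict id K \<in> galois_group F"
  by (rule restrict_in_galois_group) auto

lemma galois_inverse:
  assumes "\<sigma> \<in> galois_group F"
  shows "restrict (inv_into K \<sigma>) K \<in> galois_group F"
proof (rule restrict_in_galois_group)
  have bij: "bij_betw \<sigma> K K" using assms by (simp add: galois_group_iff)
  note K = subfield_K
  have inv: "inv_into K \<sigma> x = y" if "y \<in> K" "\<sigma> y = x" for x y
    using bij that by (auto simp: bij_betw_def inv_into_f_f)
  have pre: "\<exists>y\<in>K. x = \<sigma> y" if "x \<in> K" for x using bij that by (auto simp: bij_betw_def)
  show "inv_into K \<sigma> 1 = 1" using inv subfield_1[OF K] assms by (simp add: galois_group_iff)
  show "inv_into K \<sigma> (x + y) = inv_into K \<sigma> x + inv_into K \<sigma> y" if xy: "x \<in> K" "y \<in> K" for x y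
  proof -
    obtain a b where ab: "a \<in> K" "b \<in> K" "x = \<sigma> a" "y = \<sigma> b" using pre xy by blast
    then have "x + y = \<sigma> (a + b)" using assms by (simp add: galois_group_iff)
    then show ?thesis using inv ab subfield_add[OF K] by metis
  qed
  show "inv_into K \<sigma> (x * y) = inv_into K \<sigma> x * inv_into K \<sigma> y" if xy: "x \<in> K" "y \<in> K" for x y
  proof -
    obtain a b where ab: "a \<in> K" "b \<in> K" "x = \<sigma> a" "y = \<sigma> b" using pre xy by blast
    then have "x * y = \<sigma> (a * b)" using assms by (simp add: galois_group_iff)
    then show ?thesis using inv ab subfield_mult[OF K] by metis
  qed
  show "inv_into K \<sigma> q = q" if "q \<in> \<rat>" for q
  proof (rule inv)
    show "q \<in> K" using that subfield_Rats[OF K] by blast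
    show "\<sigma> q = q" using that assms by (simp add: galois_group_iff)
  qed
  show "inv_into K \<sigma> ` R \<subseteq> R"
  proof
    fix y assume "y \<in> inv_into K \<sigma> ` R"
    then obtain x where x: "x \<in> R" "y = inv_into K \<sigma> x" by blast
    obtain z where "z \<in> R" "x = \<sigma> z"
      using galois_permutes_roots[OF assms] x by (auto simp: bij_betw_def)
    then show "y \<in> R" using inv[of z x] x R_subset_K by auto
  qed
qed

lemma galois_K: "\<sigma> \<in> galois_group F \<Longrightarrow> x \<in> K \<Longrightarrow> \<sigma> x \<in> K"
  unfolding galois_group_iff by (auto simp: bij_betw_def)

lemma galois_R: "\<sigma> \<in> galois_group F \<Longrightarrow> x \<in> R \<Longrightarrow> \<sigma> x \<in> R"
  using galois_permutes_roots by (auto simp: bij_betw_def)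

lemma galois_diff:
  assumes "\<sigma> \<in> galois_group F" "x \<in> K" "y \<in> K"
  shows "\<sigma> (x - y) = \<sigma> x - \<sigma> y"
proof -
  have "\<sigma> ((x - y) + y) = \<sigma> (x - y) + \<sigma> y"
    using assms subfield_diff[OF subfield_K] unfolding galois_group_iff by blast
  then show ?thesis by simp
qed

lemma galois_sum:
  assumes "\<sigma> \<in> galois_group F" "\<And>i. i \<in> I \<Longrightarrow> g i \<in> K"
  shows "\<sigma> (sum g I) = (\<Sum>i\<in>I. \<sigma> (g i))"
  using assms(2)
proof (induction I rule: infinite_finite_induct)
  case (insert i I)
  then have "sum g I \<in> K" using subfield_sum[OF subfield_K] by blast
  then show ?case using insert assms(1) by (simp add: galois_group_iff)
qed (use assms(1) in \<open>auto simp: galois_group_iff\<close>)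

lemma galois_prod_linear:
  assumes \<sigma>: "\<sigma> \<in> galois_group F" and "finite Z" "Z \<subseteq> K"
  shows "coeff (\<Prod>z\<in>Z. [:- z, 1:]) k \<in> K \<and>
    \<sigma> (coeff (\<Prod>z\<in>Z. [:- z, 1:]) k) = coeff (\<Prod>z\<in>Z. [:- \<sigma> z, 1:]) k"
  using assms(2,3)
proof (induction Z arbitrary: k rule: finite_induct)
  case empty
  have "\<sigma> 0 = 0" "\<sigma> 1 = 1" using \<sigma> by (auto simp: galois_group_iff)
  then show ?case using subfield_0[OF subfield_K] subfield_1[OF subfield_K] by simp
next
  case (insert x Z)
  define Q where "Q = (\<Prod>z\<in>Z. [:- z, 1:])"
  define Q' where "Q' = (\<Prod>z\<in>Z. [:- \<sigma> z, 1:])"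
  have IH: "coeff Q k \<in> K" "\<sigma> (coeff Q k) = coeff Q' k" for k
    using insert unfolding Q_def Q'_def by auto
  have e: "coeff ([:- z, 1:] * q) k = (case k of 0 \<Rightarrow> 0 | Suc l \<Rightarrow> coeff q l) - z * coeff q k" for z :: complex and q k
    by (simp add: coeff_pCons split: nat.split)
  have s0: "\<sigma> 0 = 0" using \<sigma> by (auto simp: galois_group_iff)
  have mem: "(case k of 0 \<Rightarrow> 0 | Suc l \<Rightarrow> coeff Q l) \<in> K" "x * coeff Q k \<in> K"
    using IH insert subfield_0[OF subfield_K] subfield_mult[OF subfield_K]
    by (auto split: nat.split)
  have "\<sigma> (coeff ([:- x, 1:] * Q) k) = (case k of 0 \<Rightarrow> 0 | Suc l \<Rightarrow> coeff Q' l) - \<sigma> x * coeff Q' k"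
    unfolding e galois_diff[OF \<sigma> mem] using \<sigma> IH insert.prems s0
    by (auto simp: galois_group_iff split: nat.split)
  moreover have "coeff ([:- x, 1:] * Q) k \<in> K"
    unfolding e by (rule subfield_diff[OF subfield_K mem])
  moreover have "(\<Prod>z\<in>insert x Z. [:- z, 1:]) = [:- x, 1:] * Q"
    "(\<Prod>z\<in>insert x Z. [:- \<sigma> z, 1:]) = [:- \<sigma> x, 1:] * Q'"
    using insert.hyps by (simp_all add: Q_def Q'_def)
  ultimately show ?case by (simp only: e)
qed

text \<open>The Galois group permutes the conjugates of \<open>a\<close>, so the coefficients of the product are rational; they are also
  algebraic integers.\<close>

lemma conjugates_polynomial:
  assumes a: "a \<in> K" "algebraic_int a" and O: "Orb = (\<lambda>\<sigma>. \<sigma> a) ` galois_group F" "finite Orb"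
    and int: "\<And>z. z \<in> Orb \<Longrightarrow> algebraic_int z"
  shows "\<exists>m. of_int_poly m = (\<Prod>z\<in>Orb. [:- z, 1:])"
proof -
  define M where "M = (\<Prod>z\<in>Orb. [:- z, 1:])"
  have OK: "Orb \<subseteq> K" using O a galois_K by auto
  have rat: "coeff M k \<in> \<rat>" for k
  proof (rule galois_fixed_imp_rational)
    show "coeff M k \<in> K" unfolding M_def using galois_prod_linear[OF galois_id O(2) OK] by simp
    fix \<sigma> assume \<sigma>: "\<sigma> \<in> galois_group F"
    have "\<sigma> ` Orb \<subseteq> Orb"
    proof
      fix y assume "y \<in> \<sigma> ` Orb"
      then obtain \<tau> where \<tau>: "\<tau> \<in> galois_group F" "y = \<sigma> (\<tau> a)" using O by auto
      then have "y = restrict (\<sigma> \<circ> \<tau>) K a" using a by simp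
      then show "y \<in> Orb" using galois_comp[OF \<sigma> \<tau>(1)] O by blast
    qed
    moreover have inj: "inj_on \<sigma> Orb"
      using \<sigma> OK unfolding galois_group_iff bij_betw_def by (blast intro: inj_on_subset)
    ultimately have "\<sigma> ` Orb = Orb" using O(2) by (simp add: endo_inj_surj)
    then have "(\<Prod>z\<in>Orb. [:- \<sigma> z, 1:]) = M"
      using prod.reindex[OF inj, of "\<lambda>z. [:- z, 1:]"] by (simp add: M_def)
    then show "\<sigma> (coeff M k) = coeff M k"
      using galois_prod_linear[OF \<sigma> O(2) OK, of k] by (simp add: M_def)
  qed
  have "int_coeffs M" unfolding M_def using int by (intro int_coeffs_prod) auto
  then have Ints: "coeff M k \<in> \<int>" for k
    using rat[of k] rational_algebraic_int_is_int[of "coeff M k"] by (simp add: int_coeffs_def)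
  define m where "m = map_poly (\<lambda>x. \<lfloor>Re x\<rfloor>) M"
  have "of_int \<lfloor>Re x\<rfloor> = x" if "x \<in> \<int>" for x :: complex
    using that by (auto elim!: Ints_cases)
  then have "of_int_poly m = M"
    using Ints by (intro poly_eqI) (simp add: m_def coeff_map_poly)
  then show ?thesis using M_def by blast
qed

text \<open>A combination \<open>a\<close> of the roots with coefficients \<open>1, t, t\<^sup>2, \<dots>\<close> determines the images of all roots,
  even modulo \<open>P\<close>, for a suitable integer \<open>t\<close>: each of the at most \<open>n\<^sup>n\<close> maps between the \<open>n\<close> roots excludes at most \<open>n\<close> residues, which is
  where \<open>p\<close> has to be large. The polynomial of the conjugates of \<open>a\<close> has integer coefficients, so
  it vanishes at \<open>a\<^sup>p\<close> modulo \<open>P\<close>, and \<open>a\<^sup>p\<close> is congruent to a conjugate of \<open>a\<close>.\<close>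

lemma frobenius_automorphism:
  assumes "residue_prime p P"
    and big: "p > card R * card R ^ card R"
  shows "\<exists>\<sigma>\<in>galois_group F. \<forall>x\<in>R. \<sigma> x - x ^ p \<in> P"
proof (rule ccontr)
  assume no: "\<not> ?thesis"
  interpret residue_prime p P by fact
  define n where "n = card R"
  obtain e where e: "bij_betw e {..<n} R"
    using ex_bij_betw_nat_finite[OF finite_R] by (auto simp: n_def lessThan_atLeast0)
  have eR: "e j \<in> R" if "j < n" for j using e that by (auto simp: bij_betw_def)
  define Pi where "Pi = (\<lambda>\<sigma>. restrict \<sigma> R) ` galois_group F"
  have Pi: "Pi \<subseteq> R \<rightarrow>\<^sub>E R"
    using galois_R by (auto simp: Pi_def)
  have fPi: "finite Pi" by (rule finite_subset[OF Pi]) (simp add: finite_PiE)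
  have cPi: "card Pi \<le> n ^ n"
    using card_mono[OF _ Pi] by (simp add: finite_PiE card_PiE n_def)
  \<comment> \<open>Modulo \<open>P\<close>, the value of \<open>D \<pi>\<close> at \<open>t\<close> compares \<open>\<pi>\<close> with the Frobenius map on \<open>a\<close>.\<close>
  define D where "D \<pi> = Poly (map (\<lambda>j. \<pi> (e j) - e j ^ p) [0..<n])" for \<pi>
  have cD: "coeff (D \<pi>) j = (if j < n then \<pi> (e j) - e j ^ p else 0)" for \<pi> j
    by (simp add: D_def nth_default_def)
  have pD: "poly (D \<pi>) t = (\<Sum>j<n. (\<pi> (e j) - e j ^ p) * t ^ j)" for \<pi> t
  proof -
    have "poly (D \<pi>) t = (\<Sum>j\<le>Polynomial.degree (D \<pi>). coeff (D \<pi>) j * t ^ j)" by (rule poly_altdef)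
    also have "\<dots> = (\<Sum>j<n. coeff (D \<pi>) j * t ^ j)"
    proof (rule sum.mono_neutral_cong)
      show "coeff (D \<pi>) i * t ^ i = 0" if "i \<in> {..Polynomial.degree (D \<pi>)} - {..<n}" for i
        using that by (simp add: cD)
    qed (auto simp: coeff_eq_0)
    finally show ?thesis by (simp add: cD)
  qed
  define B where "B \<pi> = {k \<in> {0..<p}. poly (D \<pi>) (of_nat k) \<in> P}" for \<pi>
  have cB: "card (B \<pi>) \<le> n" if \<pi>: "\<pi> \<in> Pi" for \<pi>
  proof -
    obtain \<sigma> where \<sigma>: "\<sigma> \<in> galois_group F" "\<pi> = restrict \<sigma> R" using \<pi> by (auto simp: Pi_def)
    obtain x where x: "x \<in> R" "\<sigma> x - x ^ p \<notin> P" using no \<sigma> by blast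
    then obtain j where j: "j < n" "e j = x" using e unfolding bij_betw_def by (metis imageE lessThan_iff)
    have "card ((of_nat :: nat \<Rightarrow> complex) ` B \<pi>) \<le> n"
    proof (rule card_roots_mod_le[of _ "D \<pi>"])
      show "finite ((of_nat :: nat \<Rightarrow> complex) ` B \<pi>)" by (simp add: B_def)
      show "int_coeffs (D \<pi>)" unfolding int_coeffs_def cD
        using Pi \<pi> eR by (auto intro!: algebraic_int_diff algebraic_int_power)
      show "Polynomial.degree (D \<pi>) \<le> n" by (rule degree_le) (simp add: cD)
      show "\<exists>k. coeff (D \<pi>) k \<notin> P" using x j \<sigma> by (intro exI[of _ j]) (simp add: cD)
      show "z = w" if zw: "z \<in> of_nat ` B \<pi>" "w \<in> of_nat ` B \<pi>" "z \<equiv>\<^sub>P w" for z w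
      proof -
        obtain k l where kl: "z = of_nat k" "w = of_nat l" "k < p" "l < p" using zw(1,2) by (auto simp: B_def)
        then have "int p dvd int k - int l" using zw(3) residue_eq_of_int_iff[of "int k" "int l"] by simp
        then have "int k mod int p = int l mod int p" by (simp add: mod_eq_dvd_iff)
        then show ?thesis using kl by simp
      qed
    qed (auto simp: B_def)
    then show ?thesis by (simp add: card_image inj_on_def)
  qed
  have "card (\<Union>\<pi>\<in>Pi. B \<pi>) \<le> (\<Sum>\<pi>\<in>Pi. card (B \<pi>))" by (rule card_UN_le[OF fPi])
  also have "\<dots> \<le> card Pi * n" using sum_bounded_above[of Pi "\<lambda>\<pi>. card (B \<pi>)" n] cB by simp
  also have "\<dots> \<le> n ^ n * n" using cPi by simp
  also have "\<dots> < p" using big by (simp add: n_def mult.commute)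
  finally have "card (\<Union>\<pi>\<in>Pi. B \<pi>) < card {0..<p}" by simp
  then have "\<not> {0..<p} \<subseteq> (\<Union>\<pi>\<in>Pi. B \<pi>)"
    using fPi card_mono[of "\<Union>\<pi>\<in>Pi. B \<pi>" "{0..<p}"] by (auto simp: B_def)
  then obtain t where "t \<in> {0..<p}" "t \<notin> (\<Union>\<pi>\<in>Pi. B \<pi>)" by blast
  then have t: "t < p" "\<And>\<pi>. \<pi> \<in> Pi \<Longrightarrow> poly (D \<pi>) (of_nat t) \<notin> P"
    by (auto simp: B_def)
  define a where "a = (\<Sum>j<n. e j * of_nat t ^ j)"
  have tK: "of_nat t ^ j \<in> K" for j using subfield_power[OF subfield_K] subfield_of_nat[OF subfield_K] by blast
  have ejK: "e j * of_nat t ^ j \<in> K" if "j < n" for j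
    using subfield_mult[OF subfield_K] tK eR[OF that] R_subset_K by blast
  have aK: "a \<in> K" unfolding a_def using ejK by (intro subfield_sum[OF subfield_K]) auto
  have aint: "algebraic_int a" unfolding a_def using eR
    by (intro algebraic_int_sum algebraic_int_times algebraic_int_power) auto
  have \<sigma>a: "\<sigma> a = (\<Sum>j<n. \<sigma> (e j) * of_nat t ^ j)" if \<sigma>: "\<sigma> \<in> galois_group F" for \<sigma>
  proof -
    have "\<sigma> a = (\<Sum>j<n. \<sigma> (e j * of_nat t ^ j))" unfolding a_def using ejK by (intro galois_sum[OF \<sigma>]) auto
    also have "\<dots> = (\<Sum>j<n. \<sigma> (e j) * of_nat t ^ j)"
    proof (rule sum.cong)
      fix j assume "j \<in> {..<n}"
      then have "e j \<in> K" using eR R_subset_K by auto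
      moreover have "\<sigma> (of_nat t ^ j) = of_nat t ^ j" using \<sigma> unfolding galois_group_iff
        by (metis Rats_of_nat of_nat_power)
      ultimately show "\<sigma> (e j * of_nat t ^ j) = \<sigma> (e j) * of_nat t ^ j"
        using \<sigma> tK[of j] unfolding galois_group_iff by metis
    qed simp
    finally show ?thesis .
  qed
  define Orb where "Orb = (\<lambda>\<sigma>. \<sigma> a) ` galois_group F"
  have "Orb \<subseteq> (\<lambda>\<pi>. \<Sum>j<n. \<pi> (e j) * of_nat t ^ j) ` Pi"
  proof
    fix y assume "y \<in> Orb"
    then obtain \<sigma> where \<sigma>: "\<sigma> \<in> galois_group F" "y = \<sigma> a" by (auto simp: Orb_def)
    have "y = (\<Sum>j<n. restrict \<sigma> R (e j) * of_nat t ^ j)"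
      unfolding \<sigma>(2) \<sigma>a[OF \<sigma>(1)] using eR by (intro sum.cong) auto
    moreover have "restrict \<sigma> R \<in> Pi" using \<sigma> by (auto simp: Pi_def)
    ultimately show "y \<in> (\<lambda>\<pi>. \<Sum>j<n. \<pi> (e j) * of_nat t ^ j) ` Pi" by (rule image_eqI)
  qed
  then have fO: "finite Orb" using fPi by (meson finite_imageI finite_subset)
  have Oint: "algebraic_int z" if "z \<in> Orb" for z
  proof -
    obtain \<sigma> where \<sigma>: "\<sigma> \<in> galois_group F" "z = \<sigma> a" using \<open>z \<in> Orb\<close> by (auto simp: Orb_def)
    have "\<sigma> (e j) \<in> R" if "j < n" for j using galois_permutes_roots[OF \<sigma>(1)] eR[OF that] by (auto simp: bij_betw_def)
    then show ?thesis unfolding \<sigma>(2) \<sigma>a[OF \<sigma>(1)]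
      by (intro algebraic_int_sum algebraic_int_times algebraic_int_power) auto
  qed
  obtain m where m: "of_int_poly m = (\<Prod>z\<in>Orb. [:- z, 1:])"
    using conjugates_polynomial[OF aK aint Orb_def fO Oint] by blast
  have pm: "poly (of_int_poly m) x = (\<Prod>z\<in>Orb. x - z)" for x
    unfolding m by (simp add: poly_prod)
  have "restrict id K a = a" using aK by simp
  then have "a \<in> Orb" unfolding Orb_def using galois_id by (metis image_eqI)
  then have "poly (of_int_poly m) a = 0" unfolding pm using fO by (simp add: prod_zero_iff)
  then have "poly (of_int_poly m) (a ^ p) \<equiv>\<^sub>P 0 ^ p" using frobenius_int_poly[OF aint, of m] by simp
  then have "(\<Prod>z\<in>Orb. a ^ p - z) \<in> P" using p_gt_1 by (simp add: pm residue_eq_0_iff zero_power)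
  then obtain z where z: "z \<in> Orb" "a ^ p - z \<in> P"
    using P_prod[OF fO, of "\<lambda>z. a ^ p - z"] Oint aint by auto
  then obtain \<sigma> where \<sigma>: "\<sigma> \<in> galois_group F" "z = \<sigma> a" by (auto simp: Orb_def)
  have "a ^ p \<equiv>\<^sub>P (\<Sum>j<n. (e j * of_nat t ^ j) ^ p)"
    unfolding a_def using eR by (intro frobenius_sum algebraic_int_times algebraic_int_power) auto
  also have "(\<Sum>j<n. (e j * of_nat t ^ j) ^ p) \<equiv>\<^sub>P (\<Sum>j<n. e j ^ p * of_nat t ^ j)"
  proof (rule residue_eq_sum)
    fix j assume j: "j \<in> {..<n}"
    have "(of_nat t ^ j) ^ p = (of_int (int t) ^ p) ^ j" by (simp add: mult.commute flip: power_mult)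
    also have "\<dots> \<equiv>\<^sub>P of_int (int t) ^ j" by (intro residue_eq_power fermat_of_int) auto
    finally have "(of_nat t ^ j) ^ p \<equiv>\<^sub>P (of_nat t ^ j)" by simp
    then show "(e j * of_nat t ^ j) ^ p \<equiv>\<^sub>P e j ^ p * of_nat t ^ j"
      unfolding power_mult_distrib using j eR by (intro residue_eq_mult) auto
  qed
  finally have "a ^ p \<equiv>\<^sub>P (\<Sum>j<n. e j ^ p * of_nat t ^ j)" .
  moreover have "a ^ p \<equiv>\<^sub>P \<sigma> a" using z \<sigma> by (simp add: residue_eq_def)
  ultimately have "\<sigma> a \<equiv>\<^sub>P (\<Sum>j<n. e j ^ p * of_nat t ^ j)" using residue_eq_sym residue_eq_trans by blast
  then have "poly (D (restrict \<sigma> R)) (of_nat t) \<in> P"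
    unfolding \<sigma>a[OF \<sigma>(1)] pD residue_eq_def sum_subtractf[symmetric] left_diff_distrib[symmetric]
    using eR by simp
  then show False using t(2) \<sigma> by (auto simp: Pi_def)
qed

end

section \<open>Permutation groups generated by transpositions\<close>

text \<open>The powers of \<open>\<rho>\<close> fix \<open>x0\<close> and act transitively on the other points; with \<open>\<kappa>\<close>, which moves \<open>x0\<close>, the group is doubly
  transitive. Conjugating one transposition then gives all of them.\<close>

lemma all_transpositions_in_group:
  fixes G :: "('a \<Rightarrow> 'a) set"
  assumes perm: "\<And>\<pi>. \<pi> \<in> G \<Longrightarrow> \<pi> permutes R"
    and comp: "\<And>\<pi> \<rho>. \<pi> \<in> G \<Longrightarrow> \<rho> \<in> G \<Longrightarrow> \<pi> \<circ> \<rho> \<in> G"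
    and inv: "\<And>\<pi>. \<pi> \<in> G \<Longrightarrow> inv_into UNIV \<pi> \<in> G"
    and t: "Transposition.transpose a b \<in> G" "a \<noteq> b" "a \<in> R" "b \<in> R"
    and r: "\<rho> \<in> G" "\<rho> x0 = x0" "x0 \<in> R" "\<And>z. z \<in> R \<Longrightarrow> z \<noteq> x0 \<Longrightarrow> \<exists>i. z = (\<rho> ^^ i) y0"
    and k: "\<kappa> \<in> G" "\<kappa> x0 \<noteq> x0"
    and uv: "u \<in> R" "v \<in> R"
  shows "Transposition.transpose u v \<in> G"
proof -
  have id: "id \<in> G"
    using comp[OF inv[OF r(1)] r(1)] permutes_inv_o[OF perm[OF r(1)]] by simp
  have pow: "\<rho> ^^ i \<in> G" for i 
  proof (induction i)
    case 0
    show ?case using id by (simp only: funpow.simps)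
  next
    case (Suc i)
    show ?case using comp[OF r(1) Suc] by (simp only: funpow.simps)
  qed
  have fix0: "(\<rho> ^^ i) x0 = x0" for i by (induction i) (use r(2) in auto)
  have conj: "Transposition.transpose (\<pi> x) (\<pi> y) \<in> G" if "Transposition.transpose x y \<in> G" "\<pi> \<in> G" for x y \<pi>
  proof -
    have "bij \<pi>" using perm[OF that(2)] by (rule permutes_bij)
    then have "Transposition.transpose (\<pi> x) (\<pi> y) = \<pi> \<circ> Transposition.transpose x y \<circ> inv_into UNIV \<pi>"
      by (simp add: fun_eq_iff) (metis bij_inv_eq_iff transpose_apply_first transpose_apply_other transpose_apply_second)
    then show ?thesis using comp inv that by metis
  qed
  have cyc: "\<exists>\<psi>\<in>G. \<psi> x0 = x0 \<and> \<psi> w = z" if wz: "w \<in> R" "z \<in> R" "w \<noteq> x0" "z \<noteq> x0" for w z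
  proof -
    obtain i j where ij: "w = (\<rho> ^^ i) y0" "z = (\<rho> ^^ j) y0" using r(4) wz by metis
    define \<psi> where "\<psi> = (\<rho> ^^ j) \<circ> inv_into UNIV (\<rho> ^^ i)"
    have b: "bij (\<rho> ^^ i)" using perm[OF pow] by (rule permutes_bij)
    have "\<psi> \<in> G" unfolding \<psi>_def by (intro comp inv pow)
    moreover have "\<psi> w = z" unfolding \<psi>_def ij using b by (simp add: bij_is_inj)
    moreover have "inv_into UNIV (\<rho> ^^ i) x0 = x0" using b fix0 by (metis bij_inv_eq_iff)
    then have "\<psi> x0 = x0" using fix0 by (simp add: \<psi>_def)
    ultimately show ?thesis by blast
  qed
  have trans: "\<exists>\<pi>\<in>G. \<pi> x0 = z" if z: "z \<in> R" for z
  proof (cases "z = x0")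
    case True
    then show ?thesis using id by (intro bexI[of _ id]) auto
  next
    case False
    have "\<kappa> x0 \<in> R" using perm[OF k(1)] r(3) by (simp add: permutes_in_image)
    then obtain \<psi> where "\<psi> \<in> G" "\<psi> (\<kappa> x0) = z" using cyc[of "\<kappa> x0" z] k z False by auto
    then show ?thesis using comp[of \<psi> \<kappa>] k by (intro bexI[of _ "\<psi> \<circ> \<kappa>"]) auto
  qed
  obtain \<pi> where \<pi>: "\<pi> \<in> G" "\<pi> x0 = a" using trans t by blast
  define b' where "b' = inv_into UNIV \<pi> b"
  have bp: "bij \<pi>" using perm[OF \<pi>(1)] by (rule permutes_bij)
  have "inv_into UNIV \<pi> a = x0" using \<pi> bp by (metis bij_inv_eq_iff)
  then have tb: "Transposition.transpose x0 b' \<in> G" using conj[OF t(1) inv[OF \<pi>(1)]] by (simp add: b'_def)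
  have b'R: "b' \<in> R" using perm[OF inv[OF \<pi>(1)]] t by (simp add: b'_def permutes_in_image)
  have b'x: "b' \<noteq> x0" using t \<pi> bp unfolding b'_def by (metis bij_inv_eq_iff)
  have t0: "Transposition.transpose x0 z \<in> G" if z: "z \<in> R" for z
  proof (cases "z = x0")
    case True
    then show ?thesis using id by simp
  next
    case False
    then obtain \<psi> where "\<psi> \<in> G" "\<psi> x0 = x0" "\<psi> b' = z" using cyc[OF b'R z b'x] by blast
    then show ?thesis using conj[OF tb] by metis
  qed
  obtain \<mu> where \<mu>: "\<mu> \<in> G" "\<mu> x0 = u" using trans uv by blast
  define z where "z = inv_into UNIV \<mu> v"
  have "z \<in> R" using perm[OF inv[OF \<mu>(1)]] uv by (simp add: z_def permutes_in_image)
  moreover have "\<mu> z = v" unfolding z_def using perm[OF \<mu>(1)]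
    by (metis permutes_inverses(1))
  ultimately show ?thesis using conj[OF t0 \<mu>(1), of z] \<mu> by simp
qed

context monic_int_poly
begin

text \<open>The restrictions in \<^const>\<open>galois_perms\<close> are undefined outside the roots; here the same permutations are the identity there, so
  that they compose as functions.\<close>

definition "gal_perms = {\<pi>. \<pi> permutes R \<and> (\<exists>\<sigma>\<in>galois_group F. \<forall>x\<in>R. \<pi> x = \<sigma> x)}"

lemma gal_perms_comp:
  assumes "\<pi> \<in> gal_perms" "\<rho> \<in> gal_perms"
  shows "\<pi> \<circ> \<rho> \<in> gal_perms"
proof -
  obtain \<sigma> \<tau> where st: "\<sigma> \<in> galois_group F" "\<tau> \<in> galois_group F" "\<forall>x\<in>R. \<pi> x = \<sigma> x" "\<forall>x\<in>R. \<rho> x = \<tau> x"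
    and p: "\<pi> permutes R" "\<rho> permutes R"
    using assms by (auto simp: gal_perms_def)
  have "(\<pi> \<circ> \<rho>) x = restrict (\<sigma> \<circ> \<tau>) K x" if "x \<in> R" for x
  proof -
    have "\<rho> x \<in> R" using p that by (simp add: permutes_in_image)
    then show ?thesis using st that R_subset_K by auto
  qed
  then show ?thesis unfolding gal_perms_def
    using galois_comp[OF st(1,2)] permutes_compose[OF p(2,1)] by blast
qed

lemma gal_perms_inv:
  assumes "\<pi> \<in> gal_perms"
  shows "inv_into UNIV \<pi> \<in> gal_perms"
proof -
  obtain \<sigma> where st: "\<sigma> \<in> galois_group F" "\<forall>x\<in>R. \<pi> x = \<sigma> x"
    and p: "\<pi> permutes R"
    using assms by (auto simp: gal_perms_def)
  have "inv_into UNIV \<pi> x = restrict (inv_into K \<sigma>) K x" if x: "x \<in> R" for x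
  proof -
    have y: "inv_into UNIV \<pi> x \<in> R" using permutes_inv[OF p] x by (simp add: permutes_in_image)
    have "x = \<sigma> (inv_into UNIV \<pi> x)" using st y permutes_inverses(1)[OF p] by metis
    moreover have "inj_on \<sigma> K" using st by (auto simp: galois_group_iff bij_betw_def)
    ultimately have "inv_into K \<sigma> x = inv_into UNIV \<pi> x" using y R_subset_K by (metis inv_into_f_f subsetD)
    then show ?thesis using x R_subset_K by auto
  qed
  then show ?thesis unfolding gal_perms_def
    using galois_inverse[OF st(1)] permutes_inv[OF p] by blast
qed

lemma galois_in_gal_perms:
  assumes "\<sigma> \<in> galois_group F"
  obtains \<pi> where "\<pi> \<in> gal_perms" "\<And>x. x \<in> R \<Longrightarrow> \<pi> x = \<sigma> x"
proof -
  define \<pi> where "\<pi> x = (if x \<in> R then \<sigma> x else x)" for x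
  have "bij_betw \<pi> R R"
    using galois_permutes_roots[OF assms] by (simp add: \<pi>_def cong: bij_betw_cong)
  then have "\<pi> permutes R" by (rule bij_imp_permutes) (simp add: \<pi>_def)
  then show ?thesis using that[of \<pi>] assms by (auto simp: gal_perms_def \<pi>_def)
qed

lemma full_if_all_transpositions:
  assumes "\<And>u v. u \<in> R \<Longrightarrow> v \<in> R \<Longrightarrow> Transposition.transpose u v \<in> gal_perms"
  shows "galois_perms F = carrier (BijGroup R)"
proof
  show "galois_perms F \<subseteq> carrier (BijGroup R)"
    using galois_permutes_roots
    by (auto simp: galois_perms_def BijGroup_def Bij_def R_def[symmetric] cong: bij_betw_cong)
  have all: "\<pi> \<in> gal_perms" if "\<pi> permutes R" for \<pi>
    using that finite_R
  proof (induction rule: permutes_induct)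
    case id
    show ?case unfolding gal_perms_def
    proof (intro CollectI conjI bexI[of _ "restrict id K"] ballI)
      show "id permutes R" by (rule permutes_id)
    qed (use galois_id R_subset_K in auto)
  next
    case (swap a b p)
    then show ?case using assms gal_perms_comp by blast
  qed
  show "carrier (BijGroup R) \<subseteq> galois_perms F"
  proof
    fix g assume "g \<in> carrier (BijGroup R)"
    then have g: "g \<in> extensional R" "bij_betw g R R" by (auto simp: BijGroup_def Bij_def)
    define \<pi> where "\<pi> x = (if x \<in> R then g x else x)" for x
    have "bij_betw \<pi> R R" using g(2) by (simp add: \<pi>_def cong: bij_betw_cong)
    then have "\<pi> permutes R" by (rule bij_imp_permutes) (simp add: \<pi>_def)
    then obtain \<sigma> where \<sigma>: "\<sigma> \<in> galois_group F" "\<forall>x\<in>R. \<pi> x = \<sigma> x"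
      using all by (auto simp: gal_perms_def)
    have "g = restrict \<sigma> R"
      by (rule extensionalityI[of _ R]) (use g \<sigma> in \<open>auto simp: \<pi>_def\<close>)
    then show "g \<in> galois_perms F" using \<sigma> unfolding galois_perms_def R_def by blast
  qed
qed

end

section \<open>Reading off the Galois group from two factorisations modulo primes\<close>

text \<open>Over the field with \<open>p\<close> elements, an irreducible polynomial of degree \<open>N - 1\<close> is the product over the orbit, of length \<open>N - 1\<close>, of
  one of its roots \<open>\<beta>\<close> under the Frobenius map. This form shows how the Frobenius map permutes the roots.\<close>

definition linear_times_irreducible :: "nat \<Rightarrow> nat \<Rightarrow> int poly \<Rightarrow> bool" where
  "linear_times_irreducible p N f \<longleftrightarrow> (\<exists>P (a::int) \<beta>. residue_prime p P \<and> algebraic_int \<beta> \<and>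
     \<beta> ^ (p ^ (N - 1)) - \<beta> \<in> P \<and> (\<forall>d. 0 < d \<longrightarrow> d < N - 1 \<longrightarrow> \<beta> ^ (p ^ d) - \<beta> \<notin> P) \<and>
     (\<forall>k. coeff (of_int_poly f) k -
        coeff ([:- of_int a, 1:] * (\<Prod>i<N - 1. [:- (\<beta> ^ (p ^ i)), 1:])) k \<in> P))"

text \<open>The condition that \<open>1\<close> and \<open>-1\<close> are not among the roots of the linear factors excludes integer roots of
  polynomials with constant term \<open>\<plusminus>1\<close>.\<close>

definition irreducible_quadratic_times_linears :: "nat \<Rightarrow> nat \<Rightarrow> int poly \<Rightarrow> bool" where
  "irreducible_quadratic_times_linears p N f \<longleftrightarrow> (\<exists>(a::nat \<Rightarrow> int) t c.
     (\<forall>i<N - 2. \<forall>j<N - 2. int p dvd a i - a j \<longrightarrow> i = j) \<and>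
     (\<forall>i<N - 2. \<not> int p dvd 1 - a i \<and> \<not> int p dvd - 1 - a i) \<and>
     (\<forall>u. \<not> int p dvd u\<^sup>2 - t * u + c) \<and>
     (\<forall>k. int p dvd coeff f k - coeff ([:c, - t, 1:] * (\<Prod>i<N - 2. [:- a i, 1:])) k))"

lemma (in residue_prime) P_prod_list:
  "(\<And>x. x \<in> set xs \<Longrightarrow> algebraic_int x) \<Longrightarrow> prod_list xs \<in> P \<Longrightarrow> \<exists>x\<in>set xs. x \<in> P"
proof (induction xs)
  case Nil
  then show ?case using one_notin by simp
next
  case (Cons x xs)
  have "algebraic_int (prod_list xs)" using Cons.prems(1) by (induction xs) auto
  then show ?case using P_prime[of x "prod_list xs"] Cons by auto
qed

lemma (in residue_prime) fixed_p_power: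
  assumes "a ^ p \<equiv>\<^sub>P a" "algebraic_int a"
  shows "a ^ (p ^ k) \<equiv>\<^sub>P a"
proof (induction k)
  case (Suc k)
  have "a ^ (p ^ Suc k) = (a ^ (p ^ k)) ^ p" by (simp add: mult.commute flip: power_mult)
  also have "\<dots> \<equiv>\<^sub>P a ^ p" using Suc assms by (intro residue_eq_power) auto
  also have "a ^ p \<equiv>\<^sub>P a" by fact
  finally show ?case .
qed simp

context monic_int_poly
begin

text \<open>The product of the differences of \<open>v\<close> and the complex roots of \<open>f\<close> lies in the prime ideal \<open>P\<close>.\<close>

lemma root_mod_lifts:
  assumes "residue_prime p P" "algebraic_int v" "poly (of_int_poly f) v \<in> P"
  shows "\<exists>x\<in>R. x - v \<in> P"
proof -
  interpret residue_prime p P by fact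
  define G where "G = (of_int_poly f :: complex poly)"
  have lc: "lead_coeff G = 1" using monic by (simp add: G_def)
  obtain as where as: "smult (lead_coeff G) (\<Prod>a\<leftarrow>as. [:- a, 1:]) = G"
    using fundamental_theorem_algebra_factorized[of G] by blast
  have G: "poly G z = prod_list (map (\<lambda>a. z - a) as)" for z
  proof -
    have "poly G z = poly (\<Prod>a\<leftarrow>as. [:- a, 1:]) z" using as lc by simp
    then show ?thesis by (simp add: poly_prod_list o_def)
  qed
  have asR: "a \<in> R" if "a \<in> set as" for a
  proof -
    have "poly G a = 0" unfolding G using that by (auto simp: prod_list_zero_iff)
    then show ?thesis by (simp add: R_eq G_def)
  qed
  have "prod_list (map (\<lambda>a. v - a) as) \<in> P" using assms(3) G by (simp add: G_def)
  then obtain a where "a \<in> set as" "v - a \<in> P"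
    using P_prod_list[of "map (\<lambda>a. v - a) as"] assms(2) asR by auto
  then show ?thesis using asR P_minus[of "v - a"] by auto
qed

text \<open>If the residue of \<open>f\<close> has as many roots as its degree, then the roots of \<open>f\<close> are in bijection with
  them, and a congruence between roots is an equality.\<close>

lemma frobenius_on_residues:
  fixes v :: "'i \<Rightarrow> complex"
  assumes P: "residue_prime p P" and I: "finite I" "card I = Polynomial.degree f"
    and v: "\<And>i. i \<in> I \<Longrightarrow> algebraic_int (v i)" "\<And>i. i \<in> I \<Longrightarrow> poly (of_int_poly f) (v i) \<in> P"
    and inc: "\<And>i j. i \<in> I \<Longrightarrow> j \<in> I \<Longrightarrow> v i - v j \<in> P \<Longrightarrow> i = j"
    and big: "p > Polynomial.degree f * Polynomial.degree f ^ Polynomial.degree f"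
  obtains r \<sigma> where "bij_betw r I R" "\<sigma> \<in> galois_group F" "card R = Polynomial.degree f"
    "\<And>i j. i \<in> I \<Longrightarrow> j \<in> I \<Longrightarrow> v i ^ p - v j \<in> P \<Longrightarrow> \<sigma> (r i) = r j"
proof -
  interpret residue_prime p P by fact
  have "\<exists>x\<in>R. x - v i \<in> P" if "i \<in> I" for i using root_mod_lifts[OF P] v that by blast
  then obtain r where r: "\<And>i. i \<in> I \<Longrightarrow> r i \<in> R" "\<And>i. i \<in> I \<Longrightarrow> r i \<equiv>\<^sub>P v i"
    unfolding residue_eq_def by metis
  have cgr: "i = j" if "i \<in> I" "j \<in> I" "r i \<equiv>\<^sub>P r j" for i j
  proof (rule inc[OF that(1,2)])
    have "v i \<equiv>\<^sub>P r i" using r that residue_eq_sym by blast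
    also have "\<dots> \<equiv>\<^sub>P r j" by fact
    also have "\<dots> \<equiv>\<^sub>P v j" using r that by blast
    finally show "v i - v j \<in> P" by (simp add: residue_eq_def)
  qed
  have inj: "inj_on r I" using cgr residue_eq_refl by (metis inj_onI)
  have "card R \<le> Polynomial.degree (of_int_poly f :: complex poly)"
    unfolding R_eq using monic by (intro card_poly_roots_bound) auto
  then have cR: "card R \<le> card (r ` I)" using I inj by (simp add: card_image)
  moreover have sub: "r ` I \<subseteq> R" using r by auto
  ultimately have im: "r ` I = R" using finite_R by (metis card_seteq)
  then have bij: "bij_betw r I R" using inj by (simp add: bij_betw_def)
  have card: "card R = Polynomial.degree f" using bij I bij_betw_same_card by metis
  obtain \<sigma> where \<sigma>: "\<sigma> \<in> galois_group F" "\<And>x. x \<in> R \<Longrightarrow> \<sigma> x \<equiv>\<^sub>P x ^ p"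
    using frobenius_automorphism[OF P] big card unfolding residue_eq_def by metis
  have "\<sigma> (r i) = r j" if ij: "i \<in> I" "j \<in> I" "v i ^ p - v j \<in> P" for i j
  proof -
    have "\<sigma> (r i) \<equiv>\<^sub>P r i ^ p" using \<sigma> r ij by blast
    also have "r i ^ p \<equiv>\<^sub>P v i ^ p" using r ij v by (intro residue_eq_power) auto
    also have "v i ^ p \<equiv>\<^sub>P v j" using ij by (simp add: residue_eq_def)
    also have "v j \<equiv>\<^sub>P r j" using r ij residue_eq_sym by blast
    finally have c: "\<sigma> (r i) \<equiv>\<^sub>P r j" .
    have "\<sigma> (r i) \<in> R" using galois_permutes_roots[OF \<sigma>(1)] r ij by (auto simp: bij_betw_def)
    then obtain k where k: "k \<in> I" "\<sigma> (r i) = r k" using im by blast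
    then show ?thesis using cgr c ij by metis
  qed
  then show ?thesis using that bij \<sigma> card by blast
qed

text \<open>The Frobenius map shifts the residues of \<open>\<beta>, \<beta>\<^sup>p, \<beta>\<^bsup>p\<^sup>2\<^esup>, \<dots>\<close> cyclically and fixes the residue of \<open>a\<close>, which is none of them,
  because they are not fixed.\<close>

lemma long_cycle_mod:
  fixes a :: int
  assumes P: "residue_prime p P" and N: "Polynomial.degree f = N" "N \<ge> 3"
    and big: "p > N * N ^ N" and \<beta>: "algebraic_int \<beta>"
    "\<beta> ^ (p ^ (N - 1)) - \<beta> \<in> P" "\<And>d. 0 < d \<Longrightarrow> d < N - 1 \<Longrightarrow> \<beta> ^ (p ^ d) - \<beta> \<notin> P"
    and f: "\<And>k. coeff (of_int_poly f) k -
        coeff ([:- of_int a, 1:] * (\<Prod>i<N - 1. [:- (\<beta> ^ (p ^ i)), 1:])) k \<in> P"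
  shows "\<exists>\<sigma>\<in>galois_group F. \<exists>x0\<in>R. \<exists>y0\<in>R. \<sigma> x0 = x0 \<and> (\<forall>z\<in>R. z \<noteq> x0 \<longrightarrow> (\<exists>i. z = (\<sigma> ^^ i) y0))"
proof -
  interpret residue_prime p P by fact
  define n where "n = N - 1"
  define v where "v i = (if i < n then \<beta> ^ (p ^ i) else of_int a)" for i
  have vint: "algebraic_int (v i)" for i using \<beta> by (auto simp: v_def)
  define Q where "Q = [:- of_int a, 1:] * (\<Prod>i<n. [:- (\<beta> ^ (p ^ i)), 1:])"
  have Qint: "int_coeffs Q" unfolding Q_def using \<beta> by (intro int_coeffs_mult int_coeffs_prod) auto
  have Qv: "poly Q (v i) = 0" if "i \<le> n" for i
    using that by (auto simp: Q_def v_def poly_prod)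
  have fv: "poly (of_int_poly f) (v i) \<in> P" if "i \<le> n" for i
  proof -
    have "poly (of_int_poly f) (v i) \<equiv>\<^sub>P poly Q (v i)"
      using f vint Qint by (intro residue_eq_poly_coeffs) (auto simp: residue_eq_def Q_def n_def)
    then show ?thesis using Qv that by (simp add: residue_eq_0_iff)
  qed
  have \<beta>n: "\<beta> ^ (p ^ n) \<equiv>\<^sub>P \<beta>" using \<beta> by (simp add: residue_eq_def n_def)
  have return: "(\<beta> ^ (p ^ i)) ^ (p ^ (n - i)) \<equiv>\<^sub>P \<beta>" if "i \<le> n" for i
    using \<beta>n that by (simp flip: power_mult power_add)
  have ne: "\<not> \<beta> ^ (p ^ i) \<equiv>\<^sub>P \<beta> ^ (p ^ j)" if ij: "i < j" "j < n" for i j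
  proof
    assume "\<beta> ^ (p ^ i) \<equiv>\<^sub>P \<beta> ^ (p ^ j)"
    then have "(\<beta> ^ (p ^ i)) ^ (p ^ (n - i)) \<equiv>\<^sub>P (\<beta> ^ (p ^ j)) ^ (p ^ (n - i))"
      using \<beta> by (intro residue_eq_power) auto
    moreover have "(\<beta> ^ (p ^ j)) ^ (p ^ (n - i)) = (\<beta> ^ (p ^ n)) ^ (p ^ (j - i))"
    proof -
      have "p ^ j * p ^ (n - i) = p ^ n * p ^ (j - i)" using ij by (simp add: add.commute flip: power_add)
      then show ?thesis by (simp flip: power_mult)
    qed
    moreover have "(\<beta> ^ (p ^ n)) ^ (p ^ (j - i)) \<equiv>\<^sub>P \<beta> ^ (p ^ (j - i))"
      using \<beta>n \<beta> by (intro residue_eq_power) auto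
    ultimately have "\<beta> ^ (p ^ (j - i)) \<equiv>\<^sub>P \<beta>"
      using return[of i] ij residue_eq_sym residue_eq_trans by (metis less_imp_le less_trans)
    moreover have "j - i < N - 1" using ij n_def by linarith
    ultimately show False using \<beta>(3)[of "j - i"] ij by (simp add: residue_eq_def)
  qed
  have ap: "(of_int a :: complex) ^ (p ^ k) \<equiv>\<^sub>P of_int a" for k
    by (intro fixed_p_power fermat_of_int) auto
  have ne2: "\<not> (\<beta> ^ (p ^ i) \<equiv>\<^sub>P of_int a)" if i: "i < n" for i
  proof
    assume "\<beta> ^ (p ^ i) \<equiv>\<^sub>P of_int a"
    then have "(\<beta> ^ (p ^ i)) ^ (p ^ (n - i)) \<equiv>\<^sub>P of_int a ^ (p ^ (n - i))" using \<beta> by (intro residue_eq_power) auto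
    then have "\<beta> \<equiv>\<^sub>P of_int a ^ (p ^ (n - i))" using return[of i] i residue_eq_sym residue_eq_trans by (metis less_imp_le)
    then have ba: "\<beta> \<equiv>\<^sub>P of_int a" using ap residue_eq_trans by blast
    then have "\<beta> ^ p \<equiv>\<^sub>P of_int a ^ p" using \<beta> by (intro residue_eq_power) auto
    also have "(of_int a :: complex) ^ p \<equiv>\<^sub>P of_int a" by (rule fermat_of_int)
    also have "of_int a \<equiv>\<^sub>P \<beta>" using ba by (rule residue_eq_sym)
    finally have "\<beta> ^ p \<equiv>\<^sub>P \<beta>" .
    moreover have "1 < N - 1" using N by linarith
    ultimately show False using \<beta>(3)[of 1] by (simp add: residue_eq_def)
  qed
  have inc: "i = j" if "i \<in> {..n}" "j \<in> {..n}" "v i - v j \<in> P" for i j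
  proof -
    have c: "v i \<equiv>\<^sub>P v j" "v j \<equiv>\<^sub>P v i" using that residue_eq_sym by (auto simp: residue_eq_def)
    show ?thesis
      using c ne[of i j] ne[of j i] ne2[of i] ne2[of j] that
      by (cases "i < n"; cases "j < n"; cases i j rule: linorder_cases) (auto simp: v_def)
  qed
  obtain r \<sigma> where r: "bij_betw r {..n} R" and \<sigma>: "\<sigma> \<in> galois_group F"
    and act: "\<And>i j. i \<in> {..n} \<Longrightarrow> j \<in> {..n} \<Longrightarrow> v i ^ p - v j \<in> P \<Longrightarrow> \<sigma> (r i) = r j"
    by (rule frobenius_on_residues[OF P, of "{..n}" v])
      (use N n_def vint fv inc big in \<open>auto\<close>)
  have "v n ^ p \<equiv>\<^sub>P v n" using ap[of 1] by (simp add: v_def)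
  then have fixn: "\<sigma> (r n) = r n" using act by (simp add: residue_eq_def)
  have step: "\<sigma> (r i) = r (Suc i)" if "Suc i < n" for i
  proof -
    have "v i ^ p = v (Suc i)" using that by (simp add: v_def mult.commute flip: power_mult)
    then show ?thesis using act[of i "Suc i"] that by simp
  qed
  have iter: "(\<sigma> ^^ i) (r 0) = r i" if "i < n" for i
    using that by (induction i) (auto simp: step)
  have "\<exists>i. z = (\<sigma> ^^ i) (r 0)" if z: "z \<in> R" "z \<noteq> r n" for z
  proof -
    obtain i where "i \<le> n" "z = r i" using r z by (auto simp: bij_betw_def)
    then show ?thesis using iter[of i] z by (metis le_neq_implies_less)
  qed
  moreover have "r n \<in> R" "r 0 \<in> R" using r by (auto simp: bij_betw_def)
  ultimately show ?thesis using fixn \<sigma> by blast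
qed

lemma long_cycle:
  assumes "linear_times_irreducible p N f" "Polynomial.degree f = N" "N \<ge> 3" "p > N * N ^ N"
  shows "\<exists>\<sigma>\<in>galois_group F. \<exists>x0\<in>R. \<exists>y0\<in>R. \<sigma> x0 = x0 \<and> (\<forall>z\<in>R. z \<noteq> x0 \<longrightarrow> (\<exists>i. z = (\<sigma> ^^ i) y0))"
proof -
  obtain P and a :: int and \<beta> where h: "residue_prime p P" "algebraic_int \<beta>"
    "\<beta> ^ (p ^ (N - 1)) - \<beta> \<in> P" "\<And>d. 0 < d \<Longrightarrow> d < N - 1 \<Longrightarrow> \<beta> ^ (p ^ d) - \<beta> \<notin> P"
    "\<And>k. coeff (of_int_poly f) k -
        coeff ([:- of_int a, 1:] * (\<Prod>i<N - 1. [:- (\<beta> ^ (p ^ i)), 1:])) k \<in> P"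
    using assms(1) unfolding linear_times_irreducible_def by blast
  show ?thesis by (rule long_cycle_mod[OF h(1) assms(2-4) h(2-5)])
qed

text \<open>The Frobenius map fixes the residues of the integers \<open>a i\<close> and exchanges the two roots of the quadratic factor, since only the
  residues of integers are fixed.\<close>

lemma transposition_mod:
  fixes a :: "nat \<Rightarrow> int"
  assumes P: "residue_prime p P" and N: "Polynomial.degree f = N" "N \<ge> 2" and big: "p > N * N ^ N"
    and a: "\<And>i j. i < N - 2 \<Longrightarrow> j < N - 2 \<Longrightarrow> int p dvd a i - a j \<Longrightarrow> i = j"
    and a1: "\<And>i. i < N - 2 \<Longrightarrow> \<not> int p dvd 1 - a i" "\<And>i. i < N - 2 \<Longrightarrow> \<not> int p dvd - 1 - a i"
    and q: "\<And>u. \<not> int p dvd u\<^sup>2 - t * u + c"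
    and f: "\<And>k. int p dvd coeff f k - coeff ([:c, - t, 1:] * (\<Prod>i<N - 2. [:- a i, 1:])) k"
  shows "(\<exists>\<sigma>\<in>galois_group F. \<exists>x\<in>R. \<exists>y\<in>R. x \<noteq> y \<and> \<sigma> x = y \<and> \<sigma> y = x \<and> (\<forall>z\<in>R. z \<noteq> x \<longrightarrow> z \<noteq> y \<longrightarrow> \<sigma> z = z)) \<and>
    card R = N \<and> poly f 1 \<noteq> 0 \<and> poly f (-1) \<noteq> 0"
proof (intro conjI)
  interpret residue_prime p P by fact
  note p = prime_p
  define Q where "Q = [:c, - t, 1:] * (\<Prod>i<N - 2. [:- a i, 1:])"
  have fQ: "coeff (of_int_poly f) k \<equiv>\<^sub>P coeff (of_int_poly Q) k" for k
    using f[of k] by (simp only: of_int_hom.coeff_map_poly_hom residue_eq_of_int_iff Q_def)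
  have nz: "poly f u \<noteq> 0" if "\<And>i. i < N - 2 \<Longrightarrow> \<not> int p dvd u - a i" for u
  proof
    assume "poly f u = 0"
    moreover have "poly (of_int_poly f) (of_int u) \<equiv>\<^sub>P poly (of_int_poly Q) (of_int u)"
      using fQ by (intro residue_eq_poly_coeffs) auto
    ultimately have "int p dvd poly Q u" using residue_eq_of_int_iff[of 0 "poly Q u"] by simp
    also have "poly Q u = (u\<^sup>2 - t * u + c) * (\<Prod>i<N - 2. u - a i)"
      by (simp add: Q_def poly_prod algebra_simps power2_eq_square)
    finally have "int p dvd (\<Prod>i<N - 2. u - a i)"
      using q p by (simp add: prime_dvd_mult_iff)
    then show False using that p by (subst (asm) prime_dvd_prod_iff) auto
  qed
  show "poly f 1 \<noteq> 0" "poly f (-1) \<noteq> 0" using nz a1 by blast+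
  define s where "s = csqrt (of_int (t\<^sup>2 - 4 * c))"
  define \<gamma> where "\<gamma> = (of_int t + s) / 2"
  define \<gamma>' where "\<gamma>' = (of_int t - s) / 2"
  have s2: "s * s = of_int (t\<^sup>2 - 4 * c)" unfolding s_def by (metis power2_csqrt power2_eq_square)
  have fac: "z\<^sup>2 - of_int t * z + of_int c = (z - \<gamma>) * (z - \<gamma>')" for z
  proof -
    have "(z - \<gamma>) * (z - \<gamma>') = z\<^sup>2 - of_int t * z + (of_int t * of_int t - s * s) / 4"
      by (simp add: \<gamma>_def \<gamma>'_def field_simps power2_eq_square)
    then show ?thesis unfolding s2 by (simp add: power2_eq_square)
  qed
  have pq: "poly (of_int_poly [:c, - t, 1:]) z = (z - \<gamma>) * (z - \<gamma>')" for z
    by (subst fac[symmetric]) (simp add: of_int_hom.map_poly_pCons_hom algebra_simps power2_eq_square)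
  have int: "algebraic_int \<gamma>" "algebraic_int \<gamma>'"
    unfolding algebraic_int_altdef_ipoly
    by (rule exI[of _ "[:c, - t, 1:]"], use pq in simp)+
  have not_int: "\<not> z \<equiv>\<^sub>P of_int u" if z: "z = \<gamma> \<or> z = \<gamma>'" for z u
  proof
    assume "z \<equiv>\<^sub>P of_int u"
    then have "poly (of_int_poly [:c, - t, 1:]) z \<equiv>\<^sub>P poly (of_int_poly [:c, - t, 1:]) (of_int u)"
      using z int by (intro residue_eq_poly) auto
    then have "0 \<equiv>\<^sub>P of_int (poly [:c, - t, 1:] u)"
      using pq[of z] z by auto
    then have "int p dvd 0 - poly [:c, - t, 1:] u"
      using residue_eq_of_int_iff[of 0 "poly [:c, - t, 1:] u"] by (simp only: of_int_0)
    moreover have "0 - poly [:c, - t, 1:] u = - (u\<^sup>2 - t * u + c)"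
      by (simp add: algebra_simps power2_eq_square)
    ultimately show False using q[of u] by (simp only: dvd_minus_iff)
  qed
  have moves: "\<not> z ^ p \<equiv>\<^sub>P z" if z: "z = \<gamma> \<or> z = \<gamma>'" for z
    using frobenius_fixed_imp_int[of z] not_int[OF z] int z by blast
  have swap: "z ^ p \<equiv>\<^sub>P w" if zw: "(z = \<gamma> \<and> w = \<gamma>') \<or> (z = \<gamma>' \<and> w = \<gamma>)" for z w
  proof -
    have "poly (of_int_poly [:c, - t, 1:]) (z ^ p) \<equiv>\<^sub>P 0"
      using frobenius_int_poly[of z "[:c, - t, 1:]"] int pq[of z] zw p_gt_1 by (auto simp: zero_power)
    then have "(z ^ p - \<gamma>) * (z ^ p - \<gamma>') \<in> P" by (simp only: pq residue_eq_0_iff)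
    then have "z ^ p - \<gamma> \<in> P \<or> z ^ p - \<gamma>' \<in> P" using int zw by (intro P_prime) auto
    then show ?thesis using moves[of z] zw by (auto simp: residue_eq_def)
  qed
  have neq: "\<not> \<gamma> \<equiv>\<^sub>P \<gamma>'" using swap[of \<gamma> \<gamma>'] moves[of \<gamma>] residue_eq_trans residue_eq_sym by blast
  define v where "v i = (if i = N - 1 then \<gamma>' else if i = N - 2 then \<gamma> else of_int (a i))" for i
  have vint: "algebraic_int (v i)" for i using int by (auto simp: v_def)
  have pQ: "poly (of_int_poly Q) z = (z - \<gamma>) * (z - \<gamma>') * (\<Prod>i<N - 2. z - of_int (a i))" for z
  proof -
    have "of_int_poly Q = of_int_poly [:c, - t, 1:] * (\<Prod>i<N - 2. [:- of_int (a i), 1 :: complex:])"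
      unfolding Q_def of_int_poly_hom.hom_mult of_int_poly_hom.hom_prod
      by (simp add: of_int_hom.map_poly_pCons_hom)
    then have "poly (of_int_poly Q) z =
        poly (of_int_poly [:c, - t, 1:]) z * poly (\<Prod>i<N - 2. [:- of_int (a i), 1 :: complex:]) z"
      by (simp only: poly_mult)
    then show ?thesis by (simp only: pq poly_prod) simp
  qed
  have fv: "poly (of_int_poly f) (v i) \<in> P" if "i < N" for i
  proof -
    have "poly (of_int_poly f) (v i) \<equiv>\<^sub>P poly (of_int_poly Q) (v i)"
      using fQ vint by (intro residue_eq_poly_coeffs) auto
    moreover have "poly (of_int_poly Q) (v i) = 0" using that N by (auto simp: pQ v_def)
    ultimately show ?thesis by (simp add: residue_eq_0_iff)
  qed
  have inc: "i = j" if ij: "i \<in> {..<N}" "j \<in> {..<N}" "v i - v j \<in> P" for i j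
  proof -
    have c: "v i \<equiv>\<^sub>P v j" "v j \<equiv>\<^sub>P v i" using ij residue_eq_sym by (auto simp: residue_eq_def)
    have cases: "k = N - 1 \<or> k = N - 2 \<or> k < N - 2" if "k < N" for k using that by linarith
    show ?thesis
      using cases[of i] cases[of j] ij c neq not_int[of \<gamma>] not_int[of \<gamma>'] a[of i j] residue_eq_sym[of \<gamma>' \<gamma>] N(2)
      by (auto simp: v_def residue_eq_of_int_iff split: if_splits)
  qed
  obtain r \<sigma> where r: "bij_betw r {..<N} R" and \<sigma>: "\<sigma> \<in> galois_group F" and cR: "card R = N"
    and act: "\<And>i j. i \<in> {..<N} \<Longrightarrow> j \<in> {..<N} \<Longrightarrow> v i ^ p - v j \<in> P \<Longrightarrow> \<sigma> (r i) = r j"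
    by (rule frobenius_on_residues[OF P, of "{..<N}" v])
      (use N vint fv inc big in \<open>auto\<close>)
  show "card R = N" by (rule cR)
  have "r (N - 2) \<in> R" "r (N - 1) \<in> R" using r N by (auto simp: bij_betw_def)
  moreover have "r (N - 2) \<noteq> r (N - 1)"
  proof
    assume "r (N - 2) = r (N - 1)"
    then have "N - 2 = N - 1" using r N(2) by (auto simp: bij_betw_def dest: inj_onD)
    then show False using N(2) by simp
  qed
  moreover have "\<sigma> (r (N - 2)) = r (N - 1)" "\<sigma> (r (N - 1)) = r (N - 2)"
    using swap N by (auto intro!: act simp: v_def residue_eq_def)
  moreover have "\<sigma> z = z" if z: "z \<in> R" "z \<noteq> r (N - 2)" "z \<noteq> r (N - 1)" for z
  proof -
    obtain i where i: "i < N" "z = r i" using r z by (auto simp: bij_betw_def)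
    then have "i < N - 2" using z by (cases "i = N - 1"; cases "i = N - 2") auto
    then have "v i ^ p \<equiv>\<^sub>P v i" using fermat_of_int by (auto simp: v_def)
    then show ?thesis using act i by (simp add: residue_eq_def)
  qed
  ultimately show "\<exists>\<sigma>\<in>galois_group F. \<exists>x\<in>R. \<exists>y\<in>R. x \<noteq> y \<and> \<sigma> x = y \<and> \<sigma> y = x \<and> (\<forall>z\<in>R. z \<noteq> x \<longrightarrow> z \<noteq> y \<longrightarrow> \<sigma> z = z)"
    using \<sigma> by blast
qed

lemma transposition_of_roots:
  assumes "irreducible_quadratic_times_linears p N f" "Polynomial.degree f = N" "N \<ge> 2"
    "prime p" "p > N * N ^ N"
  shows "\<exists>\<sigma>\<in>galois_group F. \<exists>x\<in>R. \<exists>y\<in>R. x \<noteq> y \<and> \<sigma> x = y \<and> \<sigma> y = x \<and> (\<forall>z\<in>R. z \<noteq> x \<longrightarrow> z \<noteq> y \<longrightarrow> \<sigma> z = z)"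
    and "card R = N" and "poly f 1 \<noteq> 0" and "poly f (-1) \<noteq> 0"
proof -
  obtain a :: "nat \<Rightarrow> int" and t c where h0:
    "(\<forall>i<N - 2. \<forall>j<N - 2. int p dvd a i - a j \<longrightarrow> i = j) \<and>
     (\<forall>i<N - 2. \<not> int p dvd 1 - a i \<and> \<not> int p dvd - 1 - a i) \<and>
     (\<forall>u. \<not> int p dvd u\<^sup>2 - t * u + c) \<and>
     (\<forall>k. int p dvd coeff f k - coeff ([:c, - t, 1:] * (\<Prod>i<N - 2. [:- a i, 1:])) k)"
    using assms(1)[unfolded irreducible_quadratic_times_linears_def] by (elim exE) (rule that)
  note h = h0[THEN conjunct1] h0[THEN conjunct2, THEN conjunct1]
    h0[THEN conjunct2, THEN conjunct2, THEN conjunct1] h0[THEN conjunct2, THEN conjunct2, THEN conjunct2]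
  obtain P where P: "residue_prime p P" using ex_residue_prime[OF assms(4)] by blast
  have T: "(\<exists>\<sigma>\<in>galois_group F. \<exists>x\<in>R. \<exists>y\<in>R. x \<noteq> y \<and> \<sigma> x = y \<and> \<sigma> y = x \<and> (\<forall>z\<in>R. z \<noteq> x \<longrightarrow> z \<noteq> y \<longrightarrow> \<sigma> z = z)) \<and>
    card R = N \<and> poly f 1 \<noteq> 0 \<and> poly f (-1) \<noteq> 0"
    by (rule transposition_mod[OF P assms(2,3,5), of a t c])
      (erule (2) h(1)[rule_format], erule h(2)[rule_format, THEN conjunct1],
       erule h(2)[rule_format, THEN conjunct2], rule h(3)[rule_format], rule h(4)[rule_format])
  show "\<exists>\<sigma>\<in>galois_group F. \<exists>x\<in>R. \<exists>y\<in>R. x \<noteq> y \<and> \<sigma> x = y \<and> \<sigma> y = x \<and> (\<forall>z\<in>R. z \<noteq> x \<longrightarrow> z \<noteq> y \<longrightarrow> \<sigma> z = z)"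
    by (rule conjunct1[OF T])
  show "card R = N" "poly f 1 \<noteq> 0" "poly f (-1) \<noteq> 0" using conjunct2[OF T] by blast+
qed

lemma integer_root_dvd_constant: "poly f u = 0 \<Longrightarrow> u dvd coeff f 0"
  by (cases f) (auto simp: eq_neg_iff_add_eq_0[symmetric])

text \<open>The transposition and the long cycle generate the symmetric group once the point fixed by the long
  cycle is moved. It is: a root fixed by the whole Galois group would be an integer dividing
  the constant term, hence \<open>1\<close> or \<open>-1\<close>.\<close>

theorem full_symmetric_galois_group:
  assumes N: "Polynomial.degree f = N" "N \<ge> 2" and c0: "\<bar>coeff f 0\<bar> = 1"
    and qtl: "irreducible_quadratic_times_linears p N f" "prime p" "p > N * N ^ N"
    and lti: "N \<ge> 3 \<Longrightarrow> linear_times_irreducible q N f" "q > N * N ^ N"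
  shows "has_full_symmetric_galois_group F"
proof -
  note T = transposition_of_roots[OF qtl(1) N qtl(2,3)]
  obtain \<sigma> x y where \<sigma>: "\<sigma> \<in> galois_group F" and xy: "x \<in> R" "y \<in> R" "x \<noteq> y" "\<sigma> x = y" "\<sigma> y = x"
    and fixed: "\<And>z. z \<in> R \<Longrightarrow> z \<noteq> x \<Longrightarrow> z \<noteq> y \<Longrightarrow> \<sigma> z = z" using T(1) by blast
  have t: "Transposition.transpose x y \<in> gal_perms"
    unfolding gal_perms_def using \<sigma> xy fixed
    by (auto intro!: permutes_swap_id bexI[of _ \<sigma>] simp: Transposition.transpose_def)
  have id: "id \<in> gal_perms" using gal_perms_comp[OF t t] by simp
  have "Transposition.transpose u v \<in> gal_perms" if uv: "u \<in> R" "v \<in> R" for u v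
  proof (cases "N \<ge> 3")
    case False
    then have "card R = card {x, y}" using T(2) N xy by simp
    then have "R = {x, y}" using xy finite_R by (metis card_seteq empty_subsetI insert_subset order_refl)
    then show ?thesis using uv t id by (auto simp: transpose_commute)
  next
    case True
    obtain \<rho> x0 y0 where \<rho>: "\<rho> \<in> galois_group F" "x0 \<in> R" "\<rho> x0 = x0" "y0 \<in> R"
      "\<And>z. z \<in> R \<Longrightarrow> z \<noteq> x0 \<Longrightarrow> \<exists>i. z = (\<rho> ^^ i) y0"
      using long_cycle[OF lti(1)[OF True] N(1) True lti(2)] by blast
    obtain \<rho>' where \<rho>': "\<rho>' \<in> gal_perms" "\<And>x. x \<in> R \<Longrightarrow> \<rho>' x = \<rho> x"
      using galois_in_gal_perms[OF \<rho>(1)] by blast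
    have "\<exists>\<kappa>\<in>galois_group F. \<kappa> x0 \<noteq> x0"
    proof (rule ccontr)
      assume "\<not> ?thesis"
      then have "x0 \<in> \<rat>" using galois_fixed_imp_rational[of x0] \<rho>(2) R_subset_K by blast
      then have "x0 \<in> \<int>" using rational_algebraic_int_is_int algebraic_int_R[OF \<rho>(2)]
        by (metis Rats_cases)
      then obtain u where u: "x0 = of_int u" by (rule Ints_cases)
      then have "poly f u = 0" using \<rho>(2) by (simp add: R_eq)
      then have "u dvd coeff f 0" by (rule integer_root_dvd_constant)
      then have "is_unit u" using c0 by (metis dvd_abs_iff)
      then have "u = 1 \<or> u = -1" by auto
      then show False using \<open>poly f u = 0\<close> T(3,4) by auto
    qed
    then obtain \<kappa> where \<kappa>: "\<kappa> \<in> galois_group F" "\<kappa> x0 \<noteq> x0" by blast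
    obtain \<kappa>' where \<kappa>': "\<kappa>' \<in> gal_perms" "\<And>x. x \<in> R \<Longrightarrow> \<kappa>' x = \<kappa> x"
      using galois_in_gal_perms[OF \<kappa>(1)] by blast
    have perm: "\<And>\<pi>. \<pi> \<in> gal_perms \<Longrightarrow> \<pi> permutes R" by (simp add: gal_perms_def)
    have y0': "\<exists>i. z = (\<rho>' ^^ i) y0" if z: "z \<in> R" "z \<noteq> x0" for z
    proof -
      obtain i where i: "z = (\<rho> ^^ i) y0" using \<rho>(5)[OF z] by blast
      have "(\<rho>' ^^ j) y0 = (\<rho> ^^ j) y0 \<and> (\<rho>' ^^ j) y0 \<in> R" for j
      proof (induction j)
        case (Suc j)
        then show ?case using \<rho>'(2) permutes_in_image[OF perm[OF \<rho>'(1)]]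
          by (metis comp_apply funpow.simps(2))
      qed (use \<rho>(4) in simp)
      then show ?thesis using i by metis
    qed
    show ?thesis
    proof (rule all_transpositions_in_group[where R = R and G = gal_perms and a = x and b = y
          and \<rho> = \<rho>' and ?x0.0 = x0 and ?y0.0 = y0 and \<kappa> = \<kappa>'])
      show "\<rho>' x0 = x0" "\<kappa>' x0 \<noteq> x0" using \<rho>' \<kappa>' \<rho> \<kappa> by auto
    qed (use perm gal_perms_comp gal_perms_inv t xy \<rho>' \<kappa>' \<rho>(2) y0' uv in auto)
  qed
  then have "galois_perms F = carrier (BijGroup R)" by (rule full_if_all_transpositions)
  then show ?thesis
    unfolding has_full_symmetric_galois_group_def R_def[symmetric] using T(2) N by simp
qed

end

section \<open>Counting polynomials modulo a prime\<close>

text \<open>The monic polynomial of degree \<open>N\<close> with constant term \<open>(-1)\<^sup>N\<close>, the shape of a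
  characteristic polynomial of a matrix of determinant one.\<close>

definition poly_with_coeffs :: "nat \<Rightarrow> (nat \<Rightarrow> int) \<Rightarrow> int poly" where
  "poly_with_coeffs N c =
     Poly (map (\<lambda>k. if k = 0 then (-1) ^ N else if k = N then 1 else c k) [0..<Suc N])"

lemma coeff_poly_with_coeffs:
  "coeff (poly_with_coeffs N c) k =
     (if k = 0 then (-1) ^ N else if k = N then 1 else if k < N then c k else 0)"
  by (auto simp: poly_with_coeffs_def nth_default_def simp del: upt_Suc)

definition coeff_box :: "nat \<Rightarrow> nat \<Rightarrow> (nat \<Rightarrow> int) set" where
  "coeff_box p N = PiE {1..<N} (\<lambda>_. {0..<int p})"

lemma finite_coeff_box [simp]: "finite (coeff_box p N)"
  by (auto simp: coeff_box_def intro: finite_PiE)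

lemma card_coeff_box: "card (coeff_box p N) = p ^ (N - 1)"
  by (simp add: coeff_box_def card_PiE)

lemma irreducible_quadratic_times_linears_cong:
  assumes "\<And>k. int p dvd coeff f k - coeff g k" "irreducible_quadratic_times_linears p N g"
  shows "irreducible_quadratic_times_linears p N f"
proof -
  have "int p dvd coeff f k - q" if "int p dvd coeff g k - q" for k q
    using dvd_add[OF assms(1)[of k] that] by simp
  then show ?thesis using assms(2) unfolding irreducible_quadratic_times_linears_def by meson
qed

lemma linear_times_irreducible_cong:
  assumes "\<And>k. int p dvd coeff f k - coeff g k" "linear_times_irreducible p N g"
  shows "linear_times_irreducible p N f"
proof -
  have "coeff (of_int_poly f) k - q \<in> P"
    if "residue_prime p P" "coeff (of_int_poly g) k - q \<in> P" for k q P
  proof -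
    interpret residue_prime p P by fact
    have "of_int (coeff f k - coeff g k) \<in> P" using assms(1) by (simp only: of_int_in_P_iff)
    then show ?thesis using P_add[OF _ that(2)] by fastforce
  qed
  then show ?thesis using assms(2) unfolding linear_times_irreducible_def by meson
qed

lemma (in residue_prime) card_int_roots_mod_P:
  assumes F: "int_coeffs F" "Polynomial.degree F \<le> D" "\<exists>k. coeff F k \<notin> P"
  shows "card {x\<in>{0..<int p}. poly F (of_int x) \<in> P} \<le> D"
proof -
  let ?A = "{x\<in>{0..<int p}. poly F (of_int x) \<in> P}"
  have inj: "x = y" if "x \<in> {0..<int p}" "y \<in> {0..<int p}" "of_int x \<equiv>\<^sub>P of_int y" for x y
    using that by (auto simp: residue_eq_of_int_iff dest!: mod_eq_dvd_iff[THEN iffD2])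
  have "card ((of_int :: int \<Rightarrow> complex) ` ?A) \<le> D"
  proof (rule card_roots_mod_le)
    show "z = w" if "z \<in> of_int ` ?A" "w \<in> of_int ` ?A" "z \<equiv>\<^sub>P w" for z w
      using that inj by fastforce
    show "finite ((of_int :: int \<Rightarrow> complex) ` ?A)"
      by (rule finite_imageI, rule finite_subset[of _ "{0..<int p}"]) auto
  qed (use F in auto)
  then show ?thesis by (simp add: card_image inj_on_def)
qed

lemma card_int_roots_mod:
  assumes "prime p" "Polynomial.degree F \<le> D" "\<not> int p dvd coeff F k"
  shows "card {x\<in>{0..<int p}. int p dvd poly F x} \<le> D"
proof -
  obtain P where "residue_prime p P" using ex_residue_prime[OF assms(1)] by blast
  then interpret residue_prime p P .
  have "card {x\<in>{0..<int p}. poly (of_int_poly F) (of_int x) \<in> P} \<le> D"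
  proof (rule card_int_roots_mod_P)
    show "\<exists>k. coeff (of_int_poly F) k \<notin> P"
      using assms(3) by (intro exI[of _ k]) (simp add: of_int_in_P_iff)
  qed (use assms in auto)
  then show ?thesis by (simp add: of_int_in_P_iff)
qed

lemma ex_inverse_mod_prime:
  assumes "prime p" "\<not> int p dvd x"
  shows "\<exists>y. int p dvd x * y - 1"
proof -
  have "coprime x (int p)" using assms by (metis coprime_commute prime_imp_coprime prime_nat_int_transfer)
  then obtain u v where uv: "u * x + v * int p = 1" using bezout_int[of x "int p"] by auto
  have "x * u - 1 = int p * (- v)" using uv by (simp add: algebra_simps)
  then show ?thesis by (metis dvd_triv_left)
qed

text \<open>The roots of a reducible quadratic polynomial with constant term \<open>c\<close> come in pairs \<open>u, c/u\<close>, which determine \<open>t\<close>. So at most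
  \<open>(p + 1)/2\<close> values of \<open>t\<close> are reducible; the pairs with \<open>u = c/u\<close> account for the excess over \<open>(p - 1)/2\<close>.\<close>

lemma card_irreducible_quadratics:
  assumes p: "prime p" and c: "\<not> int p dvd c"
  shows "2 * card {t\<in>{0..<int p}. \<forall>u. \<not> int p dvd u\<^sup>2 - t * u + c} + 1 \<ge> p"
proof -
  have p1: "p > 1" using p by (rule prime_gt_1_nat)
  have pi: "prime (int p)" using p by simp
  define T where "T = {t\<in>{0..<int p}. \<forall>u. \<not> int p dvd u\<^sup>2 - t * u + c}"
  define B where "B = {t\<in>{0..<int p}. \<exists>u. int p dvd u\<^sup>2 - t * u + c}"
  have dvdmod: "int p dvd (u mod int p)\<^sup>2 - t * (u mod int p) + c" if "int p dvd u\<^sup>2 - t * u + c" for u t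
  proof -
    have "int p dvd u - u mod int p" by (simp add: mod_eq_dvd_iff[symmetric])
    then have "int p dvd (u - u mod int p) * (u + u mod int p - t)" by simp
    from dvd_diff[OF that this] show ?thesis by (simp add: algebra_simps power2_eq_square)
  qed
  have nz: "u \<in> {1..<int p}" if "u \<in> {0..<int p}" "int p dvd u\<^sup>2 - t * u + c" for u t
  proof -
    have "u \<noteq> 0" using that(2) c by auto
    then show ?thesis using that(1) by simp
  qed
  have "\<exists>u. u \<in> {1..<int p} \<and> int p dvd u\<^sup>2 - t * u + c" if "t \<in> B" for t
  proof -
    obtain u where "int p dvd u\<^sup>2 - t * u + c" using \<open>t \<in> B\<close> by (auto simp: B_def)
    from dvdmod[OF this] show ?thesis using nz[of "u mod int p" t] p1 by (intro exI[of _ "u mod int p"]) auto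
  qed
  then obtain U where U: "\<And>t. t \<in> B \<Longrightarrow> U t \<in> {1..<int p}" "\<And>t. t \<in> B \<Longrightarrow> int p dvd (U t)\<^sup>2 - t * U t + c"
    by metis
  \<comment> \<open>The other root.\<close>
  define V where "V t = (t - U t) mod int p" for t
  have V: "V t \<in> {1..<int p}" "int p dvd (V t)\<^sup>2 - t * V t + c" if t: "t \<in> B" for t
  proof -
    have "int p dvd (t - U t)\<^sup>2 - t * (t - U t) + c" using U(2)[OF t] by (simp add: algebra_simps power2_eq_square)
    from dvdmod[OF this] show v: "int p dvd (V t)\<^sup>2 - t * V t + c" by (simp add: V_def)
    then show "V t \<in> {1..<int p}" using nz[of "V t" t] p1 by (auto simp: V_def)
  qed
  have uniq: "s = t" if st: "s \<in> {0..<int p}" "t \<in> {0..<int p}" "u \<in> {1..<int p}"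
    "int p dvd u\<^sup>2 - s * u + c" "int p dvd u\<^sup>2 - t * u + c" for s t u
  proof -
    have "int p dvd (t - s) * u" using dvd_diff[OF st(4,5)] by (simp add: algebra_simps)
    moreover have "\<not> int p dvd u" using st(3) by (auto dest: zdvd_imp_le)
    ultimately have "int p dvd t - s" using pi by (simp add: prime_dvd_mult_iff)
    then show ?thesis using st(1,2) by (auto dest!: mod_eq_dvd_iff[THEN iffD2])
  qed
  have BT: "t \<in> {0..<int p}" if "t \<in> B" for t using that by (simp add: B_def)
  have injU: "inj_on U B" by (rule inj_onI) (metis uniq BT U)
  have injV: "inj_on V B" by (rule inj_onI) (metis uniq BT V)
  have finB: "finite B" unfolding B_def by (rule finite_subset[of _ "{0..<int p}"]) auto
  have "U ` B \<inter> V ` B \<subseteq> {u\<in>{0..<int p}. int p dvd poly [:- c, 0, 1:] u}"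
  proof
    fix u assume "u \<in> U ` B \<inter> V ` B"
    then obtain s t where st: "s \<in> B" "t \<in> B" "u = U s" "u = V t" by auto
    then have "s = t" using uniq[of s t u] U V BT by metis
    have "int p dvd (t - U t) - V t" unfolding V_def by (simp add: mod_eq_dvd_iff[symmetric])
    then have "int p dvd t - 2 * u" using st \<open>s = t\<close> by simp
    then have "int p dvd (t - 2 * u) * u + (u\<^sup>2 - t * u + c)" using U(2)[of t] st \<open>s = t\<close> by (simp add: dvd_add)
    also have "(t - 2 * u) * u + (u\<^sup>2 - t * u + c) = - (poly [:- c, 0, 1:] u)"
      by (simp add: algebra_simps power2_eq_square)
    finally have "int p dvd poly [:- c, 0, 1:] u" by (simp only: dvd_minus_iff)
    then show "u \<in> {u\<in>{0..<int p}. int p dvd poly [:- c, 0, 1:] u}" using U st by fastforce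
  qed
  then have "card (U ` B \<inter> V ` B) \<le> card {u\<in>{0..<int p}. int p dvd poly [:- c, 0, 1:] u}"
    by (intro card_mono finite_subset[of "{u\<in>{0..<int p}. int p dvd poly [:- c, 0, 1:] u}" "{0..<int p}"]) auto
  also have "\<dots> \<le> 2" using p1
    by (intro card_int_roots_mod[where k = 2] p) (auto simp: numeral_2_eq_2)
  finally have int: "card (U ` B \<inter> V ` B) \<le> 2" .
  have "card (U ` B \<union> V ` B) \<le> card {1..<int p}" using U V by (intro card_mono) auto
  then have un: "card (U ` B \<union> V ` B) \<le> p - 1" by simp
  have "card (U ` B) + card (V ` B) = card (U ` B \<union> V ` B) + card (U ` B \<inter> V ` B)"
    using finB by (intro card_Un_Int) auto
  then have "2 * card B \<le> p + 1" using injU injV un int p1 by (simp add: card_image)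
  moreover have "card T + card B = p"
  proof -
    have "T \<union> B = {0..<int p}" "T \<inter> B = {}" by (auto simp: T_def B_def)
    moreover have "finite T" unfolding T_def by (rule finite_subset[of _ "{0..<int p}"]) auto
    ultimately show ?thesis using card_Un_disjoint[of T B] finB by simp
  qed
  ultimately show ?thesis unfolding T_def[symmetric] by linarith
qed

text \<open>The linear factors get roots in disjoint blocks of length \<open>w\<close>, away from \<open>0\<close>, \<open>1\<close> and \<open>-1\<close>, so that the polynomial
  determines each of them. The constant term of the quadratic factor is forced by that of the product, and about half of
  the choices for its middle coefficient are irreducible.\<close>

lemma count_irreducible_quadratic_times_linears:
  assumes N: "N \<ge> 2" and p: "prime p" and w: "N * w + 3 \<le> p"
  shows "2 * card {c\<in>coeff_box p N. irreducible_quadratic_times_linears p N (poly_with_coeffs N c)} \<ge> w ^ (N - 2) * (p - 1)"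
proof -
  have pi: "prime (int p)" using p by simp
  have p3: "p \<ge> 3" using w by simp
  define n where "n = N - 2"
  have Nn: "N = Suc (Suc n)" using N by (simp add: n_def)
  define A where "A = PiE {..<n} (\<lambda>i. {2 + int (i * w)..<2 + int (Suc i * w)})"
  have blk: "2 \<le> a i \<and> a i + 2 \<le> int p" if "a \<in> A" "i < n" for a i
  proof -
    have "2 + int (i * w) \<le> a i" "a i < 2 + int (Suc i * w)"
      using that unfolding A_def by (auto simp: PiE_iff)
    moreover have "Suc i * w \<le> n * w" using that by (intro mult_right_mono) auto
    moreover have "n * w + 3 \<le> p" using w by (simp add: Nn)
    ultimately show ?thesis by linarith
  qed
  have nd: "\<not> int p dvd a i" "\<not> int p dvd 1 - a i" "\<not> int p dvd - 1 - a i" if "a \<in> A" "i < n" for a i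
  proof -
    have b: "2 \<le> a i" "a i + 2 \<le> int p" using blk[OF that] by auto
    show "\<not> int p dvd a i" using b by (auto dest: zdvd_imp_le)
    have "\<not> int p dvd a i - 1" "\<not> int p dvd a i + 1" using b by (auto dest: zdvd_imp_le)
    then show "\<not> int p dvd 1 - a i" "\<not> int p dvd - 1 - a i"
      using dvd_minus_iff[of "int p" "a i - 1"] dvd_minus_iff[of "int p" "a i + 1"]
      by (simp, metis minus_add_distrib uminus_add_conv_diff add.commute diff_minus_eq_add minus_diff_commute)
  qed
  have eqmod: "x = y" if "int p dvd x - y" "0 \<le> x" "x < int p" "0 \<le> y" "y < int p" for x y :: int
    using that by (auto dest!: mod_eq_dvd_iff[THEN iffD2])
  have sep: "a i = b j \<longrightarrow> i = j" if "a \<in> A" "b \<in> A" "i < n" "j < n" for a b i j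
  proof
    assume e: "a i = b j"
    have 1: "2 + int (i * w) \<le> a i" "a i < 2 + int (Suc i * w)" "2 + int (j * w) \<le> b j" "b j < 2 + int (Suc j * w)"
      using that unfolding A_def by (auto simp: PiE_iff)
    show "i = j"
    proof (rule ccontr)
      assume "i \<noteq> j"
      then have "Suc i * w \<le> j * w \<or> Suc j * w \<le> i * w" by (metis Suc_leI linorder_neqE_nat mult_le_mono1)
      then show False using 1 e by linarith
    qed
  qed
  have "\<exists>c. int p dvd (\<Prod>i<n. a i) * c - 1" if a: "a \<in> A" for a
  proof (rule ex_inverse_mod_prime[OF p])
    show "\<not> int p dvd (\<Prod>i<n. a i)" using nd(1)[OF a] pi by (simp add: prime_dvd_prod_iff)
  qed
  then obtain C where C: "\<And>a. a \<in> A \<Longrightarrow> int p dvd (\<Prod>i<n. a i) * C a - 1" by metis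
  have Cnd: "\<not> int p dvd C a" if a: "a \<in> A" for a
  proof
    assume "int p dvd C a"
    then have "int p dvd (\<Prod>i<n. a i) * C a" by simp
    from dvd_diff[OF this C[OF a]] have "int p dvd 1" by simp
    then show False using p3 by (simp add: zdvd1_eq)
  qed
  define T where "T a = {t\<in>{0..<int p}. \<forall>u. \<not> int p dvd u\<^sup>2 - t * u + C a}" for a
  have cT: "2 * card (T a) + 1 \<ge> p" if "a \<in> A" for a
    unfolding T_def by (rule card_irreducible_quadratics[OF p Cnd[OF that]])
  define Q where "Q = (\<lambda>(a, t). [:C a, - t, 1:] * (\<Prod>i<n. [:- a i, 1:]))"
  have Qe: "poly (Q (a, t)) x = (x\<^sup>2 - t * x + C a) * (\<Prod>i<n. x - a i)" for a t x
    by (simp add: Q_def poly_prod algebra_simps power2_eq_square)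
  have Qlc: "lead_coeff (Q x) = 1" "Polynomial.degree (Q x) = N" for x
  proof -
    obtain a t where x: "x = (a, t)" by (cases x)
    define q where "q = (\<Prod>i<n. [:- a i, 1:])"
    have "lead_coeff q = 1" unfolding q_def lead_coeff_prod by simp
    moreover have "Polynomial.degree q = n"
      unfolding q_def by (subst degree_prod_eq_sum_degree) auto
    ultimately have q: "lead_coeff q = 1" "Polynomial.degree q = n" .
    then have "q \<noteq> 0" by auto
    have Q: "Q x = [:C a, - t, 1:] * q" by (simp add: Q_def q_def x)
    show "lead_coeff (Q x) = 1" unfolding Q lead_coeff_mult by (simp only: q(1)) simp
    show "Polynomial.degree (Q x) = N" unfolding Q using \<open>q \<noteq> 0\<close> q by (subst degree_mult_eq) (auto simp: Nn)
  qed
  define \<Phi> where "\<Phi> x = (\<lambda>k\<in>{1..<N}. coeff (Q x) k mod int p)" for x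
  have cong: "int p dvd coeff (poly_with_coeffs N (\<Phi> (a, t))) k - coeff (Q (a, t)) k" if a: "a \<in> A" for a t k
  proof -
    consider "k = 0" | "k = N" | "0 < k" "k < N" | "k > N" by linarith
    then show ?thesis
    proof cases
      case 1
      have "coeff (Q (a, t)) 0 = C a * (\<Prod>i<n. - a i)"
        using Qe[of a t 0] by (simp add: poly_0_coeff_0)
      also have "\<dots> = (-1) ^ n * ((\<Prod>i<n. a i) * C a)"
        using prod.distrib[of "\<lambda>_. -1" a "{..<n}"] by simp
      finally have "coeff (poly_with_coeffs N (\<Phi> (a, t))) 0 - coeff (Q (a, t)) 0 = (-1) ^ n * (- ((\<Prod>i<n. a i) * C a - 1))"
        by (simp add: coeff_poly_with_coeffs Nn algebra_simps)
      also have "int p dvd \<dots>" using C[OF a] by (intro dvd_mult) (simp only: dvd_minus_iff)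
      finally show ?thesis using 1 by simp
    next
      case 2
      then show ?thesis using Qlc[of "(a, t)"] N by (simp add: coeff_poly_with_coeffs)
    next
      case 3
      then show ?thesis by (simp add: coeff_poly_with_coeffs \<Phi>_def mod_eq_dvd_iff[symmetric])
    next
      case 4
      then show ?thesis using Qlc[of "(a, t)"] N by (simp add: coeff_poly_with_coeffs coeff_eq_0)
    qed
  qed
  have good: "irreducible_quadratic_times_linears p N (poly_with_coeffs N (\<Phi> (a, t)))"
    if a: "a \<in> A" and t: "t \<in> T a" for a t
    unfolding irreducible_quadratic_times_linears_def
  proof (rule exI[of _ a], rule exI[of _ t], rule exI[of _ "C a"], intro conjI allI impI)
    fix i j assume ij: "i < N - 2" "j < N - 2" "int p dvd a i - a j"
    then have "a i = a j" using blk[OF a, of i] blk[OF a, of j] by (intro eqmod) (auto simp: Nn)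
    then show "i = j" using sep[OF a a] ij by (simp add: Nn)
  qed (use nd[OF a] t cong[OF a, of t] in \<open>auto simp: T_def Q_def Nn\<close>)
  have dvdQ: "int p dvd poly (Q (a, t)) x - poly (Q (b, s)) x" if "a \<in> A" "b \<in> A" "\<Phi> (a, t) = \<Phi> (b, s)" for a b t s x
  proof -
    have "int p dvd coeff (Q (a, t)) k - coeff (Q (b, s)) k" for k
      using dvd_diff[OF cong[OF that(2), of s k] cong[OF that(1), of t k]] that(3) by simp
    then have "int p dvd (\<Sum>k\<le>N. (coeff (Q (a, t)) k - coeff (Q (b, s)) k) * x ^ k)"
      by (intro dvd_sum) simp
    also have "\<dots> = poly (Q (a, t)) x - poly (Q (b, s)) x"
      by (simp add: poly_altdef Qlc sum_subtractf left_diff_distrib)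
    finally show ?thesis .
  qed
  have inj: "inj_on \<Phi> (SIGMA a:A. T a)"
  proof (rule inj_onI)
    fix x y assume xy: "x \<in> (SIGMA a:A. T a)" "y \<in> (SIGMA a:A. T a)" "\<Phi> x = \<Phi> y"
    obtain a t b s where e: "x = (a, t)" "y = (b, s)" by (cases x; cases y)
    have ab: "a \<in> A" "b \<in> A" "t \<in> T a" "s \<in> T b" and \<Phi>: "\<Phi> (a, t) = \<Phi> (b, s)" using xy e by auto
    have "a i = b i" if i: "i < n" for i
    proof -
      have "poly (Q (a, t)) (a i) = 0" using i by (auto simp: Qe)
      then have "int p dvd poly (Q (b, s)) (a i)" using dvdQ[OF ab(1,2) \<Phi>, of "a i"] by simp
      moreover have "\<not> int p dvd (a i)\<^sup>2 - s * a i + C b" using ab(4) by (simp add: T_def)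
      ultimately have "int p dvd (\<Prod>j<n. a i - b j)" using pi by (simp add: Qe prime_dvd_mult_iff)
      then obtain j where j: "j < n" "int p dvd a i - b j" using pi by (auto simp: prime_dvd_prod_iff)
      then have "a i = b j" using blk[OF ab(1) i] blk[OF ab(2) j(1)] by (intro eqmod) auto
      then show ?thesis using sep[OF ab(1,2) i j(1)] by simp
    qed
    then have "a = b" using ab(1,2) unfolding A_def by (intro PiE_ext) auto
    have "int p dvd (s - t) * (\<Prod>i<n. 1 - a i)"
      using dvdQ[OF ab(1,2) \<Phi>, of 1] \<open>a = b\<close> by (simp add: Qe algebra_simps)
    moreover have "\<not> int p dvd (\<Prod>i<n. 1 - a i)" using nd(2)[OF ab(1)] pi by (simp add: prime_dvd_prod_iff)
    ultimately have "int p dvd s - t" using pi by (simp add: prime_dvd_mult_iff)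
    then have "s = t" using ab by (intro eqmod) (auto simp: T_def)
    then show "x = y" using e \<open>a = b\<close> by simp
  qed
  have finA: "finite A" unfolding A_def by (intro finite_PiE) auto
  have finT: "finite (T a)" for a unfolding T_def by (rule finite_subset[of _ "{0..<int p}"]) auto
  have cA: "card A = w ^ n"
    unfolding A_def by (subst card_PiE) (auto simp: algebra_simps)
  have "w ^ n * (p - 1) \<le> (\<Sum>a\<in>A. 2 * card (T a))"
  proof -
    have "(\<Sum>a\<in>A. p - 1) \<le> (\<Sum>a\<in>A. 2 * card (T a))"
      by (intro sum_mono) (use cT in force)
    then show ?thesis by (simp add: cA)
  qed
  also have "\<dots> = 2 * card (SIGMA a:A. T a)" using finA finT by (simp add: sum_distrib_left)
  also have "\<dots> = 2 * card (\<Phi> ` (SIGMA a:A. T a))" using inj by (simp add: card_image)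
  also have "\<dots> \<le> 2 * card {c\<in>coeff_box p N. irreducible_quadratic_times_linears p N (poly_with_coeffs N c)}"
  proof -
    have "\<Phi> x \<in> coeff_box p N" for x using p3 by (auto simp: \<Phi>_def coeff_box_def)
    then have "\<Phi> ` (SIGMA a:A. T a) \<subseteq>
        {c\<in>coeff_box p N. irreducible_quadratic_times_linears p N (poly_with_coeffs N c)}"
      using good by fast
    then show ?thesis by (intro mult_left_mono card_mono) auto
  qed
  finally show ?thesis by (simp add: n_def)
qed

context residue_prime
begin

lemma frobenius_diff:
  assumes "algebraic_int a" "algebraic_int b"
  shows "(a - b) ^ p \<equiv>\<^sub>P a ^ p - b ^ p"
proof -
  have "((a - b) + b) ^ p \<equiv>\<^sub>P (a - b) ^ p + b ^ p" using assms by (intro frobenius_add) auto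
  then have "a ^ p - b ^ p \<equiv>\<^sub>P (a - b) ^ p + b ^ p - b ^ p" by (intro residue_eq_diff) auto
  then show ?thesis by (simp add: residue_eq_sym)
qed

lemma frobenius_prod_linear:
  assumes "finite I" "\<And>i. i \<in> I \<Longrightarrow> algebraic_int (z i)"
  shows "coeff (\<Prod>i\<in>I. [:- z i, 1:]) k ^ p \<equiv>\<^sub>P coeff (\<Prod>i\<in>I. [:- (z i ^ p), 1:]) k"
  using assms
proof (induction I arbitrary: k rule: finite_induct)
  case empty
  then show ?case using p_gt_1 by (auto simp: zero_power)
next
  case (insert x I)
  define Q where "Q = (\<Prod>i\<in>I. [:- z i, 1:])"
  define Q' where "Q' = (\<Prod>i\<in>I. [:- (z i ^ p), 1:])"
  have IH: "coeff Q k ^ p \<equiv>\<^sub>P coeff Q' k" for k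
    using insert unfolding Q_def Q'_def by auto
  have Qi: "algebraic_int (coeff Q k)" "algebraic_int (coeff Q' k)" for k
  proof -
    have "int_coeffs Q" "int_coeffs Q'" unfolding Q_def Q'_def by (auto intro!: int_coeffs_prod algebraic_int_power insert.prems)
    then show "algebraic_int (coeff Q k)" "algebraic_int (coeff Q' k)" by (auto simp: int_coeffs_def)
  qed
  have e: "coeff ([:- z, 1:] * q) k = (case k of 0 \<Rightarrow> 0 | Suc l \<Rightarrow> coeff q l) - z * coeff q k" for z :: complex and q k
    by (simp add: coeff_pCons split: nat.split)
  have "coeff ([:- z x, 1:] * Q) k ^ p \<equiv>\<^sub>P (case k of 0 \<Rightarrow> 0 | Suc l \<Rightarrow> coeff Q l) ^ p - (z x * coeff Q k) ^ p"
    unfolding e using Qi insert.prems by (intro frobenius_diff) (auto split: nat.split)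
  also have "\<dots> \<equiv>\<^sub>P (case k of 0 \<Rightarrow> 0 | Suc l \<Rightarrow> coeff Q' l) - z x ^ p * coeff Q' k"
    unfolding power_mult_distrib using IH Qi insert.prems p_gt_1
    by (intro residue_eq_diff residue_eq_mult) (auto split: nat.split simp: zero_power)
  also have "\<dots> = coeff ([:- (z x ^ p), 1:] * Q') k" by (simp only: e)
  finally show ?case using insert.hyps by (simp add: Q_def Q'_def)
qed

text \<open>If \<open>z \<noteq> w\<close>, then the other factor of \<open>z\<^sup>m - w\<^sup>m\<close> vanishes, but modulo \<open>P\<close> it is \<open>m z\<^bsup>m - 1\<^esup>\<close>. For \<open>m = q - 1\<close> with a power
  \<open>q\<close> of \<open>p\<close>, the roots of unity therefore represent the nonzero elements of the field with \<open>q\<close> elements.\<close>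

lemma roots_of_unity_incongruent:
  assumes zw: "z ^ m = 1" "w ^ m = 1" and m: "m > 0" "of_nat m \<notin> P" and c: "z \<equiv>\<^sub>P w"
  shows "z = (w :: complex)"
proof (rule ccontr)
  assume ne: "z \<noteq> w"
  note int = algebraic_int_root_of_unity[OF m(1)]
  have "0 = (z - w) * (\<Sum>i<m. w ^ (m - Suc i) * z ^ i)"
    using zw power_diff_sumr2[of z m w] by simp
  then have s: "(\<Sum>i<m. w ^ (m - Suc i) * z ^ i) = 0" using ne by simp
  have "(\<Sum>i<m. w ^ (m - Suc i) * z ^ i) \<equiv>\<^sub>P (\<Sum>i<m. z ^ (m - Suc i) * z ^ i)"
    using int zw residue_eq_sym[OF c] by (intro residue_eq_sum residue_eq_mult residue_eq_power) auto
  also have "(\<Sum>i<m. z ^ (m - Suc i) * z ^ i) = (\<Sum>i<m. z ^ (m - 1))"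
    by (intro sum.cong) (auto simp flip: power_add)
  finally have "of_nat m * z ^ (m - 1) \<in> P" using s by (simp add: residue_eq_def)
  from P_mult'[OF this, of z] have "of_nat m * z ^ (m - 1) * z \<in> P" using int zw by simp
  then have "of_nat m * (z ^ (m - 1) * z) \<in> P" by (simp only: mult.assoc)
  also have "z ^ (m - 1) * z = 1" using zw m by (metis power_minus_mult)
  finally show False using m by simp
qed

text \<open>The residues of degree exactly \<open>n\<close> over the prime field outnumber the others, and each of the
  polynomials counted here accounts for at most \<open>N\<close> of them.\<close>

lemma count_linear_times_irreducible:
  assumes N: "N \<ge> 3" and p3: "p \<ge> 3"
  shows "2 * N * card {c\<in>coeff_box p N. linear_times_irreducible p N (poly_with_coeffs N c)} \<ge> p ^ (N - 1)"
proof -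
  define n where "n = N - 1"
  have n2: "n \<ge> 2" using N by (simp add: n_def)
  have Nn: "N = Suc n" using N by (simp add: n_def)
  define q where "q = p ^ n"
  define m where "m = q - 1"
  have "p ^ 1 \<le> p ^ n" using n2 p3 by (intro power_increasing) auto
  then have q3: "q \<ge> 3" using p3 by (simp add: q_def)
  then have m0: "m > 0" by (simp add: m_def)
  have mq: "Suc m = q" using q3 by (simp add: m_def)
  have mP: "of_nat m \<notin> P"
  proof
    assume "of_nat m \<in> P"
    then have "int p dvd int m" using of_int_in_P_iff[of "int m"] by simp
    then have "p dvd m" by simp
    moreover have "p dvd q" using n2 by (simp add: q_def dvd_power)
    ultimately have "p dvd 1" using mq by (metis Suc_eq_plus1 dvd_add_right_iff)
    then show False using p3 by simp
  qed
  define S where "S = {z :: complex. z ^ m = 1}"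
  have finS: "finite S" and cS: "card S = m"
    unfolding S_def using m0 by (auto simp: card_roots_unity_eq intro: finite_roots_unity)
  have Sint: "algebraic_int z" if "z \<in> S" for z
    using that algebraic_int_root_of_unity[OF m0] by (simp add: S_def)
  have Sinc: "z = w" if "z \<in> S" "w \<in> S" "z \<equiv>\<^sub>P w" for z w
    using roots_of_unity_incongruent[of z m w] that m0 mP by (auto simp: S_def)
  have Sq: "z ^ q = z" if "z \<in> S" for z using that mq by (metis S_def mem_Collect_eq mult.right_neutral power_Suc)
  define Low where "Low d = {z\<in>S. z ^ (p ^ d) - z \<in> P}" for d
  have cLow: "card (Low d) \<le> p ^ d" if d: "d > 0" for d
  proof (rule card_roots_mod_le[of _ "Polynomial.monom 1 (p ^ d) - Polynomial.monom 1 1"])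
    have pd: "p ^ d > 1" using d p_gt_1 by (metis one_less_power)
    show "finite (Low d)" using finS by (simp add: Low_def)
    show "int_coeffs (Polynomial.monom 1 (p ^ d) - Polynomial.monom 1 1)"
      by (auto simp: int_coeffs_def)
    show "Polynomial.degree (Polynomial.monom 1 (p ^ d) - Polynomial.monom 1 1 :: complex poly) \<le> p ^ d"
      using pd by (intro degree_diff_le) (auto simp: degree_monom_eq)
    show "\<exists>k. coeff (Polynomial.monom 1 (p ^ d) - Polynomial.monom 1 1) k \<notin> P"
      using one_notin pd by (intro exI[of _ "p ^ d"]) simp
  qed (use Sint Sinc in \<open>auto simp: Low_def poly_monom\<close>)
  define S' where "S' = S - (\<Union>d\<in>{1..<n}. Low d)"
  have "card (\<Union>d\<in>{1..<n}. Low d) \<le> (\<Sum>d\<in>{1..<n}. card (Low d))" by (rule card_UN_le) simp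
  also have "\<dots> \<le> (\<Sum>d\<in>{1..<n}. p ^ d)" using cLow by (intro sum_mono) auto
  finally have low: "card (\<Union>d\<in>{1..<n}. Low d) \<le> (\<Sum>d\<in>{1..<n}. p ^ d)" .
  have geo: "2 * (\<Sum>d\<in>{1..<k}. p ^ d) + 2 \<le> p ^ k" if "k \<ge> 1" for k
    using that
  proof (induction k rule: dec_induct)
    case base
    then show ?case using p3 by simp
  next
    case (step k)
    have "2 * (\<Sum>d\<in>{1..<Suc k}. p ^ d) + 2 = 2 * (\<Sum>d\<in>{1..<k}. p ^ d) + 2 + 2 * p ^ k"
      using step.hyps by simp
    also have "\<dots> \<le> 3 * p ^ k" using step.IH by simp
    also have "\<dots> \<le> p ^ Suc k" using p3 by simp
    finally show ?case .
  qed
  have "(\<Union>d\<in>{1..<n}. Low d) \<subseteq> S" by (auto simp: Low_def)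
  then have "card S' = card S - card (\<Union>d\<in>{1..<n}. Low d)"
    unfolding S'_def using finS by (intro card_Diff_subset finite_subset[OF _ finS])
  then have cS': "q \<le> 2 * card S'" using low geo[of n] n2 cS mq by (simp add: q_def)
  define E where "E = {c\<in>coeff_box p N. linear_times_irreducible p N (poly_with_coeffs N c)}"
  have finE: "finite E" by (simp add: E_def)
  define Z where "Z c = {z\<in>S. poly (of_int_poly (poly_with_coeffs N c)) z \<in> P}" for c
  have cZ: "card (Z c) \<le> N" for c
  proof (rule card_roots_mod_le[of _ "of_int_poly (poly_with_coeffs N c)"])
    show "finite (Z c)" using finS by (simp add: Z_def)
    show "Polynomial.degree (of_int_poly (poly_with_coeffs N c) :: complex poly) \<le> N"
      by (intro degree_le) (simp add: coeff_poly_with_coeffs)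
    show "\<exists>k. coeff (of_int_poly (poly_with_coeffs N c)) k \<notin> P"
      using one_notin N by (intro exI[of _ N]) (simp add: coeff_poly_with_coeffs)
  qed (use Sint Sinc in \<open>auto simp: Z_def\<close>)
  \<comment> \<open>The product over the Frobenius orbit of \<open>\<beta>\<close> has coefficients in the prime field; the linear factor adjusts the constant term.\<close>
  have cover: "\<exists>c\<in>E. \<beta> \<in> Z c" if b: "\<beta> \<in> S'" for \<beta>
  proof -
    have \<beta>S: "\<beta> \<in> S" using b by (simp add: S'_def)
    have \<beta>: "algebraic_int \<beta>" using Sint \<beta>S by blast
    have low: "\<beta> ^ (p ^ d) - \<beta> \<notin> P" if "0 < d" "d < n" for d
      using b \<beta>S that by (auto simp: S'_def Low_def)
    define g where "g = (\<Prod>i<n. [:- (\<beta> ^ (p ^ i)), 1:])"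
    have gint: "int_coeffs g" unfolding g_def using \<beta> by (intro int_coeffs_prod) auto
    have "coeff g k ^ p \<equiv>\<^sub>P coeff (\<Prod>i<n. [:- ((\<beta> ^ (p ^ i)) ^ p), 1:]) k" for k
      unfolding g_def using \<beta> by (intro frobenius_prod_linear) auto
    moreover have "(\<Prod>i<n. [:- ((\<beta> ^ (p ^ i)) ^ p), 1:]) = g"
    proof -
      define h where "h i = [:- (\<beta> ^ (p ^ i)), 1:]" for i
      have "(\<Prod>i<n. [:- ((\<beta> ^ (p ^ i)) ^ p), 1:]) = (\<Prod>i<n. h (Suc i))"
        by (simp add: h_def mult.commute flip: power_mult)
      moreover have "h 0 * (\<Prod>i<n. h (Suc i)) = (\<Prod>i<n. h i) * h n"
        using prod.lessThan_Suc_shift[of h n] prod.lessThan_Suc[of h n] by simp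
      moreover have "h n = h 0" using Sq[OF \<beta>S] by (simp add: h_def q_def)
      ultimately have "h 0 * (\<Prod>i<n. [:- ((\<beta> ^ (p ^ i)) ^ p), 1:]) = h 0 * (\<Prod>i<n. h i)"
        by (metis mult.commute)
      moreover have "h 0 \<noteq> 0" by (simp add: h_def)
      ultimately have "(\<Prod>i<n. [:- ((\<beta> ^ (p ^ i)) ^ p), 1:]) = (\<Prod>i<n. h i)"
        using mult_left_cancel by blast
      then show ?thesis by (simp add: g_def h_def)
    qed
    ultimately have "coeff g k ^ p \<equiv>\<^sub>P coeff g k" for k by simp
    then have "\<exists>l. coeff g k \<equiv>\<^sub>P of_int l" for k
      using frobenius_fixed_imp_int gint unfolding int_coeffs_def by blast
    then obtain G where G: "\<And>k. coeff g k \<equiv>\<^sub>P of_int (G k)" by metis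
    have "coeff g 0 = (\<Prod>i<n. - (\<beta> ^ (p ^ i)))"
      unfolding g_def by (simp add: poly_0_coeff_0[symmetric] poly_prod)
    moreover have "\<beta> ^ (p ^ i) \<notin> P" for i
    proof
      assume "\<beta> ^ (p ^ i) \<in> P"
      then have "(\<beta> ^ (p ^ i)) ^ (m - 1) * \<beta> ^ (p ^ i) \<in> P" using \<beta> by (intro P_mult) auto
      also have "(\<beta> ^ (p ^ i)) ^ (m - 1) * \<beta> ^ (p ^ i) = (\<beta> ^ m) ^ (p ^ i)"
        using m0 by (metis (no_types, lifting) mult.commute power_minus_mult power_mult)
      finally show False using one_notin \<beta>S by (simp add: S_def)
    qed
    ultimately have g0: "coeff g 0 \<notin> P"
      using P_prod[of "{..<n}" "\<lambda>i. - (\<beta> ^ (p ^ i))"] \<beta> by auto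
    have "\<not> int p dvd G 0"
    proof
      assume "int p dvd G 0"
      then have "of_int (G 0) \<in> P" by (simp add: of_int_in_P_iff)
      then show False using g0 G[of 0] P_add[of "coeff g 0 - of_int (G 0)" "of_int (G 0)"] by (simp add: residue_eq_def)
    qed
    then obtain y where y: "int p dvd G 0 * y - 1" using ex_inverse_mod_prime[OF prime_p] by blast
    define a where "a = (-1) ^ n * y"
    define Q where "Q = [:- of_int a, 1:] * g"
    have cQ: "coeff Q k = (case k of 0 \<Rightarrow> 0 | Suc l \<Rightarrow> coeff g l) - of_int a * coeff g k" for k
      by (simp add: Q_def coeff_pCons split: nat.split)
    define H where "H k = (case k of 0 \<Rightarrow> 0 | Suc l \<Rightarrow> G l) - a * G k" for k
    have QH: "coeff Q k \<equiv>\<^sub>P of_int (H k)" for k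
    proof -
      have "coeff Q k \<equiv>\<^sub>P (case k of 0 \<Rightarrow> 0 | Suc l \<Rightarrow> of_int (G l)) - of_int a * of_int (G k)"
        unfolding cQ using G gint by (intro residue_eq_diff residue_eq_mult) (auto split: nat.split simp: int_coeffs_def)
      also have "\<dots> = of_int (H k)" by (simp add: H_def split: nat.split)
      finally show ?thesis .
    qed
    define c where "c = (\<lambda>k\<in>{1..<N}. H k mod int p)"
    have "lead_coeff g = 1" unfolding g_def lead_coeff_prod by simp
    moreover have "Polynomial.degree g = n"
      unfolding g_def by (subst degree_prod_eq_sum_degree) auto
    ultimately have g: "lead_coeff g = 1" "Polynomial.degree g = n" .
    have fQ: "coeff (of_int_poly (poly_with_coeffs N c)) k \<equiv>\<^sub>P coeff Q k" for k
    proof -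
      consider "k = 0" | "k = N" | "0 < k" "k < N" | "k > N" by linarith
      then show ?thesis
      proof cases
        case 1
        have "of_int ((-1) ^ N) \<equiv>\<^sub>P of_int (H 0)"
        proof -
          have "(-1) ^ N - H 0 = (-1) ^ n * (G 0 * y - 1)" by (simp add: H_def a_def Nn algebra_simps)
          then show ?thesis using y unfolding residue_eq_of_int_iff by simp
        qed
        also have "of_int (H 0) \<equiv>\<^sub>P coeff Q 0" using QH residue_eq_sym by blast
        finally show ?thesis using 1 by (simp add: coeff_poly_with_coeffs)
      next
        case 2
        have "coeff Q N = 1" using g by (simp add: cQ Nn coeff_eq_0)
        then show ?thesis using 2 N by (simp add: coeff_poly_with_coeffs)
      next
        case 3
        have "of_int (H k mod int p) \<equiv>\<^sub>P of_int (H k)"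
          by (simp add: residue_eq_of_int_iff mod_eq_dvd_iff[symmetric])
        also have "of_int (H k) \<equiv>\<^sub>P coeff Q k" using QH residue_eq_sym by blast
        finally show ?thesis using 3 by (simp add: coeff_poly_with_coeffs c_def)
      next
        case 4
        have "coeff Q k = 0" using 4 g by (simp add: cQ Nn coeff_eq_0 split: nat.split)
        then show ?thesis using 4 N by (simp add: coeff_poly_with_coeffs)
      qed
    qed
    have rp: "residue_prime p P" by unfold_locales
    have "linear_times_irreducible p N (poly_with_coeffs N c)"
      unfolding linear_times_irreducible_def
    proof (intro exI[of _ P] exI[of _ a] exI[of _ \<beta>] conjI allI impI)
      show "\<beta> ^ (p ^ (N - 1)) - \<beta> \<in> P" using Sq[OF \<beta>S] by (simp add: q_def n_def)
      show "\<beta> ^ (p ^ d) - \<beta> \<notin> P" if "0 < d" "d < N - 1" for d using low that by (simp add: n_def)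
      show "coeff (of_int_poly (poly_with_coeffs N c)) k -
          coeff ([:- of_int a, 1:] * (\<Prod>i<N - 1. [:- (\<beta> ^ (p ^ i)), 1:])) k \<in> P" for k
        using fQ[of k] unfolding residue_eq_def Q_def g_def n_def .
    qed (use rp \<beta> in auto)
    moreover have "c \<in> coeff_box p N" using p_gt_1 by (auto simp: c_def coeff_box_def)
    ultimately have "c \<in> E" by (simp add: E_def)
    moreover have "int_coeffs Q" unfolding Q_def using gint by (intro int_coeffs_mult) auto
    then have "poly (of_int_poly (poly_with_coeffs N c)) \<beta> \<equiv>\<^sub>P poly Q \<beta>"
      using fQ \<beta> by (intro residue_eq_poly_coeffs) auto
    moreover have "poly Q \<beta> = 0"
      using n2 by (auto simp: Q_def g_def poly_prod intro!: bexI[of _ 0])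
    ultimately show ?thesis using \<beta>S by (auto simp: Z_def residue_eq_0_iff)
  qed
  have "card S' \<le> card (\<Union>c\<in>E. Z c)"
    using cover finE finS by (intro card_mono) (auto simp: Z_def)
  also have "\<dots> \<le> (\<Sum>c\<in>E. card (Z c))" by (rule card_UN_le[OF finE])
  also have "\<dots> \<le> card E * N" using sum_bounded_above[of E "\<lambda>c. card (Z c)" N] cZ by simp
  finally have "2 * card S' \<le> 2 * N * card E" by (simp add: mult_ac)
  then show ?thesis using cS' by (simp add: q_def n_def E_def)
qed

end

section \<open>Characteristic polynomials in a family of row operations\<close>

definition cong_mat :: "nat \<Rightarrow> 'a :: comm_ring_1 \<Rightarrow> 'a mat \<Rightarrow> 'a mat \<Rightarrow> bool" where
  "cong_mat n d A B \<longleftrightarrow> A \<in> carrier_mat n n \<and> B \<in> carrier_mat n n \<and>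
     (\<forall>i<n. \<forall>j<n. d dvd A $$ (i,j) - B $$ (i,j))"

lemma cong_mat_refl: "A \<in> carrier_mat n n \<Longrightarrow> cong_mat n d A A"
  by (simp add: cong_mat_def)

lemma cong_mat_sym:
  assumes "cong_mat n d A B"
  shows "cong_mat n d B A"
proof -
  have "d dvd B $$ (i,j) - A $$ (i,j)" if "i < n" "j < n" for i j
  proof -
    obtain k where "A $$ (i,j) - B $$ (i,j) = d * k"
      using assms \<open>i < n\<close> \<open>j < n\<close> unfolding cong_mat_def by (blast elim: dvdE)
    then have "B $$ (i,j) - A $$ (i,j) = d * (- k)" by (simp add: algebra_simps)
    then show ?thesis by (metis dvd_triv_left)
  qed
  then show ?thesis using assms by (simp add: cong_mat_def)
qed

lemma cong_mat_trans:
  assumes "cong_mat n d A B" "cong_mat n d B C"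
  shows "cong_mat n d A C"
proof -
  have "d dvd A $$ (i,j) - C $$ (i,j)" if "i < n" "j < n" for i j
  proof -
    have "d dvd (A $$ (i,j) - B $$ (i,j)) + (B $$ (i,j) - C $$ (i,j))"
      using assms that by (intro dvd_add) (auto simp: cong_mat_def)
    then show ?thesis by simp
  qed
  then show ?thesis using assms by (simp add: cong_mat_def)
qed

lemma dvd_mult_diff:
  fixes d :: "'a :: comm_ring_1"
  assumes "d dvd a - a'" "d dvd b - b'"
  shows "d dvd a * b - a' * b'"
proof -
  have "a * b - a' * b' = (a - a') * b + a' * (b - b')" by (simp add: algebra_simps)
  then show ?thesis using assms by (metis dvd_add dvd_mult dvd_mult2)
qed

lemma dvd_prod_diff:
  fixes d :: "'a :: comm_ring_1"
  shows "(\<And>i. i \<in> I \<Longrightarrow> d dvd f i - g i) \<Longrightarrow> d dvd prod f I - prod g I"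
  by (induction I rule: infinite_finite_induct) (auto intro: dvd_mult_diff)

lemma dvd_sum_diff:
  fixes d :: "'a :: comm_ring_1"
  shows "(\<And>i. i \<in> I \<Longrightarrow> d dvd f i - g i) \<Longrightarrow> d dvd sum f I - sum g I"
  unfolding sum_subtractf[symmetric] by (rule dvd_sum)

lemma mat_mult_index:
  assumes "A \<in> carrier_mat n m" "B \<in> carrier_mat m k" "i < n" "j < k"
  shows "(A * B) $$ (i,j) = (\<Sum>l<m. A $$ (i,l) * B $$ (l,j))"
  using assms by (auto simp: scalar_prod_def lessThan_atLeast0)

lemma cong_mat_mult:
  assumes "cong_mat n d A A'" "cong_mat n d B B'"
  shows "cong_mat n d (A * B) (A' * B')"
proof -
  have c: "A \<in> carrier_mat n n" "A' \<in> carrier_mat n n" "B \<in> carrier_mat n n" "B' \<in> carrier_mat n n"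
    using assms by (auto simp: cong_mat_def)
  have "d dvd (A * B) $$ (i,j) - (A' * B') $$ (i,j)" if "i < n" "j < n" for i j
    unfolding mat_mult_index[OF c(1,3) that] mat_mult_index[OF c(2,4) that]
    using assms that by (intro dvd_sum_diff dvd_mult_diff) (auto simp: cong_mat_def)
  then show ?thesis using c unfolding cong_mat_def by auto
qed

lemma cong_mat_pow:
  assumes "cong_mat n d A B"
  shows "cong_mat n d (A ^\<^sub>m k) (B ^\<^sub>m k)"
proof (induction k)
  case 0
  then show ?case using assms by (auto simp: cong_mat_def)
next
  case (Suc k)
  then show ?case using cong_mat_mult assms by simp
qed

lemma cong_mat_det:
  assumes "cong_mat n d A B"
  shows "d dvd Determinant.det A - Determinant.det B"
proof -
  have c: "A \<in> carrier_mat n n" "B \<in> carrier_mat n n" using assms by (auto simp: cong_mat_def)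
  show ?thesis unfolding det_def'[OF c(1)] det_def'[OF c(2)]
  proof (intro dvd_sum_diff dvd_mult_diff dvd_prod_diff)
    fix \<pi> i assume "\<pi> \<in> {\<pi>. \<pi> permutes {0..<n}}" "i \<in> {0..<n}"
    then have "i < n" "\<pi> i < n" using permutes_in_image[of \<pi> "{0..<n}" i] by auto
    then show "d dvd A $$ (i, \<pi> i) - B $$ (i, \<pi> i)" using assms by (auto simp: cong_mat_def)
  qed simp
qed

lemma cong_mat_char_poly:
  assumes "cong_mat n d A B"
  shows "d dvd coeff (char_poly A) k - coeff (char_poly B) k"
proof -
  have "cong_mat n [:d:] (char_poly_matrix A) (char_poly_matrix B)"
    unfolding cong_mat_def
  proof (intro conjI allI impI)
    have c: "A \<in> carrier_mat n n" "B \<in> carrier_mat n n" using assms by (auto simp: cong_mat_def)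
    then show "char_poly_matrix A \<in> carrier_mat n n" "char_poly_matrix B \<in> carrier_mat n n" by auto
    fix i j assume ij: "i < n" "j < n"
    have "char_poly_matrix A $$ (i,j) - char_poly_matrix B $$ (i,j) = [:B $$ (i,j) - A $$ (i,j):]"
      using c ij by (simp add: char_poly_matrix_def)
    moreover have "d dvd B $$ (i,j) - A $$ (i,j)"
      using cong_mat_sym[OF assms] ij by (auto simp: cong_mat_def)
    then obtain k where "B $$ (i,j) - A $$ (i,j) = d * k" by (elim dvdE)
    then have "[:B $$ (i,j) - A $$ (i,j):] = [:d:] * [:k:]" by simp
    ultimately show "[:d:] dvd char_poly_matrix A $$ (i,j) - char_poly_matrix B $$ (i,j)"
      by (metis dvd_triv_left)
  qed
  from cong_mat_det[OF this] have "[:d:] dvd char_poly A - char_poly B" by (simp add: char_poly_def)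
  then obtain q where q: "char_poly A - char_poly B = [:d:] * q" by (elim dvdE)
  have "coeff (char_poly A) k - coeff (char_poly B) k = d * coeff q k"
    using arg_cong[OF q, of "\<lambda>q. coeff q k"] by simp
  then show ?thesis by (metis dvd_triv_left)
qed

text \<open>The determinant of the Krylov vectors \<open>e\<^sub>0, A e\<^sub>0, A\<^sup>2 e\<^sub>0, \<dots>\<close>; it is invertible when the first basis vector is
  cyclic for \<open>A\<close>.\<close>

definition krylov_det :: "nat \<Rightarrow> 'a :: comm_ring_1 mat \<Rightarrow> 'a" where
  "krylov_det N A = Determinant.det (mat N N (\<lambda>(i,k). (A ^\<^sub>m k) $$ (i,0)))"

lemma krylov_det_cong:
  assumes "cong_mat N d A B" "N > 0"
  shows "d dvd krylov_det N A - krylov_det N B"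
  unfolding krylov_det_def
proof (rule cong_mat_det)
  show "cong_mat N d (mat N N (\<lambda>(i,k). (A ^\<^sub>m k) $$ (i,0))) (mat N N (\<lambda>(i,k). (B ^\<^sub>m k) $$ (i,0)))"
    using cong_mat_pow[OF assms(1)] assms(2) by (auto simp: cong_mat_def)
qed

text \<open>Left multiplication by \<open>first_row_shear N v\<close> adds \<open>v k\<close> times row \<open>k\<close> to row \<open>0\<close>, for all
  \<open>k \<ge> 1\<close>.\<close>

definition first_row_shear :: "nat \<Rightarrow> (nat \<Rightarrow> 'a :: comm_ring_1) \<Rightarrow> 'a mat" where
  "first_row_shear N v = mat N N (\<lambda>(i,j). if i = j then 1 else if i = 0 then v j else 0)"

lemma first_row_shear_carrier [simp]: "first_row_shear N v \<in> carrier_mat N N"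
  by (simp add: first_row_shear_def)

lemma first_row_shear_mult_index:
  assumes A: "A \<in> carrier_mat N N" and ij: "i < N" "j < N"
  shows "(first_row_shear N v * A) $$ (i,j) =
    (if i = 0 then A $$ (0,j) + (\<Sum>k\<in>{1..<N}. v k * A $$ (k,j)) else A $$ (i,j))"
proof -
  have e: "(first_row_shear N v * A) $$ (i,j) = (\<Sum>k<N. (if i = k then 1 else if i = 0 then v k else 0) * A $$ (k,j))"
    using mat_mult_index[OF first_row_shear_carrier A ij, of v] ij
    by (simp add: first_row_shear_def)
  show ?thesis
  proof (cases "i = 0")
    case False
    then have "(\<Sum>k<N. (if i = k then 1 else if i = 0 then v k else 0) * A $$ (k,j)) = (\<Sum>k<N. if i = k then A $$ (k,j) else 0)"
      by (intro sum.cong) auto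
    then show ?thesis using False e ij by simp
  next
    case True
    have "{..<N} = insert 0 {1..<N}" using ij by auto
    then have "(\<Sum>k<N. (if i = k then 1 else if i = 0 then v k else 0) * A $$ (k,j)) =
        A $$ (0,j) + (\<Sum>k\<in>{1..<N}. (if i = k then 1 else if i = 0 then v k else 0) * A $$ (k,j))"
      using True by simp
    also have "(\<Sum>k\<in>{1..<N}. (if i = k then 1 else if i = 0 then v k else 0) * A $$ (k,j)) = (\<Sum>k\<in>{1..<N}. v k * A $$ (k,j))"
      using True by (intro sum.cong) auto
    finally show ?thesis using True e by simp
  qed
qed

text \<open>The first column of the adjugate of \<open>X - A\<close>.\<close>

definition resolvent_column :: "'a :: comm_ring_1 mat \<Rightarrow> nat \<Rightarrow> 'a poly" where
  "resolvent_column A j = cofactor (char_poly_matrix A) 0 j"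

lemma char_poly_matrix_index:
  assumes "A \<in> carrier_mat N N" "i < N" "j < N"
  shows "char_poly_matrix A $$ (i,j) = (if i = j then [:0,1:] else 0) - [:A $$ (i,j):]"
  using assms by (auto simp: char_poly_matrix_def)

lemma resolvent_column_equation:
  assumes A: "A \<in> carrier_mat N N" and N: "N > 0" and i: "i < N"
  shows "pCons 0 (resolvent_column A i) - (\<Sum>j<N. smult (A $$ (i,j)) (resolvent_column A j)) =
    (if i = 0 then char_poly A else 0)"
proof -
  let ?M = "char_poly_matrix A"
  have M: "?M \<in> carrier_mat N N" using A by simp
  note adj = adj_mat[OF M]
  have "(?M * adj_mat ?M) $$ (i,0) = (\<Sum>j<N. ?M $$ (i,j) * adj_mat ?M $$ (j,0))"
    by (rule mat_mult_index[OF M adj(1) i N])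
  also have "\<dots> = (\<Sum>j<N. (if i = j then [:0,1:] * resolvent_column A j else 0) - smult (A $$ (i,j)) (resolvent_column A j))"
  proof (rule sum.cong)
    fix j assume "j \<in> {..<N}"
    then have j: "j < N" by simp
    have "adj_mat ?M $$ (j,0) = resolvent_column A j"
      using j N M by (simp add: adj_mat_def resolvent_column_def)
    then show "?M $$ (i,j) * adj_mat ?M $$ (j,0) =
        (if i = j then [:0,1:] * resolvent_column A j else 0) - smult (A $$ (i,j)) (resolvent_column A j)"
      unfolding char_poly_matrix_index[OF A i j] by (auto simp: algebra_simps)
  qed simp
  also have "\<dots> = pCons 0 (resolvent_column A i) - (\<Sum>j<N. smult (A $$ (i,j)) (resolvent_column A j))"
    using i by (simp add: sum_subtractf)
  finally show ?thesis using adj(2) i N by (cases "i = 0") (simp_all add: char_poly_def)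
qed

text \<open>In the Laplace expansion of the characteristic polynomial along row \<open>0\<close> the cofactors do not see row \<open>0\<close>, and by
  \<open>resolvent_column_equation\<close> row \<open>k\<close> of \<open>A\<close> times the column of cofactors is the column's entry \<open>k\<close> times the variable.\<close>

lemma char_poly_first_row_shear:
  assumes A: "A \<in> carrier_mat N N" and N: "N > 0"
  shows "char_poly (first_row_shear N v * A) =
    char_poly A - pCons 0 (\<Sum>k\<in>{1..<N}. smult (v k) (resolvent_column A k))"
proof -
  define B where "B = first_row_shear N v * A"
  have B: "B \<in> carrier_mat N N" unfolding B_def using A by (intro mult_carrier_mat) auto
  let ?M = "char_poly_matrix A" and ?L = "char_poly_matrix B"
  have M: "?M \<in> carrier_mat N N" and L: "?L \<in> carrier_mat N N" using A B by auto
  have "mat_delete ?L 0 j = mat_delete ?M 0 j" for j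
  proof (rule eq_matI)
    fix a b assume "a < dim_row (mat_delete ?M 0 j)" "b < dim_col (mat_delete ?M 0 j)"
    then have ab: "Suc a < N" "Suc b < N" using M by auto
    define b' where "b' = (if b < j then b else Suc b)"
    have b': "b' < N" using ab by (simp add: b'_def)
    have "B $$ (Suc a, b') = A $$ (Suc a, b')"
      unfolding B_def using first_row_shear_mult_index[OF A ab(1) b'] by simp
    then have "?L $$ (Suc a, b') = ?M $$ (Suc a, b')"
      using char_poly_matrix_index[OF A ab(1) b'] char_poly_matrix_index[OF B ab(1) b'] by simp
    then show "mat_delete ?L 0 j $$ (a,b) = mat_delete ?M 0 j $$ (a,b)"
      using ab L M by (simp add: mat_delete_def b'_def)
  qed (use L M in auto)
  then have cof: "cofactor ?L 0 j = resolvent_column A j" for j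
    by (simp add: resolvent_column_def cofactor_def)
  have "char_poly B = (\<Sum>j<N. ?L $$ (0,j) * resolvent_column A j)"
    unfolding char_poly_def using laplace_expansion_row[OF L N] by (simp add: cof)
  also have "\<dots> = (\<Sum>j<N. ?M $$ (0,j) * resolvent_column A j -
      (\<Sum>k\<in>{1..<N}. smult (v k) (smult (A $$ (k,j)) (resolvent_column A j))))"
  proof (rule sum.cong)
    fix j assume "j \<in> {..<N}"
    then have j: "j < N" by simp
    have "[:B $$ (0,j):] = [:A $$ (0,j):] + [:(\<Sum>k\<in>{1..<N}. v k * A $$ (k,j)):]"
      unfolding B_def using first_row_shear_mult_index[OF A N j] by simp
    then have "?L $$ (0,j) = ?M $$ (0,j) - [:(\<Sum>k\<in>{1..<N}. v k * A $$ (k,j)):]"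
      unfolding char_poly_matrix_index[OF A N j] char_poly_matrix_index[OF B N j] by simp
    then show "?L $$ (0,j) * resolvent_column A j = ?M $$ (0,j) * resolvent_column A j -
        (\<Sum>k\<in>{1..<N}. smult (v k) (smult (A $$ (k,j)) (resolvent_column A j)))"
      by (simp add: left_diff_distrib smult_sum)
  qed simp
  also have "\<dots> = (\<Sum>j<N. ?M $$ (0,j) * cofactor ?M 0 j) -
      (\<Sum>j<N. \<Sum>k\<in>{1..<N}. smult (v k) (smult (A $$ (k,j)) (resolvent_column A j)))"
    by (simp add: sum_subtractf resolvent_column_def)
  also have "(\<Sum>j<N. ?M $$ (0,j) * cofactor ?M 0 j) = char_poly A"
    unfolding char_poly_def using laplace_expansion_row[OF M N] by simp
  also have "(\<Sum>j<N. \<Sum>k\<in>{1..<N}. smult (v k) (smult (A $$ (k,j)) (resolvent_column A j))) =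
      (\<Sum>k\<in>{1..<N}. \<Sum>j<N. smult (v k) (smult (A $$ (k,j)) (resolvent_column A j)))"
    by (rule sum.swap)
  also have "\<dots> = (\<Sum>k\<in>{1..<N}. smult (v k) (pCons 0 (resolvent_column A k)))"
  proof (rule sum.cong)
    fix k assume "k \<in> {1..<N}"
    then have "(\<Sum>j<N. smult (A $$ (k,j)) (resolvent_column A j)) = pCons 0 (resolvent_column A k)"
      using resolvent_column_equation[OF A N, of k] by simp
    then show "(\<Sum>j<N. smult (v k) (smult (A $$ (k,j)) (resolvent_column A j))) = smult (v k) (pCons 0 (resolvent_column A k))"
      by (simp only: smult_sum2[symmetric])
  qed simp
  also have "\<dots> = pCons 0 (\<Sum>k\<in>{1..<N}. smult (v k) (resolvent_column A k))"
  proof -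
    have "(\<Sum>k\<in>K. smult (v k) (pCons 0 (resolvent_column A k))) = pCons 0 (\<Sum>k\<in>K. smult (v k) (resolvent_column A k))" if "finite K" for K
      using that by induction auto
    then show ?thesis by simp
  qed
  finally show ?thesis by (simp add: B_def)
qed

text \<open>Modulo \<open>p\<close>, let the functional \<open>d\<close> vanish on the coefficient vectors of the resolvent column. By the resolvent
  equation, so does \<open>d A\<^sup>k\<close> for every \<open>k\<close>. The leading coefficient vector is \<open>e\<^sub>0\<close>, so \<open>d\<close> vanishes on the Krylov
  vectors, which span the whole space.\<close>

lemma functional_vanishes_if_cyclic:
  fixes A :: "int mat"
  assumes A: "A \<in> carrier_mat N N" and N: "N > 0" and p: "prime (p::int)"
    and cyc: "\<not> p dvd krylov_det N A"
    and van: "\<And>m. p dvd (\<Sum>j<N. d j * coeff (resolvent_column A j) m)"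
    and i: "i < N"
  shows "p dvd d i"
proof -
  define q where "q = char_poly A"
  let ?z = "\<lambda>j m. coeff (resolvent_column A j) m"
  have eq: "(\<Sum>j<N. A $$ (i,j) * ?z j m) = (case m of 0 \<Rightarrow> 0 | Suc l \<Rightarrow> ?z i l) - (if i = 0 then coeff q m else 0)"
    if i: "i < N" for i m
  proof -
    have "coeff (pCons 0 (resolvent_column A i) - (\<Sum>j<N. smult (A $$ (i,j)) (resolvent_column A j))) m =
      coeff (if i = 0 then char_poly A else 0) m"
      using resolvent_column_equation[OF A N i] by simp
    then show ?thesis by (auto simp: coeff_sum coeff_pCons q_def split: nat.splits if_splits)
  qed
  have deg: "?z j N = 0" for j
  proof -
    have "Polynomial.degree (resolvent_column A j) \<le> 1 * (N - 1)"
    proof -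
      have M: "char_poly_matrix A \<in> carrier_mat N N" using A by simp
      have "Polynomial.degree (Determinant.det (mat_delete (char_poly_matrix A) 0 j)) \<le> 1 * (N - 1)"
      proof (rule degree_det_le)
        show "mat_delete (char_poly_matrix A) 0 j \<in> carrier_mat (N - 1) (N - 1)"
          by (rule mat_delete_carrier[OF M])
        fix a b assume ab: "a < N - 1" "b < N - 1"
        define b' where "b' = (if b < j then b else Suc b)"
        have b': "b' < N" using ab by (auto simp: b'_def)
        have "mat_delete (char_poly_matrix A) 0 j $$ (a,b) = char_poly_matrix A $$ (Suc a, b')"
          using ab M by (simp add: mat_delete_def b'_def)
        also have "\<dots> = (if Suc a = b' then [:0,1:] else 0) - [:A $$ (Suc a, b'):]"
          using ab b' by (intro char_poly_matrix_index[OF A]) auto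
        also have "Polynomial.degree \<dots> \<le> 1"
          by (intro degree_diff_le) auto
        finally show "Polynomial.degree (mat_delete (char_poly_matrix A) 0 j $$ (a,b)) \<le> 1" .
      qed
      moreover have "Polynomial.degree ((-1) ^ (0 + j) * D) = Polynomial.degree D" for D :: "int poly"
        by (cases "even j") auto
      ultimately show ?thesis unfolding resolvent_column_def cofactor_def by simp
    qed
    then show ?thesis using N by (intro coeff_eq_0) auto
  qed
  have qN: "coeff q N = 1" using degree_monic_char_poly[OF A] by (simp add: q_def)
  have top: "?z i (N - 1) = (if i = 0 then 1 else 0)" if "i < N" for i
    using eq[OF that, of N] N qN deg by (auto simp: not0_implies_Suc split: nat.splits)
  \<comment> \<open>The functional \<open>d A\<^sup>k\<close>.\<close>
  define l where "l k j = (\<Sum>i<N. d i * (A ^\<^sub>m k) $$ (i,j))" for k j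
  have Ak: "A ^\<^sub>m k \<in> carrier_mat N N" for k using A by (rule pow_carrier_mat)
  have l0: "l 0 j = d j" if "j < N" for j
  proof -
    have "l 0 j = (\<Sum>i<N. if i = j then d i else 0)"
      unfolding l_def using A that by (intro sum.cong) auto
    then show ?thesis using that by simp
  qed
  have lS: "l (Suc k) j = (\<Sum>i<N. l k i * A $$ (i,j))" if "j < N" for k j
  proof -
    have "l (Suc k) j = (\<Sum>i<N. d i * (\<Sum>r<N. (A ^\<^sub>m k) $$ (i,r) * A $$ (r,j)))"
      unfolding l_def using mat_mult_index[OF Ak A _ that] by (intro sum.cong) auto
    also have "\<dots> = (\<Sum>i<N. \<Sum>r<N. d i * (A ^\<^sub>m k) $$ (i,r) * A $$ (r,j))"
      by (simp add: sum_distrib_left mult.assoc)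
    also have "\<dots> = (\<Sum>r<N. \<Sum>i<N. d i * (A ^\<^sub>m k) $$ (i,r) * A $$ (r,j))" by (rule sum.swap)
    finally show ?thesis by (simp add: l_def sum_distrib_right)
  qed
  have claim: "p dvd (\<Sum>j<N. l k j * ?z j m)" for k m
  proof (induction k arbitrary: m)
    case 0
    then show ?case using van[of m] l0 by simp
  next
    case (Suc k)
    have lk0: "p dvd l k 0"
    proof -
      have "(\<Sum>j<N. l k j * ?z j (N - 1)) = (\<Sum>j<N. if j = 0 then l k j else 0)"
        using top by (intro sum.cong) auto
      then show ?thesis using Suc[of "N - 1"] N by simp
    qed
    have "(\<Sum>j<N. l (Suc k) j * ?z j m) = (\<Sum>j<N. \<Sum>i<N. l k i * A $$ (i,j) * ?z j m)"
      using lS by (intro sum.cong) (auto simp: sum_distrib_right)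
    also have "\<dots> = (\<Sum>i<N. \<Sum>j<N. l k i * A $$ (i,j) * ?z j m)" by (rule sum.swap)
    also have "\<dots> = (\<Sum>i<N. l k i * (\<Sum>j<N. A $$ (i,j) * ?z j m))"
      by (simp add: sum_distrib_left mult.assoc)
    also have "\<dots> = (\<Sum>i<N. l k i * (case m of 0 \<Rightarrow> 0 | Suc r \<Rightarrow> ?z i r) - (if i = 0 then l k i * coeff q m else 0))"
      using eq by (intro sum.cong) (auto simp: right_diff_distrib)
    also have "\<dots> = (\<Sum>i<N. l k i * (case m of 0 \<Rightarrow> 0 | Suc r \<Rightarrow> ?z i r)) - l k 0 * coeff q m"
      using N by (simp add: sum_subtractf)
    also have "p dvd \<dots>"
    proof (intro dvd_diff dvd_mult2 lk0)
      show "p dvd (\<Sum>i<N. l k i * (case m of 0 \<Rightarrow> 0 | Suc r \<Rightarrow> ?z i r))"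
        using Suc by (cases m) auto
    qed
    finally show ?case .
  qed
  have col: "p dvd l k 0" for k
  proof -
    have "(\<Sum>j<N. l k j * ?z j (N - 1)) = (\<Sum>j<N. if j = 0 then l k j else 0)"
      using top by (intro sum.cong) auto
    then show ?thesis using claim[of k "N - 1"] N by simp
  qed
  define Kr where "Kr = mat N N (\<lambda>(i,k). (A ^\<^sub>m k) $$ (i,0))"
  have Kr: "Kr \<in> carrier_mat N N" by (simp add: Kr_def)
  note adj = adj_mat[OF Kr]
  have "(\<Sum>k<N. l k 0 * adj_mat Kr $$ (k,i)) = (\<Sum>k<N. \<Sum>j<N. d j * Kr $$ (j,k) * adj_mat Kr $$ (k,i))"
    by (intro sum.cong) (auto simp: l_def sum_distrib_right Kr_def)
  also have "\<dots> = (\<Sum>j<N. \<Sum>k<N. d j * Kr $$ (j,k) * adj_mat Kr $$ (k,i))" by (rule sum.swap)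
  also have "\<dots> = (\<Sum>j<N. d j * (Kr * adj_mat Kr) $$ (j,i))"
    using mat_mult_index[OF Kr adj(1) _ i] by (intro sum.cong) (auto simp: sum_distrib_left mult.assoc)
  also have "\<dots> = (\<Sum>j<N. if j = i then d j * Determinant.det Kr else 0)"
    unfolding adj(2) using i by (intro sum.cong) auto
  also have "\<dots> = d i * krylov_det N A" using i by (simp add: krylov_det_def Kr_def)
  finally have "d i * krylov_det N A = (\<Sum>k<N. l k 0 * adj_mat Kr $$ (k,i))" by simp
  also have "p dvd \<dots>" using col by (intro dvd_sum) auto
  finally show ?thesis using cyc p by (simp add: prime_dvd_mult_iff)
qed

lemma char_poly_coeff_0:
  fixes A :: "int mat"
  assumes "A \<in> carrier_mat N N"
  shows "coeff (char_poly A) 0 = (-1) ^ N * Determinant.det A"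
proof -
  have c: "char_poly_matrix A \<in> carrier_mat N N" using assms by simp
  have "coeff (char_poly A) 0 = poly (Determinant.det (char_poly_matrix A)) 0"
    by (simp add: char_poly_def poly_0_coeff_0)
  also have "\<dots> = Determinant.det (- A)"
    using poly_det_cong[OF uminus_carrier_mat[OF assms] c, of 0] char_poly_matrix_index[OF assms] assms by simp
  also have "- A = (-1) \<cdot>\<^sub>m A" using assms by (intro eq_matI) auto
  also have "Determinant.det \<dots> = (-1) ^ N * Determinant.det A"
    using assms by (simp add: det_smult)
  finally show ?thesis .
qed

text \<open>The coefficients of the characteristic polynomial depend affinely on \<open>v\<close>, and by \<open>functional_vanishes_if_cyclic\<close> the
  linear part is injective modulo \<open>p\<close>, hence bijective. The unit \<open>u\<close> leaves room for the factors of the Chinese remainder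
  theorem.\<close>

lemma char_poly_equidistributed:
  fixes A :: "int mat" and u :: int
  assumes A: "A \<in> carrier_mat N N" and N: "N > 0" and p: "prime p"
    and cyc: "\<not> int p dvd krylov_det N A" and u: "\<not> int p dvd u"
    and det: "int p dvd Determinant.det A - 1"
    and good: "\<And>f g. (\<And>k. int p dvd coeff f k - coeff g k) \<Longrightarrow> Good g \<Longrightarrow> Good f"
  shows "card {v\<in>coeff_box p N. Good (char_poly (first_row_shear N (\<lambda>k. u * v k) * A))} =
    card {c\<in>coeff_box p N. Good (poly_with_coeffs N c)}"
proof -
  have pi: "prime (int p)" and p0: "int p > 0" using p prime_gt_0_nat by auto
  define cp where "cp v = char_poly (first_row_shear N (\<lambda>k. u * v k) * A)" for v
  define \<Psi> where "\<Psi> v = (\<lambda>k\<in>{1..<N}. coeff (cp v) k mod int p)" for v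
  have box: "\<Psi> v \<in> coeff_box p N" for v using p0 by (auto simp: \<Psi>_def coeff_box_def)
  have B: "first_row_shear N (\<lambda>k. u * v k) * A \<in> carrier_mat N N" for v
    using A by (intro mult_carrier_mat) auto
  have monic: "Polynomial.degree (cp v) = N" "coeff (cp v) N = 1" for v
    using degree_monic_char_poly[OF B[of v]] by (auto simp: cp_def)
  have c0: "coeff (cp v) 0 = coeff (char_poly A) 0" for v
    unfolding cp_def char_poly_first_row_shear[OF A N] by simp
  have coeff: "int p dvd coeff (cp v) k - coeff (poly_with_coeffs N (\<Psi> v)) k" for v k
  proof -
    consider "k = 0" | "k = N" "k > 0" | "0 < k" "k < N" | "k > N" by linarith
    then show ?thesis
    proof cases
      case 1
      have "coeff (cp v) 0 - (-1) ^ N = (-1) ^ N * (Determinant.det A - 1)"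
        by (simp add: c0 char_poly_coeff_0[OF A] algebra_simps)
      then show ?thesis using 1 det by (simp add: coeff_poly_with_coeffs)
    next
      case 3
      then show ?thesis by (simp add: coeff_poly_with_coeffs \<Psi>_def mod_eq_dvd_iff[symmetric])
    qed (use monic[of v] in \<open>auto simp: coeff_poly_with_coeffs coeff_eq_0\<close>)
  qed
  have inj: "inj_on \<Psi> (coeff_box p N)"
  proof (rule inj_onI)
    fix v w assume vw: "v \<in> coeff_box p N" "w \<in> coeff_box p N" "\<Psi> v = \<Psi> w"
    define d where "d k = (if k = 0 then 0 else u * (v k - w k))" for k
    have "int p dvd (\<Sum>j<N. d j * coeff (resolvent_column A j) m)" for m
    proof -
      have "int p dvd coeff (cp w) (Suc m) - coeff (cp v) (Suc m)"
        using dvd_diff[OF coeff[of w "Suc m"] coeff[of v "Suc m"]] vw(3) by simp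
      also have "coeff (cp w) (Suc m) - coeff (cp v) (Suc m) = (\<Sum>j\<in>{1..<N}. d j * coeff (resolvent_column A j) m)"
        unfolding cp_def char_poly_first_row_shear[OF A N]
        by (simp add: coeff_sum sum_subtractf[symmetric] d_def) (intro sum.cong, auto simp: algebra_simps)
      also have "\<dots> = (\<Sum>j<N. d j * coeff (resolvent_column A j) m)"
        by (rule sum.mono_neutral_left) (auto simp: d_def)
      finally show ?thesis .
    qed
    then have dk: "int p dvd d k" if "k < N" for k
      using functional_vanishes_if_cyclic[OF A N pi cyc _ that] by blast
    show "v = w"
    proof (rule PiE_ext)
      show "v \<in> PiE {1..<N} (\<lambda>_. {0..<int p})" "w \<in> PiE {1..<N} (\<lambda>_. {0..<int p})"
        using vw by (auto simp: coeff_box_def)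
      fix k assume k: "k \<in> {1..<N}"
      then have "int p dvd v k - w k" using dk[of k] u pi by (auto simp: d_def prime_dvd_mult_iff)
      moreover have "0 \<le> v k" "v k < int p" "0 \<le> w k" "w k < int p"
        using vw k by (auto simp: coeff_box_def PiE_iff)
      ultimately show "v k = w k" by (auto dest!: mod_eq_dvd_iff[THEN iffD2])
    qed
  qed
  have "\<Psi> ` coeff_box p N = coeff_box p N"
    using box inj by (intro endo_inj_surj) auto
  then have bij: "bij_betw \<Psi> (coeff_box p N) (coeff_box p N)" using inj by (simp add: bij_betw_def)
  have iff: "Good (cp v) \<longleftrightarrow> Good (poly_with_coeffs N (\<Psi> v))" for v
    using good[of "cp v" "poly_with_coeffs N (\<Psi> v)"] good[of "poly_with_coeffs N (\<Psi> v)" "cp v"] coeff[of v]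
    by (metis dvd_minus_iff minus_diff_eq)
  have "\<Psi> ` {v\<in>coeff_box p N. Good (cp v)} = {c\<in>coeff_box p N. Good (poly_with_coeffs N c)}"
    using bij iff by (force simp: bij_betw_def)
  then have "card {c\<in>coeff_box p N. Good (poly_with_coeffs N c)} = card {v\<in>coeff_box p N. Good (cp v)}"
    using inj by (metis (no_types, lifting) card_image inj_on_subset mem_Collect_eq subsetI)
  then show ?thesis by (simp add: cp_def)
qed

section \<open>Matrices without a cyclic first basis vector are rare\<close>

text \<open>Exactly \<open>k\<close> factors; shorter products are included, as soon as \<open>N \<ge> 2\<close>, since the multiplier \<open>x\<close> may be \<open>0\<close>.\<close>

primrec elementary_products :: "nat \<Rightarrow> nat \<Rightarrow> int mat set" where
  "elementary_products N 0 = {1\<^sub>m N}"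
| "elementary_products N (Suc k) =
     {W * addrow_mat N x i j | W x i j. W \<in> elementary_products N k \<and> i < N \<and> j < N \<and> i \<noteq> j}"

lemma elementary_products_carrier: "W \<in> elementary_products N k \<Longrightarrow> W \<in> carrier_mat N N"
  by (induction k arbitrary: W) (auto intro!: mult_carrier_mat)

lemma elementary_products_SucI:
  "W \<in> elementary_products N k \<Longrightarrow> i < N \<Longrightarrow> j < N \<Longrightarrow> i \<noteq> j \<Longrightarrow>
    W * addrow_mat N x i j \<in> elementary_products N (Suc k)"
  by auto

lemma elementary_products_SucE:
  assumes "W \<in> elementary_products N (Suc k)"
  obtains V x i j where "W = V * addrow_mat N x i j" "V \<in> elementary_products N k" "i < N" "j < N" "i \<noteq> j"
  using assms by auto

declare elementary_products.simps(2) [simp del]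

lemma elementary_products_det: "W \<in> elementary_products N k \<Longrightarrow> Determinant.det W = 1"
proof (induction k arbitrary: W)
  case (Suc k)
  then obtain V x i j where "W = V * addrow_mat N x i j" "V \<in> elementary_products N k" "i < N" "j < N" "i \<noteq> j"
    by (elim elementary_products_SucE)
  then show ?case using Suc.IH[of V] det_mult[OF elementary_products_carrier addrow_mat_carrier, of V N k x i j]
    by (simp add: det_addrow_mat)
qed simp

lemma elementary_products_mult:
  "V \<in> elementary_products N k \<Longrightarrow> W \<in> elementary_products N l \<Longrightarrow> V * W \<in> elementary_products N (k + l)"
proof (induction l arbitrary: W)
  case 0
  then show ?case using elementary_products_carrier[OF 0(1)] by simp
next
  case (Suc l)
  then obtain U x i j where W: "W = U * addrow_mat N x i j" "U \<in> elementary_products N l" "i < N" "j < N" "i \<noteq> j"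
    using Suc.prems(2) by (elim elementary_products_SucE)
  have "V * W = (V * U) * addrow_mat N x i j"
    unfolding W(1) using Suc.prems(1) W(2)
    by (intro assoc_mult_mat[symmetric]) (auto intro: elementary_products_carrier)
  then show ?case using elementary_products_SucI[OF Suc.IH[OF Suc.prems(1) W(2)] W(3-5), of x] by simp
qed

lemma addrow_mat_in_elementary_products:
  "i < N \<Longrightarrow> j < N \<Longrightarrow> i \<noteq> j \<Longrightarrow> addrow_mat N x i j \<in> elementary_products N 1"
  using elementary_products_SucI[of "1\<^sub>m N" N 0 i j x] by simp

lemma addrow_mat_0: "addrow_mat N 0 i j = 1\<^sub>m N"
  by (rule eq_matI) auto

lemma one_in_elementary_products: "N \<ge> 2 \<Longrightarrow> 1\<^sub>m N \<in> elementary_products N k"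
proof (induction k)
  case (Suc k)
  have "1\<^sub>m N * addrow_mat N 0 0 1 \<in> elementary_products N (Suc k)"
    using Suc by (intro elementary_products_SucI) auto
  then show ?case by (simp add: addrow_mat_0)
qed simp

lemma addrow_mat_mult_index:
  assumes "A \<in> carrier_mat N N" "i < N" "j < N" "r < N" "c < N"
  shows "(addrow_mat N x i j * A) $$ (r,c) = (if r = i then x * A $$ (j,c) + A $$ (i,c) else A $$ (r,c))"
  using assms addrow_mat[OF assms(1,3), of x i, symmetric] by auto

definition reaches_cyclic :: "nat \<Rightarrow> nat \<Rightarrow> nat \<Rightarrow> int mat \<Rightarrow> bool" where
  "reaches_cyclic p N k A \<longleftrightarrow> (\<exists>W\<in>elementary_products N k. \<not> int p dvd krylov_det N (W * A))"

lemma reaches_cyclic_cong: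
  assumes "cong_mat N (int p) A B" "N > 0"
  shows "reaches_cyclic p N k A \<longleftrightarrow> reaches_cyclic p N k B"
proof -
  have "reaches_cyclic p N k B" if c: "cong_mat N (int p) A B" "reaches_cyclic p N k A" for A B
  proof -
    obtain W where W: "W \<in> elementary_products N k" "\<not> int p dvd krylov_det N (W * A)"
      using c by (auto simp: reaches_cyclic_def)
    have "cong_mat N (int p) (W * A) (W * B)"
      using c(1) W by (intro cong_mat_mult cong_mat_refl) (auto intro: elementary_products_carrier)
    from krylov_det_cong[OF this assms(2)] have "\<not> int p dvd krylov_det N (W * B)"
      using W(2) by (metis diff_add_cancel dvd_add)
    then show ?thesis using W by (auto simp: reaches_cyclic_def)
  qed
  then show ?thesis using assms(1) cong_mat_sym by blast
qed

lemma reaches_cyclic_Suc: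
  assumes A: "A \<in> carrier_mat N N"
  shows "reaches_cyclic p N (Suc k) A \<longleftrightarrow>
    (\<exists>i<N. \<exists>j<N. i \<noteq> j \<and> (\<exists>x. reaches_cyclic p N k (addrow_mat N x i j * A)))"
proof -
  have "(W * addrow_mat N x i j) * A = W * (addrow_mat N x i j * A)" if "W \<in> elementary_products N k" for W x i j
    using A elementary_products_carrier[OF that] by (intro assoc_mult_mat) auto
  note assoc = this
  show ?thesis
  proof
    assume "reaches_cyclic p N (Suc k) A"
    then obtain V where V: "V \<in> elementary_products N (Suc k)" "\<not> int p dvd krylov_det N (V * A)"
      by (auto simp: reaches_cyclic_def)
    obtain W x i j where W: "V = W * addrow_mat N x i j" "W \<in> elementary_products N k" "i < N" "j < N" "i \<noteq> j"
      using V(1) by (elim elementary_products_SucE)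
    then have "reaches_cyclic p N k (addrow_mat N x i j * A)"
      using V(2) assoc[OF W(2), of x i j] unfolding reaches_cyclic_def by (intro bexI[of _ W]) auto
    then show "\<exists>i<N. \<exists>j<N. i \<noteq> j \<and> (\<exists>x. reaches_cyclic p N k (addrow_mat N x i j * A))" using W by blast
  next
    assume "\<exists>i<N. \<exists>j<N. i \<noteq> j \<and> (\<exists>x. reaches_cyclic p N k (addrow_mat N x i j * A))"
    then obtain x i j W where W: "i < N" "j < N" "i \<noteq> j" "W \<in> elementary_products N k"
      "\<not> int p dvd krylov_det N (W * (addrow_mat N x i j * A))" by (auto simp: reaches_cyclic_def)
    then show "reaches_cyclic p N (Suc k) A"
      using elementary_products_SucI[OF W(4,1-3), of x] assoc[OF W(4), of x i j]
      unfolding reaches_cyclic_def by (intro bexI[of _ "W * addrow_mat N x i j"]) auto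
  qed
qed

text \<open>Along the line of all multiples of an elementary row operation, the Krylov determinant is a polynomial of
  bounded degree, so it vanishes either everywhere or rarely.\<close>

lemma krylov_det_along_line:
  assumes W: "W \<in> carrier_mat N N" and A: "A \<in> carrier_mat N N" and ij: "i < N" "j < N" and N: "N > 0"
  shows "\<exists>F :: int poly. Polynomial.degree F \<le> N * N \<and>
    (\<forall>x. poly F x = krylov_det N (W * (addrow_mat N x i j * A)))"
proof -
  define E where "E = addrow_mat N [:0, 1 :: int:] i j"
  define M where "M = map_mat (\<lambda>a. [:a:]) W * (E * map_mat (\<lambda>a. [:a:]) A)"
  have c: "map_mat (\<lambda>a. [:a:]) W \<in> carrier_mat N N" "map_mat (\<lambda>a. [:a:]) A \<in> carrier_mat N N"
    "E \<in> carrier_mat N N" using W A by (auto simp: E_def)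
  have cEA: "E * map_mat (\<lambda>a. [:a:]) A \<in> carrier_mat N N" using c by (intro mult_carrier_mat)
  have M: "M \<in> carrier_mat N N" unfolding M_def using c cEA by (intro mult_carrier_mat)
  have degM: "Polynomial.degree (M $$ (r,s)) \<le> 1" if rs: "r < N" "s < N" for r s
  proof -
    have "Polynomial.degree ((E * map_mat (\<lambda>a. [:a:]) A) $$ (l,s)) \<le> 1" if "l < N" for l
      unfolding mat_mult_index[OF c(3,2) that rs(2)]
      using that ij rs A by (intro degree_sum_le order.trans[OF degree_mult_le]) (auto simp: E_def one_pCons)
    then show ?thesis unfolding M_def mat_mult_index[OF c(1) cEA rs]
      using W rs by (intro degree_sum_le order.trans[OF degree_mult_le]) auto
  qed
  have Mk: "M ^\<^sub>m k \<in> carrier_mat N N" for k using M by (rule pow_carrier_mat)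
  have degMk: "Polynomial.degree ((M ^\<^sub>m k) $$ (r,s)) \<le> k" if "r < N" "s < N" for k r s
    using that
  proof (induction k arbitrary: r s)
    case 0
    then show ?case using M by auto
  next
    case (Suc k)
    have "Polynomial.degree ((M ^\<^sub>m k) $$ (r,l) * M $$ (l,s)) \<le> Suc k" if "l < N" for l
      using degree_mult_le[of "(M ^\<^sub>m k) $$ (r,l)" "M $$ (l,s)"] Suc.IH[of r l] degM[of l s] Suc.prems that by linarith
    then have "Polynomial.degree ((M ^\<^sub>m k * M) $$ (r,s)) \<le> Suc k"
      unfolding mat_mult_index[OF Mk M Suc.prems] by (intro degree_sum_le) auto
    then show ?case by simp
  qed
  have "Polynomial.degree (krylov_det N M) \<le> N * N"
    unfolding krylov_det_def
  proof (rule degree_det_le)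
    fix r s assume rs: "r < N" "s < N"
    have "Polynomial.degree ((M ^\<^sub>m s) $$ (r,0)) \<le> s" using degMk rs N by blast
    then show "Polynomial.degree (mat N N (\<lambda>(i, k). (M ^\<^sub>m k) $$ (i, 0)) $$ (r,s)) \<le> N" using rs by simp
  qed simp
  moreover have "poly (krylov_det N M) x = krylov_det N (W * (addrow_mat N x i j * A))" for x
  proof -
    have ev: "semiring_hom (\<lambda>f :: int poly. poly f x)" by unfold_locales auto
    have ev': "comm_ring_hom (\<lambda>f :: int poly. poly f x)" by unfold_locales auto
    have WW: "map_mat (\<lambda>f. poly f x) (map_mat (\<lambda>a. [:a:]) W) = W"
      "map_mat (\<lambda>f. poly f x) (map_mat (\<lambda>a. [:a:]) A) = A" "map_mat (\<lambda>f. poly f x) E = addrow_mat N x i j"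
      by (auto simp: E_def intro!: eq_matI)
    have "map_mat (\<lambda>f. poly f x) (E * map_mat (\<lambda>a. [:a:]) A) = addrow_mat N x i j * A"
      using semiring_hom.mat_hom_mult[OF ev c(3,2)] WW by simp
    then have ME: "map_mat (\<lambda>f. poly f x) M = W * (addrow_mat N x i j * A)"
      unfolding M_def using semiring_hom.mat_hom_mult[OF ev c(1) cEA] WW by simp
    have "poly (krylov_det N M) x = Determinant.det (map_mat (\<lambda>f. poly f x) (mat N N (\<lambda>(i,k). (M ^\<^sub>m k) $$ (i,0))))"
      unfolding krylov_det_def by (rule comm_ring_hom.hom_det[OF ev', symmetric])
    also have "map_mat (\<lambda>f. poly f x) (mat N N (\<lambda>(i,k). (M ^\<^sub>m k) $$ (i,0))) =
        mat N N (\<lambda>(a,b). ((W * (addrow_mat N x i j * A)) ^\<^sub>m b) $$ (a,0))"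
    proof (rule eq_matI)
      fix r s assume "r < dim_row (mat N N (\<lambda>(a,b). ((W * (addrow_mat N x i j * A)) ^\<^sub>m b) $$ (a,0)))"
        "s < dim_col (mat N N (\<lambda>(a,b). ((W * (addrow_mat N x i j * A)) ^\<^sub>m b) $$ (a,0)))"
      then have rs: "r < N" "s < N" by auto
      have "poly ((M ^\<^sub>m s) $$ (r,0)) x = (map_mat (\<lambda>f. poly f x) (M ^\<^sub>m s)) $$ (r,0)"
        using Mk[of s] rs N by (subst index_map_mat) auto
      also have "\<dots> = ((W * (addrow_mat N x i j * A)) ^\<^sub>m s) $$ (r,0)"
        using semiring_hom.mat_hom_pow[OF ev M, of s] ME by simp
      finally show "map_mat (\<lambda>f. poly f x) (mat N N (\<lambda>(i,k). (M ^\<^sub>m k) $$ (i,0))) $$ (r,s) =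
        mat N N (\<lambda>(a,b). ((W * (addrow_mat N x i j * A)) ^\<^sub>m b) $$ (a,0)) $$ (r,s)" using rs by simp
    qed auto
    finally show ?thesis by (simp add: krylov_det_def)
  qed
  ultimately show ?thesis by blast
qed

text \<open>One product of elementary matrices, found for a single point of the line, works for almost all points.\<close>

lemma card_line_not_reaching:
  assumes A: "A \<in> carrier_mat N N" and ij: "i < N" "j < N" and N: "N > 0" and p: "prime p"
    and ex: "reaches_cyclic p N k (addrow_mat N x0 i j * A)"
  shows "card {x\<in>{0..<int p}. \<not> reaches_cyclic p N k (addrow_mat N x i j * A)} \<le> N * N"
proof -
  obtain W where W: "W \<in> elementary_products N k" "\<not> int p dvd krylov_det N (W * (addrow_mat N x0 i j * A))"
    using ex by (auto simp: reaches_cyclic_def)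
  obtain F :: "int poly" where F: "Polynomial.degree F \<le> N * N"
    "\<And>x. poly F x = krylov_det N (W * (addrow_mat N x i j * A))"
    using krylov_det_along_line[OF elementary_products_carrier[OF W(1)] A ij N] by blast
  have "\<exists>l. \<not> int p dvd coeff F l"
  proof (rule ccontr)
    assume "\<not> ?thesis"
    then have "int p dvd poly F x0" unfolding poly_altdef by (intro dvd_sum) auto
    then show False using W(2) F(2) by simp
  qed
  then obtain l where "\<not> int p dvd coeff F l" by blast
  then have "card {x\<in>{0..<int p}. int p dvd poly F x} \<le> N * N" by (rule card_int_roots_mod[OF p F(1)])
  moreover have "card {x\<in>{0..<int p}. \<not> reaches_cyclic p N k (addrow_mat N x i j * A)} \<le>
      card {x\<in>{0..<int p}. int p dvd poly F x}"
  proof (rule card_mono)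
    show "finite {x\<in>{0..<int p}. int p dvd poly F x}" by (rule finite_subset[of _ "{0..<int p}"]) auto
    show "{x\<in>{0..<int p}. \<not> reaches_cyclic p N k (addrow_mat N x i j * A)} \<subseteq> {x\<in>{0..<int p}. int p dvd poly F x}"
      using W(1) F(2) by (auto simp: reaches_cyclic_def)
  qed
  ultimately show ?thesis by linarith
qed

text \<open>Gaussian elimination modulo \<open>p\<close> into the monomial matrix of an \<open>N\<close>-cycle. The first \<open>k\<close> columns are
  already done: column \<open>c\<close> has its only nonzero entry in row \<open>c + 1\<close>, cyclically.\<close>

definition cyclic_columns :: "nat \<Rightarrow> nat \<Rightarrow> nat \<Rightarrow> int mat \<Rightarrow> bool" where
  "cyclic_columns p N k A \<longleftrightarrow> (\<forall>c<k. \<not> int p dvd A $$ (Suc c mod N, c) \<and>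
     (\<forall>r<N. r \<noteq> Suc c mod N \<longrightarrow> int p dvd A $$ (r,c)))"

lemma Suc_mod_inj: "c < N \<Longrightarrow> k < N \<Longrightarrow> Suc c mod N = Suc k mod N \<Longrightarrow> c = (k::nat)"
  by (auto simp: mod_Suc split: if_splits)

text \<open>Otherwise column \<open>k\<close> would be a combination of the first \<open>k\<close> columns modulo \<open>p\<close>; \<open>v\<close> contains the coefficients of the
  relation.\<close>

lemma pivot_exists:
  assumes A: "A \<in> carrier_mat N N" and k: "k < N" and p: "prime p"
    and det: "\<not> int p dvd Determinant.det A" and cc: "cyclic_columns p N k A"
  shows "\<exists>r<N. (\<forall>c<k. r \<noteq> Suc c mod N) \<and> \<not> int p dvd A $$ (r,k)"
proof (rule ccontr)
  assume no: "\<not> ?thesis"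
  have "\<exists>y. int p dvd A $$ (Suc c mod N, c) * y - 1" if "c < k" for c
    using cc that by (intro ex_inverse_mod_prime[OF p]) (auto simp: cyclic_columns_def)
  then obtain y where y: "\<And>c. c < k \<Longrightarrow> int p dvd A $$ (Suc c mod N, c) * y c - 1" by metis
  define v where "v c = (if c < k then - (A $$ (Suc c mod N, k) * y c) else if c = k then 1 else 0)" for c
  have Av: "int p dvd (\<Sum>c<N. A $$ (r,c) * v c)" if r: "r < N" for r
  proof -
    have "(\<Sum>c<N. A $$ (r,c) * v c) = (\<Sum>c<Suc k. A $$ (r,c) * v c)"
      using k by (intro sum.mono_neutral_right) (auto simp: v_def)
    also have "\<dots> = (\<Sum>c<k. A $$ (r,c) * v c) + A $$ (r,k)"
      by (simp add: v_def)
    also have "int p dvd \<dots>"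
    proof (cases "\<exists>c0<k. r = Suc c0 mod N")
      case False
      then have "int p dvd A $$ (r,k)" using no r by blast
      moreover have "int p dvd (\<Sum>c<k. A $$ (r,c) * v c)"
        using False cc r by (intro dvd_sum dvd_mult2) (auto simp: cyclic_columns_def)
      ultimately show ?thesis by (rule dvd_add[rotated])
    next
      case True
      then obtain c0 where c0: "c0 < k" "r = Suc c0 mod N" by blast
      have "(\<Sum>c<k. A $$ (r,c) * v c) = A $$ (r,c0) * v c0 + (\<Sum>c\<in>{..<k} - {c0}. A $$ (r,c) * v c)"
        using c0 by (intro sum.remove) auto
      then have "(\<Sum>c<k. A $$ (r,c) * v c) + A $$ (r,k) =
        (\<Sum>c\<in>{..<k} - {c0}. A $$ (r,c) * v c) + A $$ (r,k) * (- (A $$ (Suc c0 mod N, c0) * y c0 - 1))"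
        using c0 by (simp add: v_def algebra_simps)
      moreover have "int p dvd (\<Sum>c\<in>{..<k} - {c0}. A $$ (r,c) * v c)"
      proof (intro dvd_sum dvd_mult2)
        fix c assume c: "c \<in> {..<k} - {c0}"
        then have "r \<noteq> Suc c mod N" using Suc_mod_inj[of c N c0] c0 k by auto
        then show "int p dvd A $$ (r,c)" using cc c r by (auto simp: cyclic_columns_def)
      qed
      moreover have "int p dvd A $$ (r,k) * (- (A $$ (Suc c0 mod N, c0) * y c0 - 1))"
        using y[OF c0(1)] by (intro dvd_mult) (simp only: dvd_minus_iff)
      ultimately show ?thesis by (simp add: dvd_add)
    qed
    finally show ?thesis .
  qed
  note adj = adj_mat[OF A]
  have "(\<Sum>r<N. adj_mat A $$ (k,r) * (\<Sum>c<N. A $$ (r,c) * v c)) = (\<Sum>r<N. \<Sum>c<N. adj_mat A $$ (k,r) * A $$ (r,c) * v c)"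
    by (simp add: sum_distrib_left mult.assoc)
  also have "\<dots> = (\<Sum>c<N. \<Sum>r<N. adj_mat A $$ (k,r) * A $$ (r,c) * v c)" by (rule sum.swap)
  also have "\<dots> = (\<Sum>c<N. (adj_mat A * A) $$ (k,c) * v c)"
    using mat_mult_index[OF adj(1) A k] by (intro sum.cong) (auto simp: sum_distrib_right)
  also have "\<dots> = (\<Sum>c<N. if c = k then Determinant.det A * v c else 0)"
    unfolding adj(3) using k by (intro sum.cong) auto
  also have "\<dots> = Determinant.det A" using k by (simp add: v_def)
  finally have "Determinant.det A = (\<Sum>r<N. adj_mat A $$ (k,r) * (\<Sum>c<N. A $$ (r,c) * v c))" by simp
  also have "int p dvd \<dots>" using Av by (intro dvd_sum) auto
  finally show False using det by simp
qed

lemma dvd_add_iff_left: "(d::int) dvd a \<Longrightarrow> d dvd a + b \<longleftrightarrow> d dvd b"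
  by (simp add: dvd_add_right_iff)

lemma cyclic_columns_addrow:
  assumes A: "A \<in> carrier_mat N N" and ij: "i < N" "j < N" and k: "k < N"
    and cc: "cyclic_columns p N k A" and j: "\<And>c. c < k \<Longrightarrow> j \<noteq> Suc c mod N"
  shows "cyclic_columns p N k (addrow_mat N x i j * A)"
  unfolding cyclic_columns_def
proof (intro allI impI conjI)
  fix c assume c: "c < k"
  then have z: "int p dvd x * A $$ (j,c)" using cc j[OF c] ij by (auto simp: cyclic_columns_def)
  have idx: "(addrow_mat N x i j * A) $$ (r,c) = (if r = i then x * A $$ (j,c) + A $$ (i,c) else A $$ (r,c))" if "r < N" for r
    using c k that by (intro addrow_mat_mult_index[OF A ij]) auto
  have "Suc c mod N < N" using k by simp
  then show "\<not> int p dvd (addrow_mat N x i j * A) $$ (Suc c mod N, c)"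
    using cc c z by (auto simp: idx cyclic_columns_def dvd_add_iff_left)
  fix r assume r: "r < N" "r \<noteq> Suc c mod N"
  then show "int p dvd (addrow_mat N x i j * A) $$ (r,c)"
    using cc c z by (auto simp: idx cyclic_columns_def dvd_add_iff_left)
qed

text \<open>One row operation makes the pivot nonzero and \<open>N\<close> more clear the column; operations that add a row without a pivot of the earlier
  columns keep those columns.\<close>

lemma eliminate_column:
  assumes A: "A \<in> carrier_mat N N" and k: "k < N" and N: "N \<ge> 2" and p: "prime p"
    and det: "\<not> int p dvd Determinant.det A" and cc: "cyclic_columns p N k A"
  shows "\<exists>W\<in>elementary_products N (Suc N). cyclic_columns p N (Suc k) (W * A)"
proof -
  define s where "s = Suc k mod N"
  have s: "s < N" using N by (simp add: s_def)
  have sc: "s \<noteq> Suc c mod N" if "c < k" for c using Suc_mod_inj[of c N k] that k by (auto simp: s_def)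
  have "\<exists>V\<in>elementary_products N 1. cyclic_columns p N k (V * A) \<and> \<not> int p dvd (V * A) $$ (s,k)"
  proof (cases "int p dvd A $$ (s,k)")
    case False
    then show ?thesis using cc A one_in_elementary_products[OF N, of 1] by (intro bexI[of _ "1\<^sub>m N"]) auto
  next
    case True
    obtain r where r: "r < N" "\<And>c. c < k \<Longrightarrow> r \<noteq> Suc c mod N" "\<not> int p dvd A $$ (r,k)"
      using pivot_exists[OF A k p det cc] by blast
    then have "r \<noteq> s" using True by auto
    have "\<not> int p dvd (addrow_mat N 1 s r * A) $$ (s,k)"
      using addrow_mat_mult_index[OF A s r(1) s k, of 1] r True by (simp add: dvd_add_left_iff)
    moreover have "cyclic_columns p N k (addrow_mat N 1 s r * A)"
      by (rule cyclic_columns_addrow[OF A s r(1) k cc r(2)])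
    ultimately show ?thesis using addrow_mat_in_elementary_products[OF s r(1)] \<open>r \<noteq> s\<close> by blast
  qed
  then obtain V where V: "V \<in> elementary_products N 1" "cyclic_columns p N k (V * A)" "\<not> int p dvd (V * A) $$ (s,k)" by blast
  have "\<exists>W\<in>elementary_products N (Suc l). cyclic_columns p N k (W * A) \<and> \<not> int p dvd (W * A) $$ (s,k) \<and>
      (\<forall>r<l. r \<noteq> s \<longrightarrow> int p dvd (W * A) $$ (r,k))" if "l \<le> N" for l
    using that
  proof (induction l)
    case 0
    then show ?case using V by auto
  next
    case (Suc l)
    then obtain W where W: "W \<in> elementary_products N (Suc l)" "cyclic_columns p N k (W * A)"
      "\<not> int p dvd (W * A) $$ (s,k)" "\<And>r. r < l \<Longrightarrow> r \<noteq> s \<Longrightarrow> int p dvd (W * A) $$ (r,k)" by auto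
    have Wc: "W \<in> carrier_mat N N" using W(1) by (rule elementary_products_carrier)
    have WA: "W * A \<in> carrier_mat N N" using Wc A by (rule mult_carrier_mat)
    have l: "l < N" using Suc.prems by simp
    show ?case
    proof (cases "l = s")
      case True
      have "W * 1\<^sub>m N \<in> elementary_products N (Suc l + 1)"
        by (rule elementary_products_mult[OF W(1) one_in_elementary_products[OF N]])
      then have "W \<in> elementary_products N (Suc (Suc l))" using Wc by simp
      then show ?thesis using W True less_Suc_eq by (intro bexI[of _ W]) auto
    next
      case False
      obtain y where y: "int p dvd (W * A) $$ (s,k) * y - 1" using ex_inverse_mod_prime[OF p W(3)] by blast
      define x where "x = - ((W * A) $$ (l,k) * y)"
      define U where "U = addrow_mat N x l s"
      have UW: "U * W \<in> elementary_products N (1 + Suc l)"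
        unfolding U_def using addrow_mat_in_elementary_products[OF l s False] W(1) by (rule elementary_products_mult)
      have as: "(U * W) * A = addrow_mat N x l s * (W * A)"
        unfolding U_def using Wc A by (intro assoc_mult_mat) auto
      have idx: "((U * W) * A) $$ (r,k) = (if r = l then x * (W * A) $$ (s,k) + (W * A) $$ (l,k) else (W * A) $$ (r,k))"
        if "r < N" for r unfolding as by (rule addrow_mat_mult_index[OF WA l s that k])
      have "x * (W * A) $$ (s,k) + (W * A) $$ (l,k) = (W * A) $$ (l,k) * (- ((W * A) $$ (s,k) * y - 1))"
        by (simp add: x_def algebra_simps)
      also have "int p dvd \<dots>" using y by (intro dvd_mult) (simp only: dvd_minus_iff)
      finally have "int p dvd ((U * W) * A) $$ (r,k)" if "r < Suc l" "r \<noteq> s" for r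
        using idx[of r] W(4)[of r] that l by (auto simp: less_Suc_eq)
      moreover have "\<not> int p dvd ((U * W) * A) $$ (s,k)" using idx[OF s] False W(3) by auto
      moreover have "cyclic_columns p N k ((U * W) * A)"
        unfolding as by (rule cyclic_columns_addrow[OF WA l s k W(2) sc])
      ultimately show ?thesis using UW by (intro bexI[of _ "U * W"]) auto
    qed
  qed
  from this[of N] obtain W where W: "W \<in> elementary_products N (Suc N)" "cyclic_columns p N k (W * A)"
    "\<not> int p dvd (W * A) $$ (s,k)" "\<And>r. r < N \<Longrightarrow> r \<noteq> s \<Longrightarrow> int p dvd (W * A) $$ (r,k)" by auto
  then have "cyclic_columns p N (Suc k) (W * A)"
    unfolding cyclic_columns_def s_def using less_Suc_eq by auto
  then show ?thesis using W(1) by blast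
qed

text \<open>Modulo \<open>p\<close>, the matrix maps each basis vector to a nonzero multiple of the next one, so the Krylov vectors form a diagonal
  matrix.\<close>

lemma cyclic_columns_krylov:
  assumes A: "A \<in> carrier_mat N N" and N: "N \<ge> 2" and p: "prime p" and cc: "cyclic_columns p N N A"
  shows "\<not> int p dvd krylov_det N A"
proof -
  have pi: "prime (int p)" using p by simp
  have Ak: "A ^\<^sub>m k \<in> carrier_mat N N" for k using A by (rule pow_carrier_mat)
  have comm: "A ^\<^sub>m k * A = A * A ^\<^sub>m k" for k
  proof (induction k)
    case 0
    then show ?case using A by simp
  next
    case (Suc k)
    have "A ^\<^sub>m Suc k * A = (A * A ^\<^sub>m k) * A" using Suc by simp
    also have "\<dots> = A * (A ^\<^sub>m k * A)" by (rule assoc_mult_mat[OF A Ak A])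
    finally show ?case by simp
  qed
  have col: "(\<not> int p dvd (A ^\<^sub>m k) $$ (k,0)) \<and> (\<forall>r<N. r \<noteq> k \<longrightarrow> int p dvd (A ^\<^sub>m k) $$ (r,0))" if "k < N" for k
    using that
  proof (induction k)
    case 0
    then show ?case using A pi by (auto simp: prime_int_iff)
  next
    case (Suc k)
    have N0: "0 < N" "k < N" using Suc.prems by auto
    have e: "(A ^\<^sub>m Suc k) $$ (r,0) = (\<Sum>l<N. A $$ (r,l) * (A ^\<^sub>m k) $$ (l,0))" if "r < N" for r
      using mat_mult_index[OF A Ak that N0(1)] comm by simp
    have e2: "\<exists>z. int p dvd z \<and> (A ^\<^sub>m Suc k) $$ (r,0) = A $$ (r,k) * (A ^\<^sub>m k) $$ (k,0) + z" if "r < N" for r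
    proof (intro exI conjI)
      show "(A ^\<^sub>m Suc k) $$ (r,0) = A $$ (r,k) * (A ^\<^sub>m k) $$ (k,0) +
          (\<Sum>l\<in>{..<N} - {k}. A $$ (r,l) * (A ^\<^sub>m k) $$ (l,0))"
        unfolding e[OF that] using N0 by (intro sum.remove) auto
      show "int p dvd (\<Sum>l\<in>{..<N} - {k}. A $$ (r,l) * (A ^\<^sub>m k) $$ (l,0))"
        using Suc N0 by (intro dvd_sum dvd_mult) auto
    qed
    have IH: "\<not> int p dvd (A ^\<^sub>m k) $$ (k,0)" using Suc by simp
    have c: "\<not> int p dvd A $$ (Suc k, k)" "\<And>r. r < N \<Longrightarrow> r \<noteq> Suc k \<Longrightarrow> int p dvd A $$ (r,k)"
      using cc[unfolded cyclic_columns_def, rule_format, of k] N0 Suc.prems by auto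
    show ?case
    proof (intro conjI allI impI)
      obtain z where z: "int p dvd z" "(A ^\<^sub>m Suc k) $$ (Suc k,0) = A $$ (Suc k,k) * (A ^\<^sub>m k) $$ (k,0) + z"
        using e2[OF Suc.prems] by blast
      then show "\<not> int p dvd (A ^\<^sub>m Suc k) $$ (Suc k,0)"
        using c(1) IH pi unfolding z(2) by (simp add: dvd_add_left_iff prime_dvd_mult_iff)
      fix r assume r: "r < N" "r \<noteq> Suc k"
      obtain z where "int p dvd z" "(A ^\<^sub>m Suc k) $$ (r,0) = A $$ (r,k) * (A ^\<^sub>m k) $$ (k,0) + z"
        using e2[OF r(1)] by blast
      then show "int p dvd (A ^\<^sub>m Suc k) $$ (r,0)" using c(2)[OF r] by simp
    qed
  qed
  define D where "D = mat N N (\<lambda>(i,j). if i = j then (A ^\<^sub>m j) $$ (j,0) else 0)"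
  have D: "D \<in> carrier_mat N N" by (simp add: D_def)
  have "cong_mat N (int p) (mat N N (\<lambda>(i,k). (A ^\<^sub>m k) $$ (i,0))) D"
    using col by (auto simp: cong_mat_def D_def)
  from cong_mat_det[OF this] have d: "int p dvd krylov_det N A - Determinant.det D" by (simp add: krylov_det_def)
  have "upper_triangular D" by (auto simp: D_def)
  then have "Determinant.det D = prod_list (diag_mat D)" by (rule det_upper_triangular[OF _ D])
  also have "\<dots> = (\<Prod>k<N. (A ^\<^sub>m k) $$ (k,0))"
    by (subst prod_list_diag_prod) (auto simp: D_def lessThan_atLeast0 intro!: prod.cong)
  finally have "\<not> int p dvd Determinant.det D" using col pi by (simp add: prime_dvd_prod_iff)
  then show ?thesis using d by (metis diff_diff_eq2 diff_add_cancel dvd_diff dvd_diff_commute add_diff_cancel_left')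
qed

lemma all_reach_cyclic:
  assumes A: "A \<in> carrier_mat N N" and N: "N \<ge> 2" and p: "prime p"
    and det: "\<not> int p dvd Determinant.det A"
  shows "reaches_cyclic p N (N * Suc N) A"
proof -
  have "\<exists>W\<in>elementary_products N (k * Suc N). cyclic_columns p N k (W * A)" if "k \<le> N" for k
    using that
  proof (induction k)
    case 0
    then show ?case by (auto simp: cyclic_columns_def)
  next
    case (Suc k)
    then obtain W where W: "W \<in> elementary_products N (k * Suc N)" "cyclic_columns p N k (W * A)" by auto
    have Wc: "W \<in> carrier_mat N N" using W(1) by (rule elementary_products_carrier)
    have WA: "W * A \<in> carrier_mat N N" using Wc A by (rule mult_carrier_mat)
    have "\<not> int p dvd Determinant.det (W * A)"
      using det det_mult[OF Wc A] elementary_products_det[OF W(1)] by simp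
    then obtain V where V: "V \<in> elementary_products N (Suc N)" "cyclic_columns p N (Suc k) (V * (W * A))"
      using eliminate_column[OF WA _ N p _ W(2)] Suc.prems by auto
    have "V * (W * A) = (V * W) * A"
      using elementary_products_carrier[OF V(1)] Wc A by (intro assoc_mult_mat[symmetric])
    moreover have "Suc N + k * Suc N = Suc k * Suc N" by simp
    then have "V * W \<in> elementary_products N (Suc k * Suc N)"
      using elementary_products_mult[OF V(1) W(1)] by (simp only:)
    ultimately show ?case using V(2) by (intro bexI[of _ "V * W"]) (simp_all only:)
  qed
  from this[of N] obtain W where W: "W \<in> elementary_products N (N * Suc N)" "cyclic_columns p N N (W * A)" by auto
  have WA: "W * A \<in> carrier_mat N N" using elementary_products_carrier[OF W(1)] A by (rule mult_carrier_mat)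
  show ?thesis unfolding reaches_cyclic_def using cyclic_columns_krylov[OF WA N p W(2)] W(1) by blast
qed

text \<open>Of the matrices that need \<open>k + 1\<close> row operations to reach one with a cyclic first basis vector, each lies on one of at
  most \<open>N\<^sup>2\<close> lines of row operations on which all but \<open>N\<^sup>2\<close> points need only \<open>k\<close>. As the row operations permute \<open>Y\<close>, such matrices have a
  proportion of at most \<open>N\<^sup>4 / p\<close>. By \<open>all_reach_cyclic\<close>, no more than \<open>N (N + 1)\<close> operations are needed.\<close>

lemma card_not_cyclic:
  fixes Y :: "int mat set" and act :: "nat \<Rightarrow> nat \<Rightarrow> int \<Rightarrow> int mat \<Rightarrow> int mat"
  assumes N: "N \<ge> 2" and p: "prime p" and Y: "finite Y" "\<And>h. h \<in> Y \<Longrightarrow> h \<in> carrier_mat N N"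
    "\<And>h. h \<in> Y \<Longrightarrow> \<not> int p dvd Determinant.det h"
    and act: "\<And>i j x. i < N \<Longrightarrow> j < N \<Longrightarrow> i \<noteq> j \<Longrightarrow> x \<in> {0..<int p} \<Longrightarrow> bij_betw (act i j x) Y Y"
    "\<And>i j x h. i < N \<Longrightarrow> j < N \<Longrightarrow> i \<noteq> j \<Longrightarrow> x \<in> {0..<int p} \<Longrightarrow> h \<in> Y \<Longrightarrow>
       cong_mat N (int p) (act i j x h) (addrow_mat N x i j * h)"
  shows "p * card {h\<in>Y. int p dvd krylov_det N h} \<le> (N * Suc N) * (N * N) * (N * N) * card Y"
proof -
  have N0: "N > 0" using N by simp
  define B where "B k = {h\<in>Y. \<not> reaches_cyclic p N k h}" for k
  define T where "T k i j = {h \<in> B k. \<exists>x. reaches_cyclic p N k (addrow_mat N x i j * h)}" for k i j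
  have finB: "finite (B k)" for k using Y(1) by (simp add: B_def)
  have TY: "T k i j \<subseteq> Y" for k i j by (auto simp: T_def B_def)
  have cT: "p * card (T k i j) \<le> N * N * card Y" if ij: "i < N" "j < N" "i \<noteq> j" for k i j
  proof -
    define J where "J = {0..<int p}"
    have pre: "card {h\<in>Y. act i j x h \<in> T k i j} = card (T k i j)" if x: "x \<in> J" for x
    proof -
      have b: "bij_betw (act i j x) Y Y" using act(1)[OF ij] x by (simp add: J_def)
      have "act i j x ` {h\<in>Y. act i j x h \<in> T k i j} = T k i j"
      proof (intro equalityI subsetI)
        fix t assume t: "t \<in> T k i j"
        then obtain h where "h \<in> Y" "t = act i j x h"
          using bij_betw_imp_surj_on[OF b] TY[of k i j] by blast
        then show "t \<in> act i j x ` {h\<in>Y. act i j x h \<in> T k i j}" using t by blast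
      qed blast
      moreover have "inj_on (act i j x) {h\<in>Y. act i j x h \<in> T k i j}"
        using b by (auto simp: bij_betw_def inj_on_def)
      ultimately show ?thesis
        using card_image[of "act i j x" "{h\<in>Y. act i j x h \<in> T k i j}"] by simp
    qed
    have line: "card {x\<in>J. act i j x h \<in> T k i j} \<le> N * N" if h: "h \<in> Y" for h
    proof (cases "\<exists>x\<in>J. act i j x h \<in> T k i j")
      case False
      then have "{x\<in>J. act i j x h \<in> T k i j} = {}" by auto
      then show ?thesis by (metis card.empty zero_le)
    next
      case True
      note hc = Y(2)[OF h]
      have cong: "cong_mat N (int p) (act i j x h) (addrow_mat N x i j * h)" if "x \<in> J" for x
        using act(2)[OF ij _ h] that by (simp add: J_def)
      obtain x1 where x1: "x1 \<in> J" "act i j x1 h \<in> T k i j" using True by blast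
      then obtain x2 where x2: "reaches_cyclic p N k (addrow_mat N x2 i j * act i j x1 h)" by (auto simp: T_def)
      have "cong_mat N (int p) (addrow_mat N x2 i j * act i j x1 h) (addrow_mat N x2 i j * (addrow_mat N x1 i j * h))"
        using cong[OF x1(1)] by (intro cong_mat_mult cong_mat_refl) auto
      then have "reaches_cyclic p N k (addrow_mat N x2 i j * (addrow_mat N x1 i j * h))"
        using x2 reaches_cyclic_cong N0 by blast
      moreover have "addrow_mat N x2 i j * (addrow_mat N x1 i j * h) = addrow_mat N (x2 + x1) i j * h"
      proof (rule eq_matI)
        have c1: "addrow_mat N x1 i j * h \<in> carrier_mat N N" using hc by (intro mult_carrier_mat) auto
        fix a b assume "a < dim_row (addrow_mat N (x2 + x1) i j * h)" "b < dim_col (addrow_mat N (x2 + x1) i j * h)"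
        then have ab: "a < N" "b < N" using hc by auto
        show "(addrow_mat N x2 i j * (addrow_mat N x1 i j * h)) $$ (a,b) = (addrow_mat N (x2 + x1) i j * h) $$ (a,b)"
          unfolding addrow_mat_mult_index[OF c1 ij(1,2) ab] addrow_mat_mult_index[OF hc ij(1,2) ij(2) ab(2)]
            addrow_mat_mult_index[OF hc ij(1,2) ij(1) ab(2)] addrow_mat_mult_index[OF hc ij(1,2) ab]
          using ij(3) by (simp add: algebra_simps)
      qed (use hc in auto)
      ultimately have "reaches_cyclic p N k (addrow_mat N (x2 + x1) i j * h)" by simp
      from card_line_not_reaching[OF hc ij(1,2) N0 p this]
      have "card {x\<in>J. \<not> reaches_cyclic p N k (addrow_mat N x i j * h)} \<le> N * N" by (simp add: J_def)
      moreover have "reaches_cyclic p N k (act i j x h) \<longleftrightarrow> reaches_cyclic p N k (addrow_mat N x i j * h)" if "x \<in> J" for x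
        by (rule reaches_cyclic_cong[OF cong[OF that] N0])
      then have "{x\<in>J. act i j x h \<in> T k i j} \<subseteq> {x\<in>J. \<not> reaches_cyclic p N k (addrow_mat N x i j * h)}"
        by (auto simp: T_def B_def)
      then have "card {x\<in>J. act i j x h \<in> T k i j} \<le> card {x\<in>J. \<not> reaches_cyclic p N k (addrow_mat N x i j * h)}"
        by (intro card_mono finite_subset[of "{x\<in>J. \<not> reaches_cyclic p N k (addrow_mat N x i j * h)}" J])
          (auto simp: J_def)
      ultimately show ?thesis by linarith
    qed
    have "p * card (T k i j) = (\<Sum>x\<in>J. card {h\<in>Y. act i j x h \<in> T k i j})" using pre by (simp add: J_def)
    also have "\<dots> = (\<Sum>h\<in>Y. card {x\<in>J. act i j x h \<in> T k i j})"
      by (rule sum_multicount_gen) (use Y in \<open>auto simp: J_def\<close>)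
    also have "\<dots> \<le> (\<Sum>h\<in>Y. N * N)" using line by (rule sum_mono)
    finally show ?thesis by (simp add: mult.commute)
  qed
  have step: "p * card (B k) \<le> p * card (B (Suc k)) + (N * N) * (N * N) * card Y" for k
  proof -
    define I where "I = {(i,j). i < N \<and> j < N \<and> i \<noteq> j}"
    have I: "I \<subseteq> {..<N} \<times> {..<N}" by (auto simp: I_def)
    then have finI: "finite I" by (rule finite_subset) auto
    have cI: "card I \<le> N * N" using card_mono[OF _ I] by simp
    have "B k \<subseteq> B (Suc k) \<union> (\<Union>(i,j)\<in>I. T k i j)"
      using reaches_cyclic_Suc Y(2) by (fastforce simp: B_def T_def I_def)
    then have "card (B k) \<le> card (B (Suc k) \<union> (\<Union>(i,j)\<in>I. T k i j))"
      using finB finI finite_subset[OF TY Y(1)] by (intro card_mono) auto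
    also have "\<dots> \<le> card (B (Suc k)) + card (\<Union>(i,j)\<in>I. T k i j)" by (rule card_Un_le)
    also have "card (\<Union>(i,j)\<in>I. T k i j) \<le> (\<Sum>(i,j)\<in>I. card (T k i j))"
      using card_UN_le[OF finI, of "\<lambda>(i,j). T k i j"] by (simp add: case_prod_unfold)
    finally have "p * card (B k) \<le> p * (card (B (Suc k)) + (\<Sum>(i,j)\<in>I. card (T k i j)))" by simp
    also have "\<dots> = p * card (B (Suc k)) + (\<Sum>(i,j)\<in>I. p * card (T k i j))"
      by (simp add: distrib_left sum_distrib_left case_prod_unfold)
    finally have "p * card (B k) \<le> p * card (B (Suc k)) + (\<Sum>(i,j)\<in>I. p * card (T k i j))" .
    moreover have "(\<Sum>(i,j)\<in>I. p * card (T k i j)) \<le> (\<Sum>(i,j)\<in>I. N * N * card Y)"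
      using cT by (intro sum_mono) (auto simp: I_def)
    moreover have "(\<Sum>(i,j)\<in>I. N * N * card Y) \<le> (N * N) * (N * N) * card Y"
      using cI by (simp add: case_prod_unfold)
    ultimately show ?thesis by linarith
  qed
  have "p * card (B 0) \<le> p * card (B k) + k * ((N * N) * (N * N) * card Y)" for k
  proof (induction k)
    case (Suc k)
    then show ?case using step[of k] by simp
  qed simp
  from this[of "N * Suc N"] have "p * card (B 0) \<le> p * card (B (N * Suc N)) + (N * Suc N) * ((N * N) * (N * N) * card Y)" .
  moreover have "B (N * Suc N) = {}" using all_reach_cyclic[OF Y(2) N p Y(3)] by (auto simp: B_def)
  moreover have "1\<^sub>m N * h = h" if "h \<in> Y" for h using Y(2)[OF that] by simp
  then have "B 0 = {h\<in>Y. int p dvd krylov_det N h}" by (auto simp: B_def reaches_cyclic_def)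
  ultimately show ?thesis by (simp add: mult.assoc)
qed

section \<open>Random words in a finite group\<close>

locale finite_group_words = group G for G (structure) +
  fixes S :: "'s set" and \<phi> :: "'s \<Rightarrow> 'a"
  assumes finite_carrier: "finite (carrier G)" and finite_S: "finite S" and S_nonempty: "S \<noteq> {}"
    and \<phi>_closed: "s \<in> S \<Longrightarrow> \<phi> s \<in> carrier G"
    and generates: "generate G (\<phi> ` S) = carrier G"
begin

definition "word_value ws = foldr (\<lambda>s x. \<phi> s \<otimes> x) ws \<one>"
definition "words L = {ws. set ws \<subseteq> S \<and> length ws = L}"
definition "values L = word_value ` words L"
definition "gorder = Coset.order G"

lemma word_value_simps [simp]: "word_value [] = \<one>" "word_value (s # ws) = \<phi> s \<otimes> word_value ws"
  by (simp_all add: word_value_def)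

lemma word_value_closed: "set ws \<subseteq> S \<Longrightarrow> word_value ws \<in> carrier G"
  by (induction ws) (auto intro: \<phi>_closed)

lemma word_value_append:
  "set vs \<subseteq> S \<Longrightarrow> set ws \<subseteq> S \<Longrightarrow> word_value (vs @ ws) = word_value vs \<otimes> word_value ws"
  by (induction vs) (auto simp: m_assoc \<phi>_closed word_value_closed)

lemma word_value_replicate: "s \<in> S \<Longrightarrow> word_value (replicate n s) = \<phi> s [^] n"
proof (induction n)
  case (Suc n)
  then show ?case using nat_pow_Suc2[OF \<phi>_closed[of s], of n] by (metis replicate_Suc word_value_simps(2))
qed simp

lemma finite_words [simp]: "finite (words L)"
  using finite_lists_length_eq[OF finite_S, of L] by (simp add: words_def)

lemma card_words: "card (words L) = card S ^ L"
  using card_lists_length_eq[OF finite_S, of L] by (simp add: words_def)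

lemma gorder_pos: "gorder > 0" unfolding gorder_def using finite_carrier by (simp add: order_gt_0_iff_finite)

lemma pow_gorder: "x \<in> carrier G \<Longrightarrow> x [^] gorder = \<one>"
  unfolding gorder_def by (rule pow_order_eq_1)

lemma inv_eq_pow: "x \<in> carrier G \<Longrightarrow> inv x = x [^] (gorder - 1)"
proof -
  assume x: "x \<in> carrier G"
  have "x [^] (gorder - 1) \<otimes> x = x [^] gorder" using x gorder_pos by (metis Suc_diff_1 nat_pow_Suc)
  then show ?thesis using x pow_gorder by (intro inv_equality) auto
qed

lemma values_closed: "values L \<subseteq> carrier G"
  by (auto simp: values_def words_def intro: word_value_closed)

lemma finite_values: "finite (values L)"
  using values_closed finite_carrier by (rule finite_subset)

lemma values_mult: "x \<in> values k \<Longrightarrow> y \<in> values l \<Longrightarrow> x \<otimes> y \<in> values (k + l)"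
proof -
  assume "x \<in> values k" "y \<in> values l"
  then obtain v w where "x = word_value v" "y = word_value w" "v \<in> words k" "w \<in> words l" by (auto simp: values_def)
  then show ?thesis unfolding values_def
    by (intro image_eqI[of _ _ "v @ w"]) (auto simp: words_def word_value_append)
qed

lemma letter_power_in_values: "s \<in> S \<Longrightarrow> \<phi> s [^] n \<in> values n"
  unfolding values_def
  by (intro image_eqI[of _ _ "replicate n s"]) (auto simp: words_def word_value_replicate)

lemma one_in_values: "\<one> \<in> values (k * gorder)"
proof -
  obtain s where s: "s \<in> S" using S_nonempty by blast
  have "\<phi> s [^] (gorder * k) = \<one>" using s \<phi>_closed pow_gorder by (simp add: nat_pow_pow[symmetric])
  then show ?thesis using letter_power_in_values[OF s, of "k * gorder"] by (simp add: mult.commute)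
qed

text \<open>Inserting a power \<open>s\<^bsup>|G|\<^esup> = 1\<close> of a letter shows that the sets of values of the words of length \<open>j |G|\<close> increase
  with \<open>j\<close>. They become stationary, and then closed under products and conjugation. All letters have the same
  class modulo the limit \<open>M\<close>, since \<open>s s\<^sub>0\<^bsup>|G| - 1\<^esup>\<close> is the value of a word of length \<open>|G|\<close>; so the quotient is
  cyclic.\<close>

lemma word_subgroup:
  obtains n M where "M = values n" "n > 0" "M \<lhd> G" "comm_group (G Mod M)"
proof -
  have "\<exists>k>0. \<forall>j\<ge>k. values (j * gorder) = values (k * gorder)"
  proof -
    define C where "C = (\<lambda>k. card (values (Suc k * gorder)))"
    have "C k \<le> card (carrier G)" for k
      unfolding C_def using values_closed finite_carrier by (intro card_mono)
    then obtain k where k: "\<And>j. C j \<le> C k"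
      using ex_has_greatest_nat[of "\<lambda>_. True" 0 C "Suc (card (carrier G))"] by (auto simp: less_Suc_eq_le)
    have "values (j * gorder) = values (Suc k * gorder)" if "j \<ge> Suc k" for j
    proof -
      obtain i where i: "j = Suc k + i" using le_Suc_ex[OF \<open>j \<ge> Suc k\<close>] by blast
      have "values (Suc k * gorder) \<subseteq> values (j * gorder)"
      proof
        fix x assume x: "x \<in> values (Suc k * gorder)"
        then have "x \<otimes> \<one> \<in> values (Suc k * gorder + i * gorder)" by (intro values_mult one_in_values)
        moreover have "Suc k * gorder + i * gorder = j * gorder" using i by (simp add: add_mult_distrib)
        moreover have "x \<in> carrier G" using x values_closed by blast
        ultimately show "x \<in> values (j * gorder)" by simp
      qed
      moreover have "card (values (j * gorder)) \<le> card (values (Suc k * gorder))"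
      proof -
        have "Suc (j - 1) = j" using \<open>j \<ge> Suc k\<close> by simp
        then show ?thesis using k[of "j - 1"] by (simp only: C_def)
      qed
      ultimately show ?thesis using finite_values card_seteq by metis
    qed
    then show ?thesis by blast
  qed
  then obtain k where k: "k > 0" "\<And>j. j \<ge> k \<Longrightarrow> values (j * gorder) = values (k * gorder)" by blast
  define n where "n = k * gorder"
  define M where "M = values n"
  have M_mult: "x \<otimes> y \<in> M" if "x \<in> M" "y \<in> M" for x y
  proof -
    have "x \<otimes> y \<in> values (n + n)" using that by (auto simp: M_def intro: values_mult)
    also have "n + n = (k + k) * gorder" by (simp add: n_def add_mult_distrib)
    finally show ?thesis using k(2)[of "k + k"] by (simp add: M_def n_def)
  qed
  have M_closed: "M \<subseteq> carrier G" unfolding M_def by (rule values_closed)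
  have M_one: "\<one> \<in> M" using one_in_values by (simp add: M_def n_def)
  have M_pow: "x [^] (i::nat) \<in> M" if "x \<in> M" for x i
    using that by (induction i) (auto intro: M_one M_mult)
  have M_inv: "inv x \<in> M" if "x \<in> M" for x
    using inv_eq_pow[of x] M_pow[OF that, of "gorder - 1"] that M_closed by auto
  have sub: "subgroup M G"
    using M_closed M_mult M_one M_inv by (intro subgroup.intro) auto
  \<comment> \<open>With \<open>s\<^sup>-\<^sup>1 = s\<^bsup>|G| - 1\<^esup>\<close>, the conjugate is the value of a word of length \<open>n + gorder\<close>.\<close>
  have conj_letter: "\<phi> s \<otimes> x \<otimes> inv (\<phi> s) \<in> M" if "s \<in> S" "x \<in> M" for s x
  proof -
    have "\<phi> s \<otimes> x \<otimes> inv (\<phi> s) = \<phi> s [^] (1::nat) \<otimes> x \<otimes> \<phi> s [^] (gorder - 1)"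
      using that \<phi>_closed inv_eq_pow by simp
    also have "\<dots> \<in> values (1 + n + (gorder - 1))"
      using that unfolding M_def by (intro values_mult letter_power_in_values)
    also have "1 + n + (gorder - 1) = Suc k * gorder" using gorder_pos by (simp add: n_def)
    finally show ?thesis using k(2)[of "Suc k"] by (simp add: M_def n_def)
  qed
  define Nor where "Nor = {g \<in> carrier G. \<forall>x\<in>M. g \<otimes> x \<otimes> inv g \<in> M}"
  have Nor_mult: "g \<otimes> h \<in> Nor" if gh: "g \<in> Nor" "h \<in> Nor" for g h
  proof -
    have c: "g \<in> carrier G" "h \<in> carrier G" using gh by (auto simp: Nor_def)
    have "g \<otimes> h \<otimes> x \<otimes> inv (g \<otimes> h) = g \<otimes> (h \<otimes> x \<otimes> inv h) \<otimes> inv g" if "x \<in> M" for x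
      using c that M_closed by (simp add: inv_mult_group m_assoc subset_iff)
    then show ?thesis using gh c by (auto simp: Nor_def)
  qed
  have Nor_one: "\<one> \<in> Nor" using M_closed by (auto simp: Nor_def)
  have Nor_pow: "g [^] (i::nat) \<in> Nor" if "g \<in> Nor" for g i
    by (induction i) (auto intro: Nor_one Nor_mult that)
  have Nor_inv: "inv g \<in> Nor" if "g \<in> Nor" for g
    using inv_eq_pow[of g] Nor_pow[OF that, of "gorder - 1"] that by (auto simp: Nor_def)
  have "carrier G \<subseteq> Nor"
  proof
    fix g assume "g \<in> carrier G"
    then have "g \<in> generate G (\<phi> ` S)" by (simp add: generates)
    then show "g \<in> Nor"
    proof (induction rule: generate.induct)
      case one
      show ?case by (rule Nor_one)
    next
      case (incl h)
      then show ?case using conj_letter \<phi>_closed by (auto simp: Nor_def)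
    next
      case (inv h)
      then have "h \<in> Nor" using conj_letter \<phi>_closed by (auto simp: Nor_def)
      then show ?case by (rule Nor_inv)
    next
      case (eng h1 h2)
      then show ?case by (intro Nor_mult)
    qed
  qed
  then have normal: "M \<lhd> G"
    using sub by (auto simp: normal_inv_iff Nor_def)
  interpret M: normal M G by (rule normal)
  interpret Q: group "G Mod M" by (rule M.factorgroup_is_group)
  have hom: "(\<lambda>a. M #> a) \<in> hom G (G Mod M)" by (rule M.r_coset_hom_Mod)
  obtain s0 where s0: "s0 \<in> S" using S_nonempty by blast
  define c where "c = M #> \<phi> s0"
  have cQ: "c \<in> carrier (G Mod M)"
    using hom s0 \<phi>_closed by (auto simp: c_def hom_def)
  have same: "M #> \<phi> s = c" if s: "s \<in> S" for s
  proof -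
    have "\<phi> s [^] (1::nat) \<otimes> \<phi> s0 [^] (gorder - 1) \<in> values (1 + (gorder - 1))"
      using s s0 by (intro values_mult letter_power_in_values)
    then have "\<phi> s \<otimes> inv (\<phi> s0) \<in> values (1 * gorder)"
      using s s0 \<phi>_closed inv_eq_pow gorder_pos by simp
    then have "(\<phi> s \<otimes> inv (\<phi> s0)) \<otimes> \<one> \<in> values (1 * gorder + (k - 1) * gorder)" by (intro values_mult one_in_values)
    also have "1 * gorder + (k - 1) * gorder = k * gorder" using k(1) by (cases k) auto
    finally have "\<phi> s \<otimes> inv (\<phi> s0) \<in> M" using s s0 \<phi>_closed by (simp add: M_def n_def)
    then show ?thesis unfolding c_def
      using s s0 \<phi>_closed M.subgroup_axioms
      by (metis coset_join2 coset_mult_assoc inv_closed inv_solve_right l_inv m_assoc m_closed r_one coset_mult_inv1 M_closed)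
  qed
  have powers: "\<exists>i::nat. M #> g = c [^]\<^bsub>G Mod M\<^esub> i" if "g \<in> carrier G" for g
  proof -
    have "g \<in> generate G (\<phi> ` S)" using that by (simp add: generates)
    then show ?thesis
    proof (induction rule: generate.induct)
      case one
      have "M #> \<one> = \<one>\<^bsub>G Mod M\<^esub>" using hom_one[OF hom] Q.is_group is_group by blast
      then show ?case by (intro exI[of _ 0]) simp
    next
      case (incl h)
      then have "M #> h = c" using same by auto
      then show ?case using Q.nat_pow_eone[OF cQ] by metis
    next
      case (inv h)
      then obtain s where s: "s \<in> S" "h = \<phi> s" by auto
      interpret hom: group_hom G "G Mod M" "\<lambda>a. M #> a"
        using hom by (intro group_hom.intro group_hom_axioms.intro is_group Q.is_group)
      have "M #> inv h = M #> (h [^] (gorder - 1))" using s \<phi>_closed inv_eq_pow by simp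
      also have "\<dots> = (M #> h) [^]\<^bsub>G Mod M\<^esub> (gorder - 1)" using s \<phi>_closed by (intro hom.hom_nat_pow) simp
      finally show ?case using s same by auto
    next
      case (eng h1 h2)
      then obtain i j :: nat where ij: "M #> h1 = c [^]\<^bsub>G Mod M\<^esub> i" "M #> h2 = c [^]\<^bsub>G Mod M\<^esub> j" by blast
      have "h1 \<in> carrier G" "h2 \<in> carrier G" using eng generates by auto
      then have "M #> (h1 \<otimes> h2) = (M #> h1) \<otimes>\<^bsub>G Mod M\<^esub> (M #> h2)" using hom by (simp add: hom_def)
      also have "\<dots> = c [^]\<^bsub>G Mod M\<^esub> (i + j)" unfolding ij using cQ by (rule Q.nat_pow_mult)
      finally show ?case by blast
    qed
  qed
  have "comm_group (G Mod M)"
  proof (rule Q.group_comm_groupI)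
    fix x y assume "x \<in> carrier (G Mod M)" "y \<in> carrier (G Mod M)"
    then obtain g h where gh: "g \<in> carrier G" "h \<in> carrier G" "x = M #> g" "y = M #> h"
      by (auto simp: FactGroup_def RCOSETS_def)
    obtain i j :: nat where "x = c [^]\<^bsub>G Mod M\<^esub> i" "y = c [^]\<^bsub>G Mod M\<^esub> j" using powers gh by metis
    then show "x \<otimes>\<^bsub>G Mod M\<^esub> y = y \<otimes>\<^bsub>G Mod M\<^esub> x"
      using Q.nat_pow_mult[OF cQ, of i j] Q.nat_pow_mult[OF cQ, of j i] by (metis add.commute)
  qed
  moreover have "n > 0" using k gorder_pos by (simp add: n_def)
  ultimately show ?thesis using that[of M n] normal M_def by blast
qed

text \<open>A block of \<open>n\<close> letters is uniform on \<open>M\<close> with some probability \<open>\<delta> > 0\<close> (one word is set aside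
  for each element of \<open>M\<close>). After many blocks, at least one of them is uniform outside an event of small probability,
  and then so is the whole product, on a coset of \<open>M\<close>.\<close>

lemma word_mixing:
  assumes M: "M = values n" "M \<lhd> G" and n: "n > 0"
    and u: "\<And>a. a \<in> carrier G \<Longrightarrow> real (card {t\<in>M. a \<otimes> t \<in> Q}) \<le> u * real (card M)"
    and \<epsilon>: "\<epsilon> > 0"
  shows "\<exists>L0. \<forall>L\<ge>L0. real (card {ws\<in>words L. word_value ws \<in> Q}) / real (card S) ^ L \<le> u + \<epsilon>"
proof -
  interpret M: normal M G by (rule M(2))
  have Mc: "M \<subseteq> carrier G" using M(1) values_closed by simp
  have finM: "finite M" using M(1) finite_values by simp
  have "M \<noteq> {}" using subgroup.one_closed[OF normal_imp_subgroup[OF M(2)]] by blast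
  then have cM: "card M > 0" using finM by (simp add: card_gt_0_iff)
  define s where "s = real (card S)"
  have s1: "s \<ge> 1" unfolding s_def using finite_S S_nonempty by (simp add: Suc_leI card_gt_0_iff)
  define f where "f L a = real (card {ws\<in>words L. a \<otimes> word_value ws \<in> Q}) / s ^ L" for L a
  have f01: "0 \<le> f L a" "f L a \<le> 1" for L a
  proof -
    have "card {ws\<in>words L. a \<otimes> word_value ws \<in> Q} \<le> card (words L)" by (intro card_mono) auto
    then have "real (card {ws\<in>words L. a \<otimes> word_value ws \<in> Q}) \<le> s ^ L"
      unfolding card_words s_def by (metis of_nat_le_iff of_nat_power)
    then show "0 \<le> f L a" "f L a \<le> 1" using s1 by (auto simp: f_def)
  qed
  define \<delta> where "\<delta> = real (card M) / s ^ n"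
  have "card M \<le> card (words n)" unfolding M(1) values_def by (rule card_image_le) simp
  then have "real (card M) \<le> s ^ n" unfolding card_words s_def by (metis of_nat_le_iff of_nat_power)
  then have \<delta>: "0 < \<delta>" "\<delta> \<le> 1" using s1 cM by (auto simp: \<delta>_def)
  have u0: "u \<ge> 0"
  proof -
    have "0 \<le> u * real (card M)" using u[OF one_closed] by (rule order.trans[rotated]) simp
    then show ?thesis using cM by (simp add: zero_le_mult_iff)
  qed
  \<comment> \<open>Averaging over \<open>M\<close> in front of a word is the same as averaging behind it, by normality.\<close>
  have avg: "(\<Sum>t\<in>M. f L (a \<otimes> t)) \<le> u * real (card M)" if a: "a \<in> carrier G" for L a
  proof -
    have "(\<Sum>t\<in>M. real (card {ws\<in>words L. (a \<otimes> t) \<otimes> word_value ws \<in> Q})) =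
        (\<Sum>ws\<in>words L. real (card {t\<in>M. (a \<otimes> t) \<otimes> word_value ws \<in> Q}))"
      unfolding of_nat_sum[symmetric] of_nat_eq_iff
      by (rule sum_multicount_gen) (use finM in auto)
    also have "\<dots> \<le> (\<Sum>ws\<in>words L. u * real (card M))"
    proof (rule sum_mono)
      fix ws assume "ws \<in> words L"
      then have g: "word_value ws \<in> carrier G" by (auto simp: words_def intro: word_value_closed)
      define g where "g = word_value ws"
      have gc: "g \<in> carrier G" using g by (simp add: g_def)
      have "(\<lambda>t. inv g \<otimes> t \<otimes> g) ` {t\<in>M. (a \<otimes> t) \<otimes> g \<in> Q} \<subseteq> {t\<in>M. (a \<otimes> g) \<otimes> t \<in> Q}"
      proof
        fix x assume "x \<in> (\<lambda>t. inv g \<otimes> t \<otimes> g) ` {t\<in>M. (a \<otimes> t) \<otimes> g \<in> Q}"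
        then obtain t where t: "t \<in> M" "(a \<otimes> t) \<otimes> g \<in> Q" "x = inv g \<otimes> t \<otimes> g" by auto
        have tc: "t \<in> carrier G" using t Mc by auto
        have "x \<in> M" using M.inv_op_closed1[OF gc t(1)] t(3) by simp
        moreover have "(a \<otimes> g) \<otimes> x = (a \<otimes> t) \<otimes> g"
        proof -
          have "g \<otimes> (inv g \<otimes> (t \<otimes> g)) = (g \<otimes> inv g) \<otimes> (t \<otimes> g)"
            using gc tc by (intro m_assoc[symmetric]) auto
          then show ?thesis unfolding t(3) using a gc tc by (simp add: m_assoc)
        qed
        ultimately show "x \<in> {t\<in>M. (a \<otimes> g) \<otimes> t \<in> Q}" using t by simp
      qed
      moreover have "inj_on (\<lambda>t. inv g \<otimes> t \<otimes> g) {t\<in>M. (a \<otimes> t) \<otimes> g \<in> Q}"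
        using gc Mc by (intro inj_onI) (auto simp: subset_iff)
      ultimately have "card {t\<in>M. (a \<otimes> t) \<otimes> g \<in> Q} \<le> card {t\<in>M. (a \<otimes> g) \<otimes> t \<in> Q}"
        using finM by (intro card_inj_on_le[of "\<lambda>t. inv g \<otimes> t \<otimes> g"]) auto
      also have "real \<dots> \<le> u * real (card M)" using u[of "a \<otimes> g"] a gc by simp
      finally show "real (card {t\<in>M. (a \<otimes> t) \<otimes> word_value ws \<in> Q}) \<le> u * real (card M)"
        by (simp add: g_def)
    qed
    also have "\<dots> = s ^ L * (u * real (card M))" by (simp add: card_words s_def)
    finally have "(\<Sum>t\<in>M. real (card {ws\<in>words L. (a \<otimes> t) \<otimes> word_value ws \<in> Q})) \<le> s ^ L * (u * real (card M))" .
    then have "(\<Sum>t\<in>M. real (card {ws\<in>words L. (a \<otimes> t) \<otimes> word_value ws \<in> Q})) / s ^ L \<le> u * real (card M)"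
      using s1 by (simp add: field_simps)
    then show ?thesis by (simp add: f_def sum_divide_distrib)
  qed
  have split: "f (n + L) a = (\<Sum>v\<in>words n. f L (a \<otimes> word_value v)) / s ^ n" if a: "a \<in> carrier G" for L a
  proof -
    have "card {ws\<in>words (n + L). a \<otimes> word_value ws \<in> Q} =
        card (SIGMA v:words n. {w\<in>words L. (a \<otimes> word_value v) \<otimes> word_value w \<in> Q})"
    proof (rule bij_betw_same_card[symmetric])
      show "bij_betw (\<lambda>(v, w). v @ w) (SIGMA v:words n. {w\<in>words L. (a \<otimes> word_value v) \<otimes> word_value w \<in> Q})
        {ws\<in>words (n + L). a \<otimes> word_value ws \<in> Q}"
      proof (rule bij_betw_byWitness[where f' = "\<lambda>ws. (take n ws, drop n ws)"])
        have assoc: "a \<otimes> word_value (v @ w) = (a \<otimes> word_value v) \<otimes> word_value w"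
          if "v \<in> words n" "w \<in> words L" for v w
          using that a by (simp add: words_def word_value_append word_value_closed m_assoc)
        show "(\<lambda>(v, w). v @ w) ` (SIGMA v:words n. {w\<in>words L. (a \<otimes> word_value v) \<otimes> word_value w \<in> Q}) \<subseteq>
            {ws\<in>words (n + L). a \<otimes> word_value ws \<in> Q}"
          using assoc by (auto simp: words_def)
        have tw: "take n ws \<in> words n" "drop n ws \<in> words L" if "ws \<in> words (n + L)" for ws
          using that by (auto simp: words_def dest: in_set_takeD in_set_dropD)
        show "(\<lambda>ws. (take n ws, drop n ws)) ` {ws\<in>words (n + L). a \<otimes> word_value ws \<in> Q} \<subseteq>
            (SIGMA v:words n. {w\<in>words L. (a \<otimes> word_value v) \<otimes> word_value w \<in> Q})"
        proof
          fix x assume "x \<in> (\<lambda>ws. (take n ws, drop n ws)) ` {ws\<in>words (n + L). a \<otimes> word_value ws \<in> Q}"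
          then obtain ws where ws: "ws \<in> words (n + L)" "a \<otimes> word_value ws \<in> Q" "x = (take n ws, drop n ws)" by auto
          then show "x \<in> (SIGMA v:words n. {w\<in>words L. (a \<otimes> word_value v) \<otimes> word_value w \<in> Q})"
            using tw[OF ws(1)] assoc[OF tw[OF ws(1)]] by simp
        qed
      qed (auto simp: words_def)
    qed
    also have "\<dots> = (\<Sum>v\<in>words n. card {w\<in>words L. (a \<otimes> word_value v) \<otimes> word_value w \<in> Q})"
      by (rule card_SigmaI) auto
    finally show ?thesis using s1
      by (simp add: f_def power_add sum_divide_distrib[symmetric] field_simps)
  qed
  have "\<exists>w. \<forall>t\<in>M. w t \<in> words n \<and> word_value (w t) = t"
  proof -
    have "\<forall>t\<in>M. \<exists>w. w \<in> words n \<and> word_value w = t" unfolding M(1) values_def by auto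
    then show ?thesis by (rule bchoice)
  qed
  then obtain w where w: "\<And>t. t \<in> M \<Longrightarrow> w t \<in> words n" "\<And>t. t \<in> M \<Longrightarrow> word_value (w t) = t" by blast
  have injw: "inj_on w M" using w(2) by (metis inj_onI)
  have main: "f (q * n + r) a \<le> (1 - \<delta>) ^ q + u" if "a \<in> carrier G" for q r a
    using that
  proof (induction q arbitrary: a)
    case 0
    then show ?case using f01(2)[of r a] u0 by simp
  next
    case (Suc q)
    define L where "L = q * n + r"
    have IH: "f L a \<le> (1 - \<delta>) ^ q + u" if "a \<in> carrier G" for a using Suc.IH[OF that] by (simp add: L_def)
    have wM: "w ` M \<subseteq> words n" using w(1) by auto
    have "(\<Sum>v\<in>words n. f L (a \<otimes> word_value v)) =
        (\<Sum>v\<in>w ` M. f L (a \<otimes> word_value v)) + (\<Sum>v\<in>words n - w ` M. f L (a \<otimes> word_value v))"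
      using wM by (simp add: sum.subset_diff[of "w ` M" "words n"] add.commute)
    also have "(\<Sum>v\<in>w ` M. f L (a \<otimes> word_value v)) = (\<Sum>t\<in>M. f L (a \<otimes> t))"
      using w(2) by (simp add: sum.reindex[OF injw])
    also have "\<dots> \<le> u * real (card M)" by (rule avg[OF Suc.prems])
    also have "(\<Sum>v\<in>words n - w ` M. f L (a \<otimes> word_value v)) \<le> (\<Sum>v\<in>words n - w ` M. (1 - \<delta>) ^ q + u)"
      using Suc.prems by (intro sum_mono IH m_closed word_value_closed) (auto simp: words_def)
    also have "\<dots> = real (card (words n - w ` M)) * ((1 - \<delta>) ^ q + u)" by simp
    also have "real (card (words n - w ` M)) = s ^ n - real (card M)"
      using wM finM card_mono[OF _ wM] by (simp add: card_Diff_subset card_image[OF injw] card_words s_def of_nat_diff)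
    finally have "(\<Sum>v\<in>words n. f L (a \<otimes> word_value v)) \<le>
        u * real (card M) + (s ^ n - real (card M)) * ((1 - \<delta>) ^ q + u)" by simp
    then have "f (n + L) a \<le> (u * real (card M) + (s ^ n - real (card M)) * ((1 - \<delta>) ^ q + u)) / s ^ n"
      unfolding split[OF Suc.prems] using s1 by (intro divide_right_mono) auto
    also have "\<dots> = u * \<delta> + (1 - \<delta>) * ((1 - \<delta>) ^ q + u)"
    proof -
      have "(u * m + (t - m) * y) / t = u * (m / t) + (1 - m / t) * y" if "t > 0" for t m y :: real
        using that by (simp add: field_simps)
      from this[of "s ^ n" "real (card M)"] show ?thesis using s1 unfolding \<delta>_def by simp
    qed
    also have "\<dots> = (1 - \<delta>) ^ Suc q + u" by (simp add: algebra_simps)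
    finally show ?case by (simp add: L_def add.assoc)
  qed
  have "(\<lambda>q. (1 - \<delta>) ^ q) \<longlonglongrightarrow> 0" using \<delta> by (intro LIMSEQ_realpow_zero) auto
  then have "eventually (\<lambda>q. (1 - \<delta>) ^ q < \<epsilon>) sequentially" using \<epsilon> by (intro order_tendstoD) auto
  then obtain q where q: "(1 - \<delta>) ^ q < \<epsilon>" by (auto simp: eventually_sequentially)
  show ?thesis
  proof (intro exI[of _ "q * n"] allI impI)
    fix L assume "L \<ge> q * n"
    then obtain r where r: "L = q * n + r" using le_Suc_ex by blast
    have "f L \<one> \<le> (1 - \<delta>) ^ q + u" unfolding r by (rule main) simp
    moreover have "{ws\<in>words L. \<one> \<otimes> word_value ws \<in> Q} = {ws\<in>words L. word_value ws \<in> Q}"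
      by (auto simp: words_def word_value_closed)
    ultimately show "real (card {ws\<in>words L. word_value ws \<in> Q}) / real (card S) ^ L \<le> u + \<epsilon>"
      using q by (simp add: f_def s_def)
  qed
qed

end

section \<open>The special linear group modulo an integer\<close>

definition reduce_mat :: "int \<Rightarrow> int mat \<Rightarrow> int mat" where
  "reduce_mat m A = map_mat (\<lambda>x. x mod m) A"

text \<open>The group \<open>SL(N, \<int>/m)\<close> on matrices with entries from \<open>0\<close> to \<open>m - 1\<close>. With the image of \<open>SL(N, \<int>)\<close> as carrier, reduction is
  surjective by definition.\<close>

definition SL_mod :: "nat \<Rightarrow> int \<Rightarrow> int mat monoid" where
  "SL_mod N m = \<lparr>carrier = reduce_mat m ` carrier (SL N),
     monoid.mult = (\<lambda>A B. reduce_mat m (A * B)), one = reduce_mat m (1\<^sub>m N)\<rparr>"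

lemma SL_simps [simp]:
  "A \<otimes>\<^bsub>SL N\<^esub> B = A * B" "\<one>\<^bsub>SL N\<^esub> = 1\<^sub>m N"
  "A \<in> carrier (SL N) \<longleftrightarrow> A \<in> carrier_mat N N \<and> Determinant.det A = 1"
  by (auto simp: SL_def)

lemma reduce_mat_carrier [simp]: "reduce_mat m A \<in> carrier_mat N N \<longleftrightarrow> A \<in> carrier_mat N N"
  by (simp add: reduce_mat_def)

lemma cong_reduce_mat: "A \<in> carrier_mat N N \<Longrightarrow> cong_mat N m (reduce_mat m A) A"
  by (auto simp: cong_mat_def reduce_mat_def mod_eq_dvd_iff[symmetric])

lemma reduce_mat_eq_iff:
  assumes "A \<in> carrier_mat N N" "B \<in> carrier_mat N N"
  shows "reduce_mat m A = reduce_mat m B \<longleftrightarrow> cong_mat N m A B"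
proof
  assume "reduce_mat m A = reduce_mat m B"
  then show "cong_mat N m A B"
    using cong_reduce_mat[OF assms(1), of m] cong_reduce_mat[OF assms(2), of m] cong_mat_sym cong_mat_trans by metis
next
  assume "cong_mat N m A B"
  then show "reduce_mat m A = reduce_mat m B"
    using assms by (intro eq_matI) (auto simp: reduce_mat_def cong_mat_def mod_eq_dvd_iff)
qed

lemma reduce_mat_mult:
  assumes "A \<in> carrier_mat N N" "B \<in> carrier_mat N N"
  shows "reduce_mat m (reduce_mat m A * reduce_mat m B) = reduce_mat m (A * B)"
    and "reduce_mat m (reduce_mat m A * B) = reduce_mat m (A * B)"
    and "reduce_mat m (A * reduce_mat m B) = reduce_mat m (A * B)"
proof -
  have r: "reduce_mat m A \<in> carrier_mat N N" "reduce_mat m B \<in> carrier_mat N N" using assms by auto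
  have "reduce_mat m C = reduce_mat m (A * B)" if "cong_mat N m C (A * B)" for C
    using that by (subst reduce_mat_eq_iff[of _ N]) (auto simp: cong_mat_def)
  then show "reduce_mat m (reduce_mat m A * reduce_mat m B) = reduce_mat m (A * B)"
    "reduce_mat m (reduce_mat m A * B) = reduce_mat m (A * B)"
    "reduce_mat m (A * reduce_mat m B) = reduce_mat m (A * B)"
    using assms by (blast intro: cong_mat_mult cong_reduce_mat cong_mat_refl)+
qed

lemma SL_mod_simps:
  "A \<otimes>\<^bsub>SL_mod N m\<^esub> B = reduce_mat m (A * B)" "\<one>\<^bsub>SL_mod N m\<^esub> = reduce_mat m (1\<^sub>m N)"
  "carrier (SL_mod N m) = reduce_mat m ` carrier (SL N)"
  by (auto simp: SL_mod_def)

lemma SL_mod_E: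
  assumes "h \<in> carrier (SL_mod N m)"
  obtains A where "A \<in> carrier (SL N)" "h = reduce_mat m A"
  using assms unfolding SL_mod_simps by blast

lemma group_SL_mod: "group (SL_mod N m)"
proof (rule groupI)
  show "\<one>\<^bsub>SL_mod N m\<^esub> \<in> carrier (SL_mod N m)"
    unfolding SL_mod_simps by (rule imageI) simp
  fix x assume "x \<in> carrier (SL_mod N m)"
  then obtain A where A: "A \<in> carrier (SL N)" "x = reduce_mat m A" by (rule SL_mod_E)
  then have Ac: "A \<in> carrier_mat N N" "Determinant.det A = 1" by auto
  show "\<one>\<^bsub>SL_mod N m\<^esub> \<otimes>\<^bsub>SL_mod N m\<^esub> x = x"
    unfolding SL_mod_simps A(2) using Ac by (simp add: reduce_mat_mult(1)[of _ N])
  interpret SL: group "SL N :: int mat monoid" by (rule group_SL)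
  have B: "inv\<^bsub>SL N\<^esub> A \<in> carrier (SL N)" "inv\<^bsub>SL N\<^esub> A * A = 1\<^sub>m N"
    using SL.inv_closed[OF A(1)] SL.l_inv[OF A(1)] by (simp_all only: SL_simps)
  then have Bc: "inv\<^bsub>SL N\<^esub> A \<in> carrier_mat N N" by auto
  have "reduce_mat m (inv\<^bsub>SL N\<^esub> A) \<otimes>\<^bsub>SL_mod N m\<^esub> x = \<one>\<^bsub>SL_mod N m\<^esub>"
    unfolding SL_mod_simps A(2) reduce_mat_mult(1)[OF Bc Ac(1)] B(2) ..
  then show "\<exists>y\<in>carrier (SL_mod N m). y \<otimes>\<^bsub>SL_mod N m\<^esub> x = \<one>\<^bsub>SL_mod N m\<^esub>"
    using B(1) unfolding SL_mod_simps(3) by blast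
  fix y assume "y \<in> carrier (SL_mod N m)"
  then obtain B where B: "B \<in> carrier (SL N)" "y = reduce_mat m B" by (rule SL_mod_E)
  then have Bc: "B \<in> carrier_mat N N" by auto
  have AB: "A * B \<in> carrier (SL N)" using SL.m_closed[OF A(1) B(1)] by simp
  have xy: "x \<otimes>\<^bsub>SL_mod N m\<^esub> y = reduce_mat m (A * B)"
    unfolding SL_mod_simps A(2) B(2) by (rule reduce_mat_mult(1)[OF Ac(1) Bc])
  then show "x \<otimes>\<^bsub>SL_mod N m\<^esub> y \<in> carrier (SL_mod N m)" using AB unfolding SL_mod_simps(3) by blast
  fix z assume "z \<in> carrier (SL_mod N m)"
  then obtain C where C: "C \<in> carrier (SL N)" "z = reduce_mat m C" by (rule SL_mod_E)
  then have Cc: "C \<in> carrier_mat N N" by auto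
  have "(x \<otimes>\<^bsub>SL_mod N m\<^esub> y) \<otimes>\<^bsub>SL_mod N m\<^esub> z = reduce_mat m ((A * B) * C)"
    unfolding xy C(2) unfolding SL_mod_simps using Ac Bc Cc by (intro reduce_mat_mult(1)) auto
  also have "(A * B) * C = A * (B * C)" using Ac Bc Cc by (intro assoc_mult_mat) auto
  also have "reduce_mat m (A * (B * C)) = x \<otimes>\<^bsub>SL_mod N m\<^esub> (y \<otimes>\<^bsub>SL_mod N m\<^esub> z)"
    unfolding A(2) B(2) C(2) SL_mod_simps reduce_mat_mult(1)[OF Bc Cc]
    using Ac Bc Cc by (intro reduce_mat_mult(1)[symmetric]) auto
  finally show "(x \<otimes>\<^bsub>SL_mod N m\<^esub> y) \<otimes>\<^bsub>SL_mod N m\<^esub> z = x \<otimes>\<^bsub>SL_mod N m\<^esub> (y \<otimes>\<^bsub>SL_mod N m\<^esub> z)" .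
qed

lemma reduce_mat_hom: "reduce_mat m \<in> hom (SL N) (SL_mod N m)"
  by (auto simp: hom_def SL_mod_simps reduce_mat_mult(1)[of _ N] intro!: imageI)

lemma finite_SL_mod:
  assumes "m > 0"
  shows "finite (carrier (SL_mod N m))"
proof (rule finite_subset)
  let ?F = "PiE ({..<N} \<times> {..<N}) (\<lambda>_. {0..<m})"
  show "carrier (SL_mod N m) \<subseteq> (\<lambda>f. mat N N f) ` ?F"
  proof
    fix h assume "h \<in> carrier (SL_mod N m)"
    then obtain A where A: "A \<in> carrier (SL N)" "h = reduce_mat m A" by (rule SL_mod_E)
    have "h = mat N N (restrict (\<lambda>ij. A $$ ij mod m) ({..<N} \<times> {..<N}))"
      using A by (intro eq_matI) (auto simp: reduce_mat_def)
    moreover have "restrict (\<lambda>ij. A $$ ij mod m) ({..<N} \<times> {..<N}) \<in> ?F" using assms by auto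
    ultimately show "h \<in> (\<lambda>f. mat N N f) ` ?F" by blast
  qed
  show "finite ((\<lambda>f. mat N N f) ` ?F)" by (intro finite_imageI finite_PiE) auto
qed

lemma addrow_mat_in_SL: "i \<noteq> j \<Longrightarrow> i < N \<Longrightarrow> j < N \<Longrightarrow> addrow_mat N x i j \<in> carrier (SL N)"
  by (simp add: det_addrow_mat)

lemma addrow_mat_add:
  assumes "i < N" "j < N" "i \<noteq> j"
  shows "addrow_mat N x i j * addrow_mat N y i j = addrow_mat N (x + y :: int) i j"
proof (rule eq_matI)
  fix a b assume "a < dim_row (addrow_mat N (x + y) i j)" "b < dim_col (addrow_mat N (x + y) i j)"
  then have ab: "a < N" "b < N" by auto
  show "(addrow_mat N x i j * addrow_mat N y i j) $$ (a,b) = addrow_mat N (x + y) i j $$ (a,b)"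
    unfolding addrow_mat_mult_index[OF addrow_mat_carrier assms(1,2) ab] using assms ab by auto
qed auto

text \<open>The Weyl element of the copy of \<open>SL\<^sub>2\<close> in rows \<open>i\<close> and \<open>j\<close>, written in two ways; it has order
  four.\<close>

lemma weyl_element:
  fixes i j N :: nat
  assumes ij: "i < N" "j < N" "i \<noteq> j"
  defines "a \<equiv> addrow_mat N (1::int) i j" and "b \<equiv> addrow_mat N (-1::int) j i"
  shows "a * (b * a) = b * (a * b)" "(a * (b * a)) * ((a * (b * a)) * ((a * (b * a)) * (a * (b * a)))) = 1\<^sub>m N"
proof -
  have ab: "a \<in> carrier_mat N N" "b \<in> carrier_mat N N" by (simp_all add: a_def b_def)
  define w where "w = a * (b * a)"
  have ba: "b * a \<in> carrier_mat N N" "a * b \<in> carrier_mat N N" using ab by auto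
  have w: "w \<in> carrier_mat N N" using ab by (auto simp: w_def)
  have a: "(a * A) $$ (r,c) = (if r = i then A $$ (j,c) + A $$ (i,c) else A $$ (r,c))"
    if "A \<in> carrier_mat N N" "r < N" "c < N" for A r c
    using addrow_mat_mult_index[OF that(1) ij(1,2) that(2,3), of 1] by (simp add: a_def)
  have b: "(b * A) $$ (r,c) = (if r = j then A $$ (j,c) - A $$ (i,c) else A $$ (r,c))"
    if "A \<in> carrier_mat N N" "r < N" "c < N" for A r c
    using addrow_mat_mult_index[OF that(1) ij(2,1) that(2,3), of "-1"] by (simp add: b_def)
  have wA: "(w * A) $$ (r,c) = (if r = i then A $$ (j,c) else if r = j then - A $$ (i,c) else A $$ (r,c))"
    if A: "A \<in> carrier_mat N N" and rc: "r < N" "c < N" for A r c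
  proof -
    have "w * A = a * (b * (a * A))"
      unfolding w_def using ab ba A by (simp add: assoc_mult_mat[of _ N N _ N _ N])
    moreover have "a * A \<in> carrier_mat N N" "b * (a * A) \<in> carrier_mat N N" using ab A by auto
    ultimately show ?thesis using A rc ij by (simp add: a b)
  qed
  have bab: "((b * (a * b)) * A) $$ (r,c) = (w * A) $$ (r,c)"
    if A: "A \<in> carrier_mat N N" and rc: "r < N" "c < N" for A r c
  proof -
    have "(b * (a * b)) * A = b * (a * (b * A))"
      using ab ba A by (simp add: assoc_mult_mat[of _ N N _ N _ N])
    moreover have "b * A \<in> carrier_mat N N" "a * (b * A) \<in> carrier_mat N N" using ab A by auto
    ultimately show ?thesis using A rc ij by (simp add: a b wA)
  qed
  have "(b * (a * b)) * 1\<^sub>m N = w * 1\<^sub>m N"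
    using bab[of "1\<^sub>m N"] ab w by (intro eq_matI) auto
  then show "a * (b * a) = b * (a * b)" using ab ba w unfolding w_def by auto
  have ww: "w * w \<in> carrier_mat N N" "w * (w * w) \<in> carrier_mat N N" using w by auto
  have "w * (w * (w * w)) = 1\<^sub>m N"
  proof -
    have "(w * (w * (w * (w * 1\<^sub>m N)))) $$ (r,c) = 1\<^sub>m N $$ (r,c)" if "r < N" "c < N" for r c
    proof -
      have "w * 1\<^sub>m N \<in> carrier_mat N N" "w * (w * 1\<^sub>m N) \<in> carrier_mat N N" "w * (w * (w * 1\<^sub>m N)) \<in> carrier_mat N N"
        using w by (auto intro!: mult_carrier_mat)
      then show ?thesis using that ij by (simp add: wA del: right_mult_one_mat)
    qed
    then have "w * (w * (w * (w * 1\<^sub>m N))) = 1\<^sub>m N"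
      using w by (intro eq_matI) (simp_all only: index_one_mat(2,3) index_mult_mat(2,3), auto)
    then show ?thesis using w by simp
  qed
  then show "(a * (b * a)) * ((a * (b * a)) * ((a * (b * a)) * (a * (b * a)))) = 1\<^sub>m N" by (simp add: w_def)
qed

text \<open>The number \<open>12\<close> is the order of the commutator quotient of \<open>SL(2, \<int>)\<close>; the commutator quotient modulo \<open>m\<close> is trivial
  for \<open>m\<close> coprime to it.\<close>

locale SL_words =
  fixes N :: nat and S :: "int mat set" and m :: int
  assumes N: "N \<ge> 2" and S: "finite S" "S \<subseteq> carrier (SL N)" "generate (SL N) S = carrier (SL N)"
    and m: "m > 1" "coprime 12 m"
begin

lemma S_nonempty': "S \<noteq> {}"
proof
  assume "S = {}"
  then have "carrier (SL N :: int mat monoid) = {\<one>\<^bsub>SL N\<^esub>}"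
    using group.generate_empty[OF group_SL] S(3) by metis
  moreover have "addrow_mat N 1 0 1 \<in> carrier (SL N :: int mat monoid)" using N by (intro addrow_mat_in_SL) auto
  ultimately have e: "addrow_mat N 1 0 1 = (1\<^sub>m N :: int mat)" by simp
  have "addrow_mat N 1 0 1 $$ (0,1) = (1::int)" "(1\<^sub>m N :: int mat) $$ (0,1) = 0" using N by auto
  then show False using e by simp
qed

sublocale finite_group_words "SL_mod N m" S "reduce_mat m"
proof -
  interpret G: group "SL_mod N m" by (rule group_SL_mod)
  interpret h: group_hom "SL N" "SL_mod N m" "reduce_mat m"
    by (intro group_hom.intro group_hom_axioms.intro group_SL group_SL_mod reduce_mat_hom)
  show "finite_group_words (SL_mod N m) S (reduce_mat m)"
  proof
    show "finite (carrier (SL_mod N m))" using m by (intro finite_SL_mod) auto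
    show "finite S" by (rule S(1))
    show "S \<noteq> {}" by (rule S_nonempty')
    show "reduce_mat m s \<in> carrier (SL_mod N m)" if "s \<in> S" for s
      using that S(2) unfolding SL_mod_simps by blast
    show "generate (SL_mod N m) (reduce_mat m ` S) = carrier (SL_mod N m)"
      using h.generate_img[OF S(2)] S(3) by (simp add: SL_mod_simps(3))
  qed
qed

lemma word_value_eq: "set ws \<subseteq> S \<Longrightarrow> word_value ws = reduce_mat m (word_product N ws) \<and> word_product N ws \<in> carrier (SL N)"
proof (induction ws)
  case Nil
  show ?case by (simp add: word_product_def SL_mod_simps)
next
  case (Cons s ws)
  interpret G: group "SL N :: int mat monoid" by (rule group_SL)
  have s: "s \<in> carrier (SL N)" using Cons.prems S(2) by auto
  have IH: "word_value ws = reduce_mat m (word_product N ws)" "word_product N ws \<in> carrier (SL N)" using Cons by auto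
  have e: "word_product N (s # ws) = s * word_product N ws" by (simp add: word_product_def)
  have "s * word_product N ws \<in> carrier (SL N)" using G.m_closed[OF s IH(2)] by simp
  moreover have "word_value (s # ws) = reduce_mat m (s * word_product N ws)"
    using s IH by (simp add: SL_mod_simps reduce_mat_mult(1)[of _ N])
  ultimately show ?case unfolding e by blast
qed

text \<open>In a commutative quotient, the two expressions for the Weyl element give the elementary matrices \<open>a\<close> and \<open>b\<close> the same
  class, and its order then gives the class an order dividing \<open>12\<close>. The order also divides \<open>m\<close>.\<close>

lemma elementary_in_normal:
  assumes M: "M \<lhd> SL_mod N m" and comm: "comm_group (SL_mod N m Mod M)"
    and ij: "i < N" "j < N" "i \<noteq> j"
  shows "reduce_mat m (addrow_mat N (int x) i j) \<in> M"
proof -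
  interpret M: normal M "SL_mod N m" by (rule M)
  interpret Q: comm_group "SL_mod N m Mod M" by (rule comm)
  let ?Q = "SL_mod N m Mod M"
  define h where "h A = M #>\<^bsub>SL_mod N m\<^esub> reduce_mat m A" for A
  have "(\<lambda>a. M #>\<^bsub>SL_mod N m\<^esub> a) \<circ> reduce_mat m \<in> hom (SL N) ?Q"
    by (rule Group.hom_compose[OF reduce_mat_hom M.r_coset_hom_Mod])
  then have hh: "h \<in> hom (SL N) ?Q" by (simp add: h_def[abs_def] comp_def)
  interpret h: group_hom "SL N" ?Q h
    using hh by (intro group_hom.intro group_hom_axioms.intro group_SL Q.is_group)
  have hm: "h (A * B) = h A \<otimes>\<^bsub>?Q\<^esub> h B" if "A \<in> carrier (SL N)" "B \<in> carrier (SL N)" for A B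
    using h.hom_mult[OF that] by simp
  have SLm: "A * B \<in> carrier (SL N)" if "A \<in> carrier (SL N)" "B \<in> carrier (SL N)" for A B :: "int mat"
    using group.subgroup_self[OF group_SL[of N], THEN subgroup.m_closed, OF that] by simp
  define a where "a = addrow_mat N (1::int) i j"
  define b where "b = addrow_mat N (-1::int) j i"
  have ab: "a \<in> carrier (SL N)" "b \<in> carrier (SL N)"
    unfolding a_def b_def using ij by (auto intro!: addrow_mat_in_SL simp del: SL_simps)
  note W = weyl_element[OF ij, folded a_def b_def]
  define \<alpha> where "\<alpha> = h a"
  define \<beta> where "\<beta> = h b"
  have c: "\<alpha> \<in> carrier ?Q" "\<beta> \<in> carrier ?Q" unfolding \<alpha>_def \<beta>_def using ab by auto
  have "h (a * (b * a)) = h (b * (a * b))" using W(1) by simp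
  then have "\<alpha> \<otimes>\<^bsub>?Q\<^esub> (\<beta> \<otimes>\<^bsub>?Q\<^esub> \<alpha>) = \<beta> \<otimes>\<^bsub>?Q\<^esub> (\<alpha> \<otimes>\<^bsub>?Q\<^esub> \<beta>)"
    using ab SLm by (simp only: hm \<alpha>_def \<beta>_def)
  then have "(\<alpha> \<otimes>\<^bsub>?Q\<^esub> \<beta>) \<otimes>\<^bsub>?Q\<^esub> \<alpha> = (\<alpha> \<otimes>\<^bsub>?Q\<^esub> \<beta>) \<otimes>\<^bsub>?Q\<^esub> \<beta>"
    using c by (simp add: Q.m_assoc Q.m_comm Q.m_lcomm del: mult_FactGroup)
  then have \<alpha>\<beta>: "\<beta> = \<alpha>" using c by (simp del: mult_FactGroup)
  have "h ((a * (b * a)) * ((a * (b * a)) * ((a * (b * a)) * (a * (b * a))))) = \<one>\<^bsub>?Q\<^esub>"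
    unfolding W(2) using h.hom_one by (simp del: one_FactGroup)
  then have "\<alpha> [^]\<^bsub>?Q\<^esub> (12::nat) = \<one>\<^bsub>?Q\<^esub>"
    using ab SLm c \<alpha>\<beta> by (simp add: hm \<alpha>_def[symmetric] \<beta>_def[symmetric] Q.m_assoc numeral_eq_Suc del: SL_simps(3) mult_FactGroup one_FactGroup)
  then have o12: "Q.ord \<alpha> dvd 12" using c Q.pow_eq_id by blast
  have pow: "h (addrow_mat N (int n) i j) = \<alpha> [^]\<^bsub>?Q\<^esub> n" for n
  proof (induction n)
    case 0
    then show ?case using h.hom_one by (simp add: addrow_mat_0)
  next
    case (Suc n)
    have "addrow_mat N (int (Suc n)) i j = addrow_mat N (int n) i j * a"
      unfolding a_def addrow_mat_add[OF ij] by (simp add: add.commute)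
    then have "h (addrow_mat N (int (Suc n)) i j) = h (addrow_mat N (int n) i j) \<otimes>\<^bsub>?Q\<^esub> h a"
      using ab ij by (simp only: hm[OF addrow_mat_in_SL[OF ij(3,1,2)] ab(1)])
    then show ?case using Suc by (simp add: \<alpha>_def)
  qed
  have "reduce_mat m (addrow_mat N m i j) = reduce_mat m (1\<^sub>m N)"
    using ij by (subst reduce_mat_eq_iff[of _ N]) (auto simp: cong_mat_def)
  then have "h (addrow_mat N (int (nat m)) i j) = h (1\<^sub>m N)" using m by (simp add: h_def)
  moreover have "h (1\<^sub>m N) = \<one>\<^bsub>?Q\<^esub>" using h.hom_one by (simp del: one_FactGroup)
  ultimately have "\<alpha> [^]\<^bsub>?Q\<^esub> (nat m) = \<one>\<^bsub>?Q\<^esub>" by (simp only: pow)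
  then have om: "Q.ord \<alpha> dvd nat m" using c Q.pow_eq_id by blast
  have "coprime (12::nat) (nat m)"
  proof -
    have "coprime (int 12) (int (nat m))" using m by simp
    then show ?thesis by (simp only: coprime_int_iff)
  qed
  then have "Q.ord \<alpha> = 1" using o12 om coprime_common_divisor_nat by blast
  then have "\<alpha> = \<one>\<^bsub>?Q\<^esub>" using c Q.ord_eq_1 by blast
  then have "h (addrow_mat N (int x) i j) = \<one>\<^bsub>?Q\<^esub>" by (simp only: pow Q.nat_pow_one)
  then have "M #>\<^bsub>SL_mod N m\<^esub> reduce_mat m (addrow_mat N (int x) i j) = M" by (simp add: h_def)
  moreover have "reduce_mat m (addrow_mat N (int x) i j) \<in> carrier (SL_mod N m)"
    using addrow_mat_in_SL[OF ij(3,1,2)] unfolding SL_mod_simps by blast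
  ultimately show ?thesis using group.rcos_self[OF group_SL_mod _ normal_imp_subgroup[OF M]] by blast
qed

lemma first_row_shear_in_normal:
  assumes M: "M \<lhd> SL_mod N m" and comm: "comm_group (SL_mod N m Mod M)"
    and v: "\<And>k. k \<in> {1..<N} \<Longrightarrow> 0 \<le> v k"
  shows "reduce_mat m (first_row_shear N v) \<in> M"
proof -
  interpret M: normal M "SL_mod N m" by (rule M)
  define s where "s K = mat N N (\<lambda>(i,j). if i = j then 1 else if i = 0 \<and> j \<in> K then v j else 0)" for K
  have sc: "s K \<in> carrier_mat N N" for K by (simp add: s_def)
  have "reduce_mat m (s K) \<in> M \<and> s K \<in> carrier (SL N)" if "finite K" "K \<subseteq> {1..<N}" for K
    using that
  proof (induction K rule: finite_induct)
    case empty
    have "s {} = 1\<^sub>m N" by (rule eq_matI) (auto simp: s_def)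
    then show ?case using subgroup.one_closed[OF normal_imp_subgroup[OF M]] by (simp add: SL_mod_simps)
  next
    case (insert k K)
    have k: "k < N" "k \<noteq> 0" "0 < N" using insert.prems N by auto
    define E where "E = addrow_mat N (v k) 0 k"
    have Ec: "E \<in> carrier (SL N)" unfolding E_def using k by (intro addrow_mat_in_SL) auto
    have e: "s (insert k K) = E * s K"
    proof (rule eq_matI)
      fix a b assume "a < dim_row (E * s K)" "b < dim_col (E * s K)"
      then have ab: "a < N" "b < N" by (auto simp: E_def s_def)
      show "s (insert k K) $$ (a,b) = (E * s K) $$ (a,b)"
        unfolding E_def addrow_mat_mult_index[OF sc k(3,1) ab]
        using ab k insert.hyps by (auto simp: s_def)
    qed (auto simp: E_def s_def)
    have IH: "reduce_mat m (s K) \<in> M" "s K \<in> carrier (SL N)" using insert by auto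
    have "reduce_mat m E \<in> M"
      using elementary_in_normal[OF M comm k(3,1) k(2)[symmetric], of "nat (v k)"] v[of k] insert.prems by (simp add: E_def)
    then have "reduce_mat m E \<otimes>\<^bsub>SL_mod N m\<^esub> reduce_mat m (s K) \<in> M"
      using IH subgroup.m_closed[OF normal_imp_subgroup[OF M]] by blast
    then have "reduce_mat m (E * s K) \<in> M"
      using Ec sc by (simp add: SL_mod_simps reduce_mat_mult(1)[of _ N])
    moreover have "E * s K \<in> carrier (SL N)"
      using group.subgroup_self[OF group_SL[of N], THEN subgroup.m_closed, OF Ec IH(2)] by simp
    ultimately show ?case unfolding e by blast
  qed
  from this[of "{1..<N}"] have r: "reduce_mat m (s {1..<N}) \<in> M" by auto
  have "s {1..<N} = first_row_shear N v" by (rule eq_matI) (auto simp: s_def first_row_shear_def)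
  then show ?thesis using r by simp
qed

end

section \<open>Random matrices modulo a product of primes\<close>

lemma cong_mat_dvd: "cong_mat N d A B \<Longrightarrow> d' dvd d \<Longrightarrow> cong_mat N d' A B"
  unfolding cong_mat_def by (meson dvd_trans)

lemma first_row_shear_cong:
  "(\<And>k. k \<in> {1..<N} \<Longrightarrow> d dvd v k - w k) \<Longrightarrow> cong_mat N d (first_row_shear N v) (first_row_shear N w)"
  by (auto simp: cong_mat_def first_row_shear_def)

context SL_words
begin

lemma reduced_matrix:
  assumes "h \<in> carrier (SL_mod N m)"
  shows "h \<in> carrier_mat N N" "m dvd Determinant.det h - 1"
proof -
  obtain A where A: "A \<in> carrier (SL N)" "h = reduce_mat m A" using assms by (rule SL_mod_E)
  then have Ac: "A \<in> carrier_mat N N" "Determinant.det A = 1" by auto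
  show "h \<in> carrier_mat N N" using A Ac by simp
  show "m dvd Determinant.det h - 1" using cong_mat_det[OF cong_reduce_mat[OF Ac(1), of m]] Ac(2) A(2) by simp
qed

text \<open>Row operations on row \<open>0\<close> with coefficients chosen
  independently modulo each prime stay in a coset of \<open>M\<close>. They make the characteristic polynomials modulo the primes independent and
  uniform, except at the few matrices without a cyclic first basis vector. So a property that holds with proportion at least
  \<open>\<kappa>\<close> modulo each prime rarely fails modulo all of them.\<close>

lemma card_all_primes_fail:
  fixes Pr :: "nat set" and Good :: "nat \<Rightarrow> int poly \<Rightarrow> bool" and \<kappa> :: real
  assumes Pr: "finite Pr" "\<And>p. p \<in> Pr \<Longrightarrow> prime p" and m_eq: "m = (\<Prod>p\<in>Pr. int p)"
    and M: "M \<lhd> SL_mod N m" and comm: "comm_group (SL_mod N m Mod M)"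
    and a: "a \<in> carrier (SL_mod N m)"
    and cong: "\<And>p f g. p \<in> Pr \<Longrightarrow> (\<And>k. int p dvd coeff f k - coeff g k) \<Longrightarrow> Good p g \<Longrightarrow> Good p f"
    and \<kappa>: "\<kappa> \<le> 1"
    and count: "\<And>p. p \<in> Pr \<Longrightarrow> \<kappa> * real p ^ (N - 1) \<le> real (card {c\<in>coeff_box p N. Good p (poly_with_coeffs N c)})"
  shows "real (card {t\<in>M. \<forall>p\<in>Pr. \<not> Good p (char_poly (a \<otimes>\<^bsub>SL_mod N m\<^esub> t))}) \<le>
    ((\<Sum>p\<in>Pr. real ((N * Suc N) * (N * N) * (N * N)) / real p) + (1 - \<kappa>) ^ card Pr) * real (card M)"
proof -
  let ?G = "SL_mod N m"
  let ?C = "(N * Suc N) * (N * N) * (N * N)"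
  interpret M: normal M ?G by (rule M)
  have Mc: "M \<subseteq> carrier ?G" by (rule M.subset)
  have finM: "finite M" using Mc finite_carrier by (rule finite_subset)
  have pm: "int p dvd m" if "p \<in> Pr" for p unfolding m_eq using that Pr(1) by auto
  define Y where "Y = (\<lambda>t. a \<otimes>\<^bsub>?G\<^esub> t) ` M"
  have injY: "inj_on (\<lambda>t. a \<otimes>\<^bsub>?G\<^esub> t) M" using a Mc by (intro inj_onI) (auto simp: subset_iff)
  have cY: "card Y = card M" unfolding Y_def by (rule card_image[OF injY])
  have finY: "finite Y" unfolding Y_def using finM by simp
  have YG: "h \<in> carrier ?G" if "h \<in> Y" for h using that a Mc by (auto simp: Y_def)
  have bij: "bij_betw (\<lambda>h. g \<otimes>\<^bsub>?G\<^esub> h) Y Y" if g: "g \<in> M" for g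
  proof -
    have gc: "g \<in> carrier ?G" using g Mc by auto
    have "(\<lambda>h. g \<otimes>\<^bsub>?G\<^esub> h) ` Y \<subseteq> Y"
    proof
      fix x assume "x \<in> (\<lambda>h. g \<otimes>\<^bsub>?G\<^esub> h) ` Y"
      then obtain t where t: "t \<in> M" "x = g \<otimes>\<^bsub>?G\<^esub> (a \<otimes>\<^bsub>?G\<^esub> t)" by (auto simp: Y_def)
      have tc: "t \<in> carrier ?G" using t Mc by auto
      define g' where "g' = inv\<^bsub>?G\<^esub> a \<otimes>\<^bsub>?G\<^esub> g \<otimes>\<^bsub>?G\<^esub> a"
      have g': "g' \<in> M" unfolding g'_def by (rule M.inv_op_closed1[OF a g])
      have g'c: "g' \<in> carrier ?G" using g' Mc by auto
      have "a \<otimes>\<^bsub>?G\<^esub> g' = (a \<otimes>\<^bsub>?G\<^esub> inv\<^bsub>?G\<^esub> a) \<otimes>\<^bsub>?G\<^esub> (g \<otimes>\<^bsub>?G\<^esub> a)"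
        unfolding g'_def using a gc by (simp only: m_assoc inv_closed m_closed)
      also have "\<dots> = g \<otimes>\<^bsub>?G\<^esub> a" using a gc by (simp only: r_inv l_one m_closed)
      finally have ag: "a \<otimes>\<^bsub>?G\<^esub> g' = g \<otimes>\<^bsub>?G\<^esub> a" .
      have "x = a \<otimes>\<^bsub>?G\<^esub> (g' \<otimes>\<^bsub>?G\<^esub> t)"
        unfolding t(2) using a gc tc g'c ag by (metis m_assoc)
      moreover have "g' \<otimes>\<^bsub>?G\<^esub> t \<in> M" using subgroup.m_closed[OF normal_imp_subgroup[OF M] g' t(1)] .
      ultimately show "x \<in> Y" by (auto simp: Y_def)
    qed
    moreover have "inj_on (\<lambda>h. g \<otimes>\<^bsub>?G\<^esub> h) Y" using gc YG by (intro inj_onI) (metis l_cancel)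
    ultimately show ?thesis using finY by (simp add: bij_betw_def endo_inj_surj)
  qed
  have detY: "\<not> int p dvd Determinant.det h" "int p dvd Determinant.det h - 1" if "h \<in> Y" "p \<in> Pr" for h p
  proof -
    show d: "int p dvd Determinant.det h - 1" using reduced_matrix(2)[OF YG[OF that(1)]] pm[OF that(2)] by (rule dvd_trans[rotated])
    show "\<not> int p dvd Determinant.det h"
    proof
      assume "int p dvd Determinant.det h"
      from dvd_diff[OF this d] have "int p dvd 1" by simp
      then show False using Pr(2)[OF that(2)] by (auto simp: prime_nat_iff)
    qed
  qed
  define NC where "NC = (\<Union>p\<in>Pr. {h\<in>Y. int p dvd krylov_det N h})"
  have NCp: "real (card {h\<in>Y. int p dvd krylov_det N h}) \<le> real ?C / real p * real (card Y)" if p: "p \<in> Pr" for p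
  proof -
    have "p * card {h\<in>Y. int p dvd krylov_det N h} \<le> ?C * card Y"
    proof (rule card_not_cyclic[OF N Pr(2)[OF p] finY, where act = "\<lambda>i j x h. reduce_mat m (addrow_mat N x i j) \<otimes>\<^bsub>?G\<^esub> h"])
      show "h \<in> carrier_mat N N" if "h \<in> Y" for h using reduced_matrix(1) YG that by blast
      show "\<not> int p dvd Determinant.det h" if "h \<in> Y" for h using detY(1)[OF that p] .
      fix i j x assume ij: "i < N" "j < N" "i \<noteq> j" and x: "x \<in> {0..<int p}"
      have "reduce_mat m (addrow_mat N (int (nat x)) i j) \<in> M"
        using elementary_in_normal[OF M comm ij] .
      then show "bij_betw ((\<otimes>\<^bsub>?G\<^esub>) (reduce_mat m (addrow_mat N x i j))) Y Y" using bij x by simp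
      fix h assume "h \<in> Y"
      then have hc: "h \<in> carrier_mat N N" using reduced_matrix(1) YG by blast
      have "cong_mat N m (reduce_mat m (reduce_mat m (addrow_mat N x i j) * h)) (addrow_mat N x i j * h)"
        unfolding reduce_mat_mult(2)[OF addrow_mat_carrier hc] using hc by (intro cong_reduce_mat mult_carrier_mat) auto
      then show "cong_mat N (int p) (reduce_mat m (addrow_mat N x i j) \<otimes>\<^bsub>?G\<^esub> h) (addrow_mat N x i j * h)"
        unfolding SL_mod_simps by (rule cong_mat_dvd[OF _ pm[OF p]])
    qed
    then have "real p * real (card {h\<in>Y. int p dvd krylov_det N h}) \<le> real ?C * real (card Y)"
      by (metis of_nat_le_iff of_nat_mult)
    moreover have "real p > 0" using Pr(2)[OF p] prime_gt_0_nat by simp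
    ultimately show ?thesis by (simp add: field_simps)
  qed
  have "real (card NC) \<le> (\<Sum>p\<in>Pr. real (card {h\<in>Y. int p dvd krylov_det N h}))"
    unfolding NC_def of_nat_sum[symmetric] of_nat_le_iff by (rule card_UN_le[OF Pr(1)])
  also have "\<dots> \<le> (\<Sum>p\<in>Pr. real ?C / real p * real (card Y))" by (rule sum_mono) (rule NCp)
  finally have cNC: "real (card NC) \<le> (\<Sum>p\<in>Pr. real ?C / real p) * real (card Y)" by (simp add: sum_distrib_right)
  define V where "V = PiE Pr (\<lambda>p. coeff_box p N)"
  \<comment> \<open>A multiple of all primes but \<open>p\<close>: the combination \<open>vec v\<close> below is \<open>v p\<close> modulo \<open>p\<close>, up to the unit \<open>mp p\<close>.\<close>
  define mp where "mp p = (\<Prod>q\<in>Pr - {p}. int q)" for p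
  have mp_nd: "\<not> int p dvd mp p" if p: "p \<in> Pr" for p
  proof
    assume "int p dvd mp p"
    then obtain q where q: "q \<in> Pr - {p}" "int p dvd int q"
      unfolding mp_def using Pr p by (subst (asm) prime_dvd_prod_iff) auto
    then have "p dvd q" by simp
    then show False using q(1) Pr(2) p primes_dvd_imp_eq by blast
  qed
  have mp_d: "int p dvd mp q" if "p \<in> Pr" "q \<noteq> p" for p q
    unfolding mp_def using that Pr(1) by (intro dvd_prodI) auto
  define vec where "vec v k = (\<Sum>p\<in>Pr. mp p * v p k)" for v :: "nat \<Rightarrow> nat \<Rightarrow> int" and k
  have vec_cong: "int p dvd vec v k - mp p * v p k" if p: "p \<in> Pr" for v k p
  proof -
    have "vec v k = mp p * v p k + (\<Sum>q\<in>Pr - {p}. mp q * v q k)"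
      unfolding vec_def using p Pr(1) by (rule sum.remove[rotated])
    then have "vec v k - mp p * v p k = (\<Sum>q\<in>Pr - {p}. mp q * v q k)" by simp
    also have "int p dvd \<dots>" using mp_d p by (intro dvd_sum dvd_mult2) auto
    finally show ?thesis .
  qed
  define g where "g v = reduce_mat m (first_row_shear N (vec v))" for v
  have gM: "g v \<in> M" if v: "v \<in> V" for v
    unfolding g_def
  proof (rule first_row_shear_in_normal[OF M comm])
    fix k assume k: "k \<in> {1..<N}"
    have "0 \<le> v p k" if "p \<in> Pr" for p using v that k unfolding V_def coeff_box_def by (auto simp: PiE_iff)
    then show "0 \<le> vec v k" unfolding vec_def mp_def by (intro sum_nonneg mult_nonneg_nonneg prod_nonneg) auto
  qed
  have finV: "finite V" unfolding V_def using Pr(1) by (intro finite_PiE) auto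
  have cV: "card V = (\<Prod>p\<in>Pr. p ^ (N - 1))" unfolding V_def using Pr(1) by (simp add: card_PiE card_coeff_box)
  have cV0: "card V > 0" unfolding cV using Pr(2) prime_gt_0_nat by (intro prod_pos) auto
  define Bad where "Bad = {h\<in>Y. \<forall>p\<in>Pr. \<not> Good p (char_poly h)}"
  have fib: "card {h\<in>Y. g v \<otimes>\<^bsub>?G\<^esub> h \<in> Bad} = card Bad" if v: "v \<in> V" for v
  proof -
    note b = bij[OF gM[OF v]]
    have "(\<otimes>\<^bsub>?G\<^esub>) (g v) ` {h\<in>Y. g v \<otimes>\<^bsub>?G\<^esub> h \<in> Bad} = Bad"
    proof (intro equalityI subsetI)
      fix y assume y: "y \<in> Bad"
      then have "y \<in> Y" by (simp add: Bad_def)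
      then obtain h where "h \<in> Y" "y = g v \<otimes>\<^bsub>?G\<^esub> h" using bij_betw_imp_surj_on[OF b] by blast
      then show "y \<in> (\<otimes>\<^bsub>?G\<^esub>) (g v) ` {h\<in>Y. g v \<otimes>\<^bsub>?G\<^esub> h \<in> Bad}" using y by blast
    qed blast
    moreover have "inj_on ((\<otimes>\<^bsub>?G\<^esub>) (g v)) {h\<in>Y. g v \<otimes>\<^bsub>?G\<^esub> h \<in> Bad}"
      using b by (auto simp: bij_betw_def inj_on_def)
    ultimately show ?thesis using card_image[of "(\<otimes>\<^bsub>?G\<^esub>) (g v)" "{h\<in>Y. g v \<otimes>\<^bsub>?G\<^esub> h \<in> Bad}"] by simp
  qed
  have cyclic_case: "real (card {v\<in>V. g v \<otimes>\<^bsub>?G\<^esub> h \<in> Bad}) \<le> (1 - \<kappa>) ^ card Pr * real (card V)"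
    if h: "h \<in> Y" "h \<notin> NC" for h
  proof -
    have hc: "h \<in> carrier_mat N N" using reduced_matrix(1) YG h by blast
    define W where "W p = {w\<in>coeff_box p N. \<not> Good p (char_poly (first_row_shear N (\<lambda>k. mp p * w k) * h))}" for p
    have finW: "finite (W p)" for p by (simp add: W_def)
    have "{v\<in>V. g v \<otimes>\<^bsub>?G\<^esub> h \<in> Bad} \<subseteq> PiE Pr W"
    proof
      fix v assume v: "v \<in> {v\<in>V. g v \<otimes>\<^bsub>?G\<^esub> h \<in> Bad}"
      have "v p \<in> W p" if p: "p \<in> Pr" for p
      proof -
        have box: "v p \<in> coeff_box p N" using v p by (auto simp: V_def)
        have "cong_mat N m (g v \<otimes>\<^bsub>?G\<^esub> h) (first_row_shear N (vec v) * h)"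
          unfolding SL_mod_simps g_def reduce_mat_mult(2)[OF first_row_shear_carrier hc]
          using hc by (intro cong_reduce_mat mult_carrier_mat) auto
        then have "cong_mat N (int p) (g v \<otimes>\<^bsub>?G\<^esub> h) (first_row_shear N (vec v) * h)"
          by (rule cong_mat_dvd[OF _ pm[OF p]])
        moreover have "cong_mat N (int p) (first_row_shear N (vec v) * h) (first_row_shear N (\<lambda>k. mp p * v p k) * h)"
          using vec_cong[OF p] hc by (intro cong_mat_mult first_row_shear_cong cong_mat_refl) auto
        ultimately have c: "cong_mat N (int p) (g v \<otimes>\<^bsub>?G\<^esub> h) (first_row_shear N (\<lambda>k. mp p * v p k) * h)"
          by (rule cong_mat_trans)
        have "\<not> Good p (char_poly (first_row_shear N (\<lambda>k. mp p * v p k) * h))"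
        proof
          assume "Good p (char_poly (first_row_shear N (\<lambda>k. mp p * v p k) * h))"
          then have "Good p (char_poly (g v \<otimes>\<^bsub>?G\<^esub> h))"
            by (rule cong[OF p, rotated]) (rule cong_mat_char_poly[OF c])
          then show False using v p by (auto simp: Bad_def)
        qed
        then show ?thesis using box by (simp add: W_def)
      qed
      then show "v \<in> PiE Pr W" using v by (auto simp: V_def PiE_iff)
    qed
    then have "card {v\<in>V. g v \<otimes>\<^bsub>?G\<^esub> h \<in> Bad} \<le> card (PiE Pr W)"
      using Pr(1) finW by (intro card_mono finite_PiE) auto
    then have "real (card {v\<in>V. g v \<otimes>\<^bsub>?G\<^esub> h \<in> Bad}) \<le> (\<Prod>p\<in>Pr. real (card (W p)))"
      using Pr(1) by (simp add: card_PiE flip: of_nat_prod)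
    also have "\<dots> \<le> (\<Prod>p\<in>Pr. (1 - \<kappa>) * real p ^ (N - 1))"
    proof (rule prod_mono)
      fix p assume p: "p \<in> Pr"
      have cyc: "\<not> int p dvd krylov_det N h" using h p by (auto simp: NC_def)
      have "card {w\<in>coeff_box p N. Good p (char_poly (first_row_shear N (\<lambda>k. mp p * w k) * h))} =
          card {c\<in>coeff_box p N. Good p (poly_with_coeffs N c)}"
      proof (rule char_poly_equidistributed[OF hc _ Pr(2)[OF p] cyc mp_nd[OF p] detY(2)[OF h(1) p]])
        show "N > 0" using N by simp
        show "Good p f" if "\<And>k. int p dvd coeff f k - coeff f' k" "Good p f'" for f f' by (rule cong[OF p that])
      qed
      then have "\<kappa> * real p ^ (N - 1) \<le> real (card {w\<in>coeff_box p N. Good p (char_poly (first_row_shear N (\<lambda>k. mp p * w k) * h))})"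
        using count[OF p] by simp
      moreover have "card (W p) + card {w\<in>coeff_box p N. Good p (char_poly (first_row_shear N (\<lambda>k. mp p * w k) * h))} = p ^ (N - 1)"
      proof -
        let ?G = "{w\<in>coeff_box p N. Good p (char_poly (first_row_shear N (\<lambda>k. mp p * w k) * h))}"
        have "W p \<union> ?G = coeff_box p N" "W p \<inter> ?G = {}" by (auto simp: W_def)
        moreover have "card (W p \<union> ?G) = card (W p) + card ?G" using calculation(2) finW by (intro card_Un_disjoint) auto
        ultimately show ?thesis by (simp only: card_coeff_box)
      qed
      then have "real (card (W p)) + real (card {w\<in>coeff_box p N. Good p (char_poly (first_row_shear N (\<lambda>k. mp p * w k) * h))}) = real p ^ (N - 1)"
        by (simp only: of_nat_add[symmetric] of_nat_power[symmetric])
      ultimately show "0 \<le> real (card (W p)) \<and> real (card (W p)) \<le> (1 - \<kappa>) * real p ^ (N - 1)"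
        by (simp add: algebra_simps)
    qed
    also have "\<dots> = (1 - \<kappa>) ^ card Pr * real (card V)" by (simp add: prod.distrib cV)
    finally show ?thesis .
  qed
  \<comment> \<open>Count the pairs \<open>(v, h)\<close> with \<open>g v h\<close> bad in two ways.\<close>
  have "real (card V) * real (card Bad) = (\<Sum>v\<in>V. real (card {h\<in>Y. g v \<otimes>\<^bsub>?G\<^esub> h \<in> Bad}))" using fib by simp
  also have "\<dots> = (\<Sum>h\<in>Y. real (card {v\<in>V. g v \<otimes>\<^bsub>?G\<^esub> h \<in> Bad}))"
    unfolding of_nat_sum[symmetric] of_nat_eq_iff by (rule sum_multicount_gen) (use finY finV in auto)
  also have "\<dots> \<le> (\<Sum>h\<in>Y. (if h \<in> NC then real (card V) else 0) + (1 - \<kappa>) ^ card Pr * real (card V))"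
  proof (rule sum_mono)
    fix h assume h: "h \<in> Y"
    show "real (card {v\<in>V. g v \<otimes>\<^bsub>?G\<^esub> h \<in> Bad}) \<le>
        (if h \<in> NC then real (card V) else 0) + (1 - \<kappa>) ^ card Pr * real (card V)"
    proof (cases "h \<in> NC")
      case True
      have "card {v\<in>V. g v \<otimes>\<^bsub>?G\<^esub> h \<in> Bad} \<le> card V" using finV by (intro card_mono) auto
      moreover have "0 \<le> (1 - \<kappa>) ^ card Pr * real (card V)" using \<kappa> by simp
      ultimately show ?thesis using True by simp
    next
      case False
      then show ?thesis using cyclic_case[OF h] by simp
    qed
  qed
  also have "\<dots> = real (card NC) * real (card V) + real (card Y) * ((1 - \<kappa>) ^ card Pr * real (card V))"
  proof -
    have "NC \<subseteq> Y" by (auto simp: NC_def)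
    then have "Y \<inter> {h. h \<in> NC} = NC" by auto
    then show ?thesis using finY by (simp add: sum.distrib sum.If_cases)
  qed
  also have "\<dots> \<le> (\<Sum>p\<in>Pr. real ?C / real p) * real (card Y) * real (card V) + real (card Y) * ((1 - \<kappa>) ^ card Pr * real (card V))"
    using cNC by (intro add_right_mono mult_right_mono) auto
  also have "\<dots> = real (card V) * (((\<Sum>p\<in>Pr. real ?C / real p) + (1 - \<kappa>) ^ card Pr) * real (card M))"
    by (simp add: cY algebra_simps)
  finally have "real (card Bad) \<le> ((\<Sum>p\<in>Pr. real ?C / real p) + (1 - \<kappa>) ^ card Pr) * real (card M)"
    using cV0 by simp
  moreover have "card {t\<in>M. \<forall>p\<in>Pr. \<not> Good p (char_poly (a \<otimes>\<^bsub>?G\<^esub> t))} = card Bad"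
  proof -
    have "(\<lambda>t. a \<otimes>\<^bsub>?G\<^esub> t) ` {t\<in>M. \<forall>p\<in>Pr. \<not> Good p (char_poly (a \<otimes>\<^bsub>?G\<^esub> t))} = Bad"
      by (auto simp: Bad_def Y_def)
    moreover have "inj_on (\<lambda>t. a \<otimes>\<^bsub>?G\<^esub> t) {t\<in>M. \<forall>p\<in>Pr. \<not> Good p (char_poly (a \<otimes>\<^bsub>?G\<^esub> t))}"
      using injY by (auto simp: inj_on_def)
    ultimately show ?thesis using card_image by fastforce
  qed
  ultimately show ?thesis by simp
qed

end

section \<open>Galois groups of random words\<close>

lemma replicate_pmf_of_set:
  assumes "finite S" "S \<noteq> {}"
  shows "replicate_pmf L (pmf_of_set S) = pmf_of_set {ws. set ws \<subseteq> S \<and> length ws = L}"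
proof -
  have fin: "finite {ws. set ws \<subseteq> S \<and> length ws = L}" for L
    using finite_lists_length_eq[OF assms(1)] by simp
  have ne: "{ws. set ws \<subseteq> S \<and> length ws = L} \<noteq> {}" for L
  proof -
    obtain s where "s \<in> S" using assms(2) by blast
    then have "replicate L s \<in> {ws. set ws \<subseteq> S \<and> length ws = L}" by auto
    then show ?thesis by blast
  qed
  have card: "card {ws. set ws \<subseteq> S \<and> length ws = L} = card S ^ L" for L
    using card_lists_length_eq[OF assms(1)] by simp
  have "pmf (replicate_pmf L (pmf_of_set S)) ws = (if set ws \<subseteq> S \<and> length ws = L then 1 / real (card S) ^ L else 0)" for ws
  proof (induction L arbitrary: ws)
    case 0
    then show ?case by (auto simp: indicator_def)
  next
    case (Suc L)
    have e: "replicate_pmf (Suc L) (pmf_of_set S) =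
        map_pmf (\<lambda>(x, xs). x # xs) (pair_pmf (pmf_of_set S) (replicate_pmf L (pmf_of_set S)))"
      by (simp add: pair_pmf_def map_bind_pmf)
    show ?case
    proof (cases ws)
      case Nil
      have "[] \<notin> set_pmf (replicate_pmf (Suc L) (pmf_of_set S))" unfolding set_replicate_pmf by simp
      then show ?thesis using Nil by (simp add: pmf_eq_0_set_pmf del: replicate_pmf.simps)
    next
      case (Cons x xs)
      have "inj (\<lambda>(x, xs). x # xs :: 'a list)" by (auto simp: inj_def)
      then have "pmf (replicate_pmf (Suc L) (pmf_of_set S)) ((\<lambda>(x, xs). x # xs) (x, xs)) =
          pmf (pair_pmf (pmf_of_set S) (replicate_pmf L (pmf_of_set S))) (x, xs)"
        unfolding e by (rule pmf_map_inj')
      then show ?thesis using Cons Suc assms by (simp add: pmf_pair pmf_of_set indicator_def)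
    qed
  qed
  then show ?thesis
    by (intro pmf_eqI) (simp add: pmf_of_set[OF ne fin] card indicator_def)
qed

text \<open>Both counts are of order \<open>p\<^bsup>N - 1\<^esup>\<close>, the first one with blocks of length \<open>w\<close> of about \<open>p/N\<close>.\<close>

lemma factorisation_proportions:
  assumes N: "N \<ge> 2"
  defines "\<kappa> \<equiv> 1 / (4 * (2 * real N) ^ N)"
  assumes p: "prime p" "p \<ge> 2 * N + 6"
  shows "\<kappa> * real p ^ (N - 1) \<le> real (card {c\<in>coeff_box p N. irreducible_quadratic_times_linears p N (poly_with_coeffs N c)})"
    and "N \<ge> 3 \<Longrightarrow> \<kappa> * real p ^ (N - 1) \<le> real (card {c\<in>coeff_box p N. linear_times_irreducible p N (poly_with_coeffs N c)})"
proof -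
  have N1: "real N \<ge> 2" using N by simp
  define w where "w = (p - 3) div N"
  have "N * w \<le> p - 3" unfolding w_def by simp
  then have w3: "N * w + 3 \<le> p" using p(2) by linarith
  have "p - 3 < N * w + N" unfolding w_def using N dividend_less_times_div[of N "p - 3"] by (simp add: add.commute)
  then have "real p \<le> real N * real w + real N + 3"
    using of_nat_mono[of p "N * w + N + 3", where 'a = real] by simp
  moreover have "real p \<ge> 2 * real N + 6" using of_nat_mono[OF p(2), where 'a = real] by simp
  ultimately have "real p \<le> 2 * real N * real w" by linarith
  then have wl: "real p / (2 * real N) \<le> real w" using N1 by (simp add: field_simps)
  have p1: "real p / 2 \<le> real (p - 1)" using p(2) by (simp add: of_nat_diff)
  have pow: "(2 * real N) ^ (N - 2) \<le> (2 * real N) ^ N" using N1 by (intro power_increasing) auto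
  have "\<kappa> * real p ^ (N - 1) \<le> (1 / (4 * (2 * real N) ^ (N - 2))) * real p ^ (N - 1)"
    unfolding \<kappa>_def using pow N1 by (intro mult_right_mono divide_left_mono mult_left_mono mult_pos_pos) auto
  also have "\<dots> = (real p / (2 * real N)) ^ (N - 2) * (real p / 2) / 2"
  proof -
    have "N - 1 = Suc (N - 2)" using N by simp
    then show ?thesis by (simp add: power_divide)
  qed
  also have "\<dots> \<le> real w ^ (N - 2) * real (p - 1) / 2"
    using wl p1 N1 by (intro divide_right_mono mult_mono power_mono) auto
  also have "\<dots> \<le> real (card {c\<in>coeff_box p N. irreducible_quadratic_times_linears p N (poly_with_coeffs N c)})"
  proof -
    have "real (w ^ (N - 2) * (p - 1)) \<le> real (2 * card {c\<in>coeff_box p N. irreducible_quadratic_times_linears p N (poly_with_coeffs N c)})"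
      using count_irreducible_quadratic_times_linears[OF N p(1) w3] by (simp only: of_nat_le_iff)
    then show ?thesis by simp
  qed
  finally show "\<kappa> * real p ^ (N - 1) \<le> real (card {c\<in>coeff_box p N. irreducible_quadratic_times_linears p N (poly_with_coeffs N c)})" .
  assume N3: "N \<ge> 3"
  obtain P where "residue_prime p P" using ex_residue_prime[OF p(1)] by blast
  then have "p ^ (N - 1) \<le> 2 * N * card {c\<in>coeff_box p N. linear_times_irreducible p N (poly_with_coeffs N c)}"
    using residue_prime.count_linear_times_irreducible[of p P N] N3 p(2) by simp
  then have "real p ^ (N - 1) \<le> 2 * real N * real (card {c\<in>coeff_box p N. linear_times_irreducible p N (poly_with_coeffs N c)})"
    by (metis (mono_tags, lifting) of_nat_le_iff of_nat_mult of_nat_numeral of_nat_power)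
  then have "real p ^ (N - 1) / (2 * real N) \<le> real (card {c\<in>coeff_box p N. linear_times_irreducible p N (poly_with_coeffs N c)})"
    using N1 by (simp add: field_simps)
  moreover have "\<kappa> * real p ^ (N - 1) \<le> real p ^ (N - 1) / (2 * real N)"
  proof -
    have "(2 * real N) ^ 1 \<le> (2 * real N) ^ N" using N1 N by (intro power_increasing) auto
    then have "2 * real N \<le> (2 * real N) ^ N" by (simp only: power_one_right)
    also have "\<dots> \<le> 4 * (2 * real N) ^ N" using zero_le_power[of "2 * real N" N] N1 by linarith
    finally have "2 * real N \<le> 4 * (2 * real N) ^ N" .
    then have "\<kappa> \<le> 1 / (2 * real N)" unfolding \<kappa>_def using N1 by (intro divide_left_mono mult_pos_pos zero_less_power) auto
    then have "\<kappa> * real p ^ (N - 1) \<le> 1 / (2 * real N) * real p ^ (N - 1)" by (intro mult_right_mono) auto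
    then show ?thesis by simp
  qed
  ultimately show "\<kappa> * real p ^ (N - 1) \<le> real (card {c\<in>coeff_box p N. linear_times_irreducible p N (poly_with_coeffs N c)})"
    by linarith
qed

theorem theorem7p1:
  fixes N :: nat and S :: "int mat set"
  assumes "N \<ge> 2"
    and "finite S"
    and "S \<subseteq> carrier (SL N)"
    and "generate (SL N) S = carrier (SL N)"
  shows "(\<lambda>L. measure_pmf.prob (random_letters S L)
            {ws. has_full_symmetric_galois_group
                   (map_poly rat_of_int (char_poly (word_product N ws)))})
         \<longlonglongrightarrow> 1"
proof (rule LIMSEQ_I)
  fix \<epsilon> :: real assume \<epsilon>: "\<epsilon> > 0"
  define good where "good ws \<longleftrightarrow> has_full_symmetric_galois_group (map_poly rat_of_int (char_poly (word_product N ws)))" for ws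
  define C where "C = real ((N * Suc N) * (N * N) * (N * N))"
  define \<kappa> where "\<kappa> = 1 / (4 * (2 * real N) ^ N)"
  have "(2 * real N) ^ N \<ge> 1" using assms(1) by (intro one_le_power) auto
  then have \<kappa>: "0 < \<kappa>" "\<kappa> \<le> 1" by (auto simp: \<kappa>_def field_simps)
  \<comment> \<open>Many primes make it unlikely that a factorisation pattern occurs modulo none of them.\<close>
  have "(\<lambda>r. (1 - \<kappa>) ^ r) \<longlonglongrightarrow> 0" using \<kappa> by (intro LIMSEQ_realpow_zero) auto
  then have "eventually (\<lambda>r. (1 - \<kappa>) ^ r < \<epsilon> / 8) sequentially" using \<epsilon> by (intro order_tendstoD) auto
  then obtain r0 where r0: "\<And>r. r \<ge> r0 \<Longrightarrow> (1 - \<kappa>) ^ r < \<epsilon> / 8" by (auto simp: eventually_sequentially)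
  have r: "(1 - \<kappa>) ^ Suc r0 < \<epsilon> / 8" by (rule r0) simp
  \<comment> \<open>Large primes make it unlikely that the first basis vector fails to be cyclic.\<close>
  obtain B0 :: nat where B0: "real B0 > 8 * C * real (Suc r0) / \<epsilon>" using reals_Archimedean2 by blast
  define B where "B = max B0 (max (2 * N + 6) (N * N ^ N))"
  have "infinite {p :: nat. prime p \<and> p > B}"
  proof
    assume f: "finite {p :: nat. prime p \<and> p > B}"
    have "{p :: nat. prime p} \<subseteq> {..B} \<union> {p. prime p \<and> p > B}" by auto
    then have "finite {p :: nat. prime p}" using f by (meson finite_Un finite_atMost finite_subset)
    then show False using primes_infinite by simp
  qed
  then obtain Pr where Pr: "finite Pr" "card Pr = Suc r0" "Pr \<subseteq> {p :: nat. prime p \<and> p > B}"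
    using infinite_arbitrarily_large by blast
  have Prp: "prime p" "p > B0" "p > 2 * N + 6" "p > N * N ^ N" if "p \<in> Pr" for p
    using Pr(3) that by (auto simp: B_def)
  define m where "m = (\<Prod>p\<in>Pr. int p)"
  have "Pr \<noteq> {}" using Pr(2) by auto
  have cop: "coprime 12 m"
    unfolding m_def
  proof (rule prod_coprime_right)
    fix p assume p: "p \<in> Pr"
    have "coprime p 12"
    proof (rule prime_imp_coprime[OF Prp(1)[OF p]])
      show "\<not> p dvd 12" using Prp(3)[OF p] assms(1) Prp(1)[OF p]
      proof -
        have "p \<noteq> 12" using Prp(1)[OF p] by auto
        have "p = 11 \<or> p \<ge> 13" using Prp(3)[OF p] assms(1) \<open>p \<noteq> 12\<close> by linarith
        then show ?thesis by (auto dest: dvd_imp_le)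
      qed
    qed
    then show "coprime (12::int) (int p)" by (metis coprime_commute coprime_int_iff of_nat_numeral)
  qed
  have m1: "m > 1"
  proof -
    obtain p where p: "p \<in> Pr" using \<open>Pr \<noteq> {}\<close> by blast
    have "m > 0" unfolding m_def using Prp(1) prime_gt_0_nat by (intro prod_pos) auto
    moreover have "int p dvd m" unfolding m_def using p Pr(1) by auto
    ultimately have "int p \<le> m" by (simp add: zdvd_imp_le)
    then show ?thesis using prime_gt_1_nat[OF Prp(1)[OF p]] by linarith
  qed
  interpret SL_words N S m by unfold_locales (use assms m1 cop in auto)
  obtain n M where M: "M = values n" "n > 0" "M \<lhd> SL_mod N m" "comm_group (SL_mod N m Mod M)"
    by (rule word_subgroup)
  define Q where "Q = {h. (\<forall>p\<in>Pr. \<not> irreducible_quadratic_times_linears p N (char_poly h)) \<or>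
      N \<ge> 3 \<and> (\<forall>p\<in>Pr. \<not> linear_times_irreducible p N (char_poly h))}"
  have often: "\<kappa> * real p ^ (N - 1) \<le> real (card {c\<in>coeff_box p N. irreducible_quadratic_times_linears p N (poly_with_coeffs N c)})"
    "N \<ge> 3 \<Longrightarrow> \<kappa> * real p ^ (N - 1) \<le> real (card {c\<in>coeff_box p N. linear_times_irreducible p N (poly_with_coeffs N c)})"
    if "p \<in> Pr" for p
    unfolding \<kappa>_def using factorisation_proportions[OF assms(1) Prp(1)[OF that]] Prp(3)[OF that] by auto
  define u where "u = (\<Sum>p\<in>Pr. C / real p) + (1 - \<kappa>) ^ card Pr"
  have finM: "finite M" unfolding M(1) by (rule finite_values)
  have uQ: "real (card {t\<in>M. a \<otimes>\<^bsub>SL_mod N m\<^esub> t \<in> Q}) \<le> 2 * u * real (card M)"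
    if a: "a \<in> carrier (SL_mod N m)" for a
  proof -
    let ?A = "{t\<in>M. \<forall>p\<in>Pr. \<not> irreducible_quadratic_times_linears p N (char_poly (a \<otimes>\<^bsub>SL_mod N m\<^esub> t))}"
    let ?B = "{t\<in>M. N \<ge> 3 \<and> (\<forall>p\<in>Pr. \<not> linear_times_irreducible p N (char_poly (a \<otimes>\<^bsub>SL_mod N m\<^esub> t)))}"
    have u0: "u \<ge> 0" unfolding u_def C_def using \<kappa> by (intro add_nonneg_nonneg sum_nonneg) auto
    have A: "real (card ?A) \<le> u * real (card M)"
      unfolding u_def C_def
      by (rule card_all_primes_fail[OF Pr(1) Prp(1) m_def M(3,4) a irreducible_quadratic_times_linears_cong \<kappa>(2) often(1)])
    have B: "real (card ?B) \<le> u * real (card M)"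
    proof (cases "N \<ge> 3")
      case True
      have "real (card {t\<in>M. \<forall>p\<in>Pr. \<not> linear_times_irreducible p N (char_poly (a \<otimes>\<^bsub>SL_mod N m\<^esub> t))}) \<le> u * real (card M)"
        unfolding u_def C_def
        by (rule card_all_primes_fail[OF Pr(1) Prp(1) m_def M(3,4) a linear_times_irreducible_cong \<kappa>(2) often(2)[OF _ True]])
      then show ?thesis using True by simp
    next
      case False
      then show ?thesis using u0 by simp
    qed
    have "{t\<in>M. a \<otimes>\<^bsub>SL_mod N m\<^esub> t \<in> Q} = ?A \<union> ?B" by (auto simp: Q_def)
    then have "card {t\<in>M. a \<otimes>\<^bsub>SL_mod N m\<^esub> t \<in> Q} \<le> card ?A + card ?B" by (simp only: card_Un_le)
    then have "real (card {t\<in>M. a \<otimes>\<^bsub>SL_mod N m\<^esub> t \<in> Q}) \<le> real (card ?A) + real (card ?B)"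
      by (simp only: of_nat_add[symmetric] of_nat_le_iff)
    also have "\<dots> \<le> u * real (card M) + u * real (card M)" using A B by (rule add_mono)
    finally show ?thesis by (simp only: mult_2 distrib_right)
  qed
  have u: "2 * u \<le> \<epsilon> / 2"
  proof -
    have "(\<Sum>p\<in>Pr. C / real p) \<le> (\<Sum>p\<in>Pr. \<epsilon> / (8 * real (Suc r0)))"
    proof (rule sum_mono)
      fix p assume p: "p \<in> Pr"
      have "real p > 8 * C * real (Suc r0) / \<epsilon>" using B0 Prp(2)[OF p] by linarith
      then have "8 * C * real (Suc r0) \<le> real p * \<epsilon>" using \<epsilon> by (simp add: field_simps)
      moreover have "real p > 0" using Prp(2)[OF p] by simp
      ultimately show "C / real p \<le> \<epsilon> / (8 * real (Suc r0))" by (simp add: field_simps del: of_nat_Suc)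
    qed
    also have "\<dots> = \<epsilon> / 8" by (simp add: Pr(2) del: of_nat_Suc)
    finally have "u \<le> \<epsilon> / 8 + \<epsilon> / 8" unfolding u_def Pr(2) by (rule add_mono) (rule less_imp_le[OF r])
    then show ?thesis by simp
  qed
  obtain L0 where L0: "\<And>L. L \<ge> L0 \<Longrightarrow> real (card {ws\<in>words L. word_value ws \<in> Q}) / real (card S) ^ L \<le> 2 * u + \<epsilon> / 4"
    using word_mixing[OF M(1,3,2) uQ, of "\<epsilon> / 4"] \<epsilon> by auto
  have goodQ: "good ws" if ws: "ws \<in> words L" "word_value ws \<notin> Q" for ws L
  proof -
    define A where "A = word_product N ws"
    have v: "word_value ws = reduce_mat m A" "A \<in> carrier (SL N)"
      using word_value_eq[of ws] ws(1) by (auto simp: words_def A_def simp del: SL_simps)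
    have Ac: "A \<in> carrier_mat N N" "Determinant.det A = 1" using v(2) by auto
    have cong: "int p dvd coeff (char_poly A) k - coeff (char_poly (reduce_mat m A)) k" if p: "p \<in> Pr" for p k
    proof -
      have "int p dvd m" unfolding m_def using p Pr(1) by auto
      then have "cong_mat N (int p) A (reduce_mat m A)"
        using cong_mat_dvd cong_mat_sym[OF cong_reduce_mat[OF Ac(1)]] by blast
      then show ?thesis by (rule cong_mat_char_poly)
    qed
    obtain p where p: "p \<in> Pr" "irreducible_quadratic_times_linears p N (char_poly (reduce_mat m A))"
      using ws(2) v(1) by (auto simp: Q_def)
    obtain q where q: "q \<in> Pr" "N \<ge> 3 \<Longrightarrow> linear_times_irreducible q N (char_poly (reduce_mat m A))"
      using ws(2) v(1) p(1) by (auto simp: Q_def)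
    have deg: "Polynomial.degree (char_poly A) = N" "coeff (char_poly A) N = 1"
      using degree_monic_char_poly[OF Ac(1)] by auto
    interpret monic_int_poly "char_poly A" by unfold_locales (simp add: deg)
    have "has_full_symmetric_galois_group F"
    proof (rule full_symmetric_galois_group[OF deg(1) assms(1)])
      show "\<bar>coeff (char_poly A) 0\<bar> = 1" using char_poly_coeff_0[OF Ac(1)] Ac(2) by simp
      show "irreducible_quadratic_times_linears p N (char_poly A)"
        by (rule irreducible_quadratic_times_linears_cong[OF cong[OF p(1)] p(2)])
      show "linear_times_irreducible q N (char_poly A)" if "N \<ge> 3"
        by (rule linear_times_irreducible_cong[OF cong[OF q(1)] q(2)[OF that]])
    qed (use Prp p(1) q(1) in auto)
    then show ?thesis by (simp add: good_def A_def)
  qed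
  have prob: "1 - \<epsilon> < measure_pmf.prob (random_letters S L) {ws. good ws}" if L: "L \<ge> L0" for L
  proof -
    have ne: "words L \<noteq> {}" and cS: "real (card S) ^ L > 0"
    proof -
      have "card S > 0" using finite_S S_nonempty by (simp add: card_gt_0_iff)
      then show "real (card S) ^ L > 0" by simp
      then show "words L \<noteq> {}" using card_words[of L] by (metis card.empty less_irrefl of_nat_0 of_nat_power)
    qed
    have "words L - {ws\<in>words L. word_value ws \<in> Q} \<subseteq> words L \<inter> {ws. good ws}" using goodQ by auto
    then have "card (words L - {ws\<in>words L. word_value ws \<in> Q}) \<le> card (words L \<inter> {ws. good ws})"
      by (intro card_mono) auto
    moreover have "card (words L - {ws\<in>words L. word_value ws \<in> Q}) = card (words L) - card {ws\<in>words L. word_value ws \<in> Q}"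
      by (intro card_Diff_subset) auto
    ultimately have "real (card (words L)) - real (card {ws\<in>words L. word_value ws \<in> Q}) \<le> real (card (words L \<inter> {ws. good ws}))"
      by linarith
    then have "(real (card (words L)) - real (card {ws\<in>words L. word_value ws \<in> Q})) / real (card S) ^ L \<le>
        real (card (words L \<inter> {ws. good ws})) / real (card S) ^ L"
      using cS by (intro divide_right_mono) auto
    moreover have "(real (card (words L)) - real (card {ws\<in>words L. word_value ws \<in> Q})) / real (card S) ^ L =
        1 - real (card {ws\<in>words L. word_value ws \<in> Q}) / real (card S) ^ L"
      using cS by (simp add: diff_divide_distrib card_words)
    moreover have "measure_pmf.prob (random_letters S L) {ws. good ws} = real (card (words L \<inter> {ws. good ws})) / real (card S) ^ L"
    proof -
      have "random_letters S L = pmf_of_set (words L)"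
        unfolding random_letters_def words_def by (rule replicate_pmf_of_set[OF finite_S S_nonempty])
      then show ?thesis using ne by (simp add: measure_pmf_of_set card_words)
    qed
    ultimately have "1 - real (card {ws\<in>words L. word_value ws \<in> Q}) / real (card S) ^ L \<le>
        measure_pmf.prob (random_letters S L) {ws. good ws}" by simp
    then show ?thesis using L0[OF L] u \<epsilon> by linarith
  qed
  show "\<exists>no. \<forall>L\<ge>no. norm (measure_pmf.prob (random_letters S L)
            {ws. has_full_symmetric_galois_group
                   (map_poly rat_of_int (char_poly (word_product N ws)))} - 1) < \<epsilon>"
  proof (intro exI[of _ L0] allI impI)
    fix L assume "L \<ge> L0"
    from prob[OF this] measure_pmf.prob_le_1[of "random_letters S L" "{ws. good ws}"]
    show "norm (measure_pmf.prob (random_letters S L)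
            {ws. has_full_symmetric_galois_group
                   (map_poly rat_of_int (char_poly (word_product N ws)))} - 1) < \<epsilon>"
      by (simp add: good_def)
  qed
qed

end
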